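(* Let $d \in \mathbb{N}$, $\lambda = (d-1)/2$, and $f \in \mathcal{P}(\mathbb{S}^{d+1}\times\mathbb{R})$. Then $\mathcal{J}^\lambda_{+} f \in \mathcal{P}(\mathbb{S}^d\times\mathbb{R})$ and $\mathcal{J}^\lambda_{-} f \in \mathcal{P}(\mathbb{S}^d\times\mathbb{R})$.
   Context: $\mathbb{S}^d$ is the unit sphere in $\mathbb{R}^{d+1}$, with geodesic distance $d(\xi,\eta)=\arccos\langle \xi,\eta\rangle$. For $d \in \mathbb{N}=\{1,2,\dots\}$, $\mathcal{P}(\mathbb{S}^d\times\mathbb{R})$ denotes the class of continuous functions $f:[-1,1]\times\mathbb{R}\to\mathbb{R}$ such that the kernel $((\xi,s),(\eta,t)) \mapsto f(\cos d(\xi,\eta),\, s-t)$ is positive definite on $\mathbb{S}^d\times\mathbb{R}$, i.e. $\sum_{i,j} c_i \overline{c_j} f(\langle \xi_i,\xi_j\rangle, t_i-t_j)\ge 0$ for all finite families of points $(\xi_i,t_i)\in\mathbb{S}^d\times\mathbb{R}$ and scalars $c_i \in \mathbb{C}$. For $\lambda \ge 0$ and continuous $f:[-1,1]\times\mathbb{R}\to\mathbb{R}$ the half-step operators (order $\alpha = 1/2$) are $$I^\lambda_+ f(x,t) := (1+x)^{-\lambda+\frac12}\int_{-1}^x (x-u)^{-\frac12}(1+u)^{\lambda} f(u,t)\,\mathrm{d}u,$$ $$I^\lambda_- f(x,t) := (1-x)^{-\lambda+\frac12}\int_{x}^1 (u-x)^{-\frac12}(1-u)^{\lambda} f(u,t)\,\mathrm{d}u,$$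 with values at $x=-1$ (for $I^\lambda_+$) and $x=1$ (for $I^\lambda_-$) understood by continuous extension, and $\mathcal{J}^\lambda_{\pm} f := I^\lambda_+ f \pm I^\lambda_- f$. *)

theory Defs
  imports "HOL-Analysis.Analysis"
begin

text \<open>
  The statement relates the spheres of two consecutive dimensions, with the dimension an arbitrary
  natural number. So points of \<open>\<real>\<^bsup>d+1\<^esup>\<close> are functions on \<open>nat\<close> with coordinates \<open>0, \<dots>, d\<close>;
  the remaining values are normalised to \<open>0\<close>, which makes the representation unique.
\<close>

definition unit_sphere :: "nat \<Rightarrow> (nat \<Rightarrow> real) set" where
  "unit_sphere d = {\<xi>. (\<forall>i>d. \<xi> i = 0) \<and> (\<Sum>i\<le>d. (\<xi> i)\<^sup>2) = 1}"

definition dot :: "nat \<Rightarrow> (nat \<Rightarrow> real) \<Rightarrow> (nat \<Rightarrow> real) \<Rightarrow> real" where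
  "dot d \<xi> \<eta> = (\<Sum>i\<le>d. \<xi> i * \<eta> i)"

definition geodesic_dist :: "nat \<Rightarrow> (nat \<Rightarrow> real) \<Rightarrow> (nat \<Rightarrow> real) \<Rightarrow> real" where
  "geodesic_dist d \<xi> \<eta> = arccos (dot d \<xi> \<eta>)"

text \<open>
  The points \<open>p i\<close> need not be distinct. As the coefficients are complex, membership in
  \<open>\<real>\<^sub>\<ge>\<^sub>0\<close> also says that the quadratic form is real, so that the kernel is Hermitian.
\<close>

definition pos_def_kernel :: "'a set \<Rightarrow> ('a \<Rightarrow> 'a \<Rightarrow> real) \<Rightarrow> bool" where
  "pos_def_kernel X K \<longleftrightarrow>
     (\<forall>(n::nat) (p :: nat \<Rightarrow> 'a) (c :: nat \<Rightarrow> complex). (\<forall>i<n. p i \<in> X) \<longrightarrow>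
        (\<Sum>i<n. \<Sum>j<n. c i * cnj (c j) * complex_of_real (K (p i) (p j))) \<in> \<real>\<^sub>\<ge>\<^sub>0)"

text \<open>
  The class \<open>\<P>(S\<^sup>d \<times> \<real>)\<close>. Its members are functions on \<open>[-1,1] \<times> \<real>\<close>; the values of \<open>f x t\<close> for
  \<open>x\<close> outside \<open>[-1,1]\<close> are irrelevant.
\<close>

definition pd_class :: "nat \<Rightarrow> (real \<Rightarrow> real \<Rightarrow> real) set" where
  "pd_class d =
     {f. continuous_on ({-1..1} \<times> UNIV) (\<lambda>(x, t). f x t) \<and>
         pos_def_kernel (unit_sphere d \<times> (UNIV :: real set))
           (\<lambda>(\<xi>, s) (\<eta>, t). f (cos (geodesic_dist d \<xi> \<eta>)) (s - t))}"

text \<open>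
  The two integral operators are first given by their formulas, which are meant for \<open>x > -1\<close> and
  \<open>x < 1\<close> respectively, and then extended to the end point by the limit. The convention
  \<open>0 powr a = 0\<close> affects the integrands only at the end points of the interval of integration.
\<close>

definition I_plus_raw :: "real \<Rightarrow> (real \<Rightarrow> real \<Rightarrow> real) \<Rightarrow> real \<Rightarrow> real \<Rightarrow> real" where
  "I_plus_raw l f x t =
     (1 + x) powr (- l + 1/2) *
     (LBINT u:{-1..x}. (x - u) powr (- (1/2)) * (1 + u) powr l * f u t)"

definition I_minus_raw :: "real \<Rightarrow> (real \<Rightarrow> real \<Rightarrow> real) \<Rightarrow> real \<Rightarrow> real \<Rightarrow> real" where
  "I_minus_raw l f x t =
     (1 - x) powr (- l + 1/2) *
     (LBINT u:{x..1}. (u - x) powr (- (1/2)) * (1 - u) powr l * f u t)"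

definition I_plus :: "real \<Rightarrow> (real \<Rightarrow> real \<Rightarrow> real) \<Rightarrow> real \<Rightarrow> real \<Rightarrow> real" where
  "I_plus l f x t =
     (if x = -1 then Lim (at_right (-1)) (\<lambda>y. I_plus_raw l f y t) else I_plus_raw l f x t)"

definition I_minus :: "real \<Rightarrow> (real \<Rightarrow> real \<Rightarrow> real) \<Rightarrow> real \<Rightarrow> real \<Rightarrow> real" where
  "I_minus l f x t =
     (if x = 1 then Lim (at_left 1) (\<lambda>y. I_minus_raw l f y t) else I_minus_raw l f x t)"

definition J_plus :: "real \<Rightarrow> (real \<Rightarrow> real \<Rightarrow> real) \<Rightarrow> real \<Rightarrow> real \<Rightarrow> real" where
  "J_plus l f x t = I_plus l f x t + I_minus l f x t"

definition J_minus :: "real \<Rightarrow> (real \<Rightarrow> real \<Rightarrow> real) \<Rightarrow> real \<Rightarrow> real \<Rightarrow> real" where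
  "J_minus l f x t = I_plus l f x t - I_minus l f x t"

end

theory Submission
  imports Defs "HOL-Computational_Algebra.Polynomial"
begin

text \<open>
  By Schoenberg's theorem a positive definite function \<open>f\<close> on \<open>S\<^bsup>d+1\<^esup> \<times> \<real>\<close> is a uniformly convergent
  series \<open>\<Sum>\<^sub>n a\<^sub>n(t) C\<^sub>n(x)\<close>, where the \<open>C\<^sub>n\<close> are the Gegenbauer polynomials of \<open>S\<^bsup>d+1\<^esup>\<close> and the \<open>a\<^sub>n\<close> are
  positive definite on \<open>\<real>\<close> (\<open>schoenberg_expansion\<close>). On a Gegenbauer polynomial of \<open>S\<^bsup>d+1\<^esup>\<close> the half-step
  operators act by
  \<open>I\<^sub>\<plusminus> C\<^sub>n = \<alpha>\<^sub>n D\<^sub>n \<plusminus> \<beta>\<^sub>n D\<^bsub>n+1\<^esub>\<close>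
  with positive \<open>\<alpha>\<^sub>n\<close> and \<open>\<beta>\<^sub>n\<close>, where the \<open>D\<^sub>n\<close> are the Gegenbauer polynomials of \<open>S\<^sup>d\<close>
  (\<open>half_plus_gegen\<close>). Hence the sum of the operators maps \<open>f\<close> to \<open>\<Sum>\<^sub>n 2 \<alpha>\<^sub>n a\<^sub>n D\<^sub>n\<close> and the difference maps
  it to \<open>\<Sum>\<^sub>n 2 \<beta>\<^sub>n a\<^sub>n D\<^bsub>n+1\<^esub>\<close>. By the Schur product theorem each term of these series is positive definite
  on \<open>S\<^sup>d \<times> \<real>\<close>.

  The formula for \<open>I\<^sub>\<plusminus> C\<^sub>n\<close> needs no explicit polynomials. The adjoint of \<open>I\<^sub>+\<close>, with respect to the
  weights of the two spheres, does not raise the degree (\<open>half_plus_adjoint\<close>), so \<open>I\<^sub>+ C\<^sub>n\<close>, of degree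
  \<open>n + 1\<close>, is orthogonal to all polynomials of degree less than \<open>n\<close>. The signs follow from the leading
  coefficient and from the zero of \<open>I\<^sub>+ C\<^sub>n\<close> at \<open>-1\<close>.

  Two facts about the sphere enter, and neither needs integration over the sphere.
  A positive definite zonal function has a nonnegative mean (\<open>zint_nonneg_of_zonal_psd\<close>); this goes by
  induction on the dimension, in spherical coordinates. It makes the \<open>a\<^sub>n\<close> positive definite and the
  series absolutely convergent. And the Gegenbauer polynomials are themselves positive definite
  (\<open>zonal_psd_gegen\<close>): minus the Laplacian preserves positive definiteness, and when it is applied again
  and again to \<open>x\<^sup>n\<close> the component of degree \<open>n\<close> dominates.
\<close>

section \<open>Positive definite kernels\<close>

text \<open>
  The kernels of the theorem are real. For a real symmetric kernel real coefficients suffice, and the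
  indexing by a set of points instead of a family makes it unnecessary to carry enumerations along.
\<close>

definition psd :: "'a set \<Rightarrow> ('a \<Rightarrow> 'a \<Rightarrow> real) \<Rightarrow> bool" where
  "psd X K \<longleftrightarrow> (\<forall>x\<in>X. \<forall>y\<in>X. K x y = K y x) \<and>
     (\<forall>F c. finite F \<longrightarrow> F \<subseteq> X \<longrightarrow> 0 \<le> (\<Sum>x\<in>F. \<Sum>y\<in>F. c x * c y * K x y))"

lemma psd_sym: "psd X K \<Longrightarrow> x \<in> X \<Longrightarrow> y \<in> X \<Longrightarrow> K x y = K y x"
  by (auto simp: psd_def)

lemma psd_nonneg: "psd X K \<Longrightarrow> finite F \<Longrightarrow> F \<subseteq> X \<Longrightarrow> 0 \<le> (\<Sum>x\<in>F. \<Sum>y\<in>F. c x * c y * K x y)"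
  by (auto simp: psd_def)

text \<open>Repeated points are allowed: their coefficients add up.\<close>

lemma psd_family:
  assumes K: "psd X K" and I: "finite I" and p: "\<And>i. i \<in> I \<Longrightarrow> p i \<in> X"
  shows "0 \<le> (\<Sum>i\<in>I. \<Sum>j\<in>I. c i * c j * K (p i) (p j))"
proof -
  define C where "C x = (\<Sum>i | i \<in> I \<and> p i = x. c i)" for x
  have collect: "(\<Sum>i\<in>I. c i * g (p i)) = (\<Sum>x\<in>p ` I. C x * g x)" for g :: "'a \<Rightarrow> real"
  proof -
    have "(\<Sum>i\<in>I. c i * g (p i)) = (\<Sum>x\<in>p ` I. \<Sum>i | i \<in> I \<and> p i = x. c i * g (p i))"
      by (rule sum.image_gen[OF I])
    also have "\<dots> = (\<Sum>x\<in>p ` I. C x * g x)"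
      unfolding C_def by (auto intro!: sum.cong simp: sum_distrib_right)
    finally show ?thesis .
  qed
  have "(\<Sum>i\<in>I. \<Sum>j\<in>I. c i * c j * K (p i) (p j))
      = (\<Sum>i\<in>I. c i * (\<Sum>j\<in>I. c j * K (p i) (p j)))"
    by (simp add: sum_distrib_left mult_ac)
  also have "\<dots> = (\<Sum>i\<in>I. c i * (\<Sum>y\<in>p ` I. C y * K (p i) y))"
    by (simp only: collect)
  also have "\<dots> = (\<Sum>x\<in>p ` I. C x * (\<Sum>y\<in>p ` I. C y * K x y))"
    by (rule collect)
  also have "\<dots> = (\<Sum>x\<in>p ` I. \<Sum>y\<in>p ` I. C x * C y * K x y)"
    by (simp add: sum_distrib_left mult_ac)
  also have "\<dots> \<ge> 0"
    using p by (intro psd_nonneg[OF K]) (auto simp: I)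
  finally show ?thesis .
qed

lemma pos_def_kernel_iff_psd: "pos_def_kernel X K \<longleftrightarrow> psd X K"
proof
  assume K: "pos_def_kernel X K"
  have ev: "(\<Sum>i<n. \<Sum>j<n. c i * cnj (c j) * complex_of_real (K (p i) (p j))) \<in> \<real>\<^sub>\<ge>\<^sub>0"
    if "\<forall>i<n. p i \<in> X" for n :: nat and p c
    using K that unfolding pos_def_kernel_def by blast
  show "psd X K"
    unfolding psd_def
  proof (intro conjI ballI allI impI)
    fix x y assume xy: "x \<in> X" "y \<in> X"
    \<comment> \<open>The coefficients \<open>1\<close> and \<open>\<i>\<close> make \<open>K y x - K x y\<close> the imaginary part of the form.\<close>
    have "(\<Sum>i<(2::nat). \<Sum>j<(2::nat). (if i = 0 then 1 else \<i>) * cnj (if j = 0 then 1 else \<i>) *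
        complex_of_real (K (if i = 0 then x else y) (if j = 0 then x else y))) \<in> \<real>\<^sub>\<ge>\<^sub>0"
      by (rule ev) (use xy in auto)
    then show "K x y = K y x"
      by (simp add: numeral_2_eq_2 complex_nonneg_Reals_iff)
  next
    fix F :: "'a set" and c :: "'a \<Rightarrow> real"
    assume F: "finite F" "F \<subseteq> X"
    obtain g where g: "bij_betw g {..<card F} F"
      using F(1) ex_bij_betw_nat_finite[of F] by (auto simp: lessThan_atLeast0)
    have "(\<Sum>i<card F. \<Sum>j<card F. of_real (c (g i)) * cnj (of_real (c (g j))) *
        complex_of_real (K (g i) (g j))) \<in> \<real>\<^sub>\<ge>\<^sub>0"
      by (rule ev) (use g F(2) in \<open>auto simp: bij_betw_def\<close>)
    then have "complex_of_real (\<Sum>i<card F. \<Sum>j<card F. c (g i) * c (g j) * K (g i) (g j)) \<in> \<real>\<^sub>\<ge>\<^sub>0"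
      by simp
    then have "0 \<le> (\<Sum>i<card F. \<Sum>j<card F. c (g i) * c (g j) * K (g i) (g j))"
      by (simp only: nonneg_Reals_of_real_iff)
    also have "\<dots> = (\<Sum>i<card F. \<Sum>y\<in>F. c (g i) * c y * K (g i) y)"
      by (intro sum.cong refl sum.reindex_bij_betw[OF g, of "\<lambda>y. c (g _) * c y * K (g _) y"])
    also have "\<dots> = (\<Sum>x\<in>F. \<Sum>y\<in>F. c x * c y * K x y)"
      by (rule sum.reindex_bij_betw[OF g, of "\<lambda>x. \<Sum>y\<in>F. c x * c y * K x y"])
    finally show "0 \<le> (\<Sum>x\<in>F. \<Sum>y\<in>F. c x * c y * K x y)" .
  qed
next
  assume K: "psd X K"
  show "pos_def_kernel X K"
    unfolding pos_def_kernel_def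
  proof (intro allI impI)
    fix n :: nat and p :: "nat \<Rightarrow> 'a" and c :: "nat \<Rightarrow> complex"
    assume p: "\<forall>i<n. p i \<in> X"
    let ?S = "\<Sum>i<n. \<Sum>j<n. c i * cnj (c j) * complex_of_real (K (p i) (p j))"
    have "Re ?S = (\<Sum>i<n. \<Sum>j<n. Re (c i) * Re (c j) * K (p i) (p j)) +
                  (\<Sum>i<n. \<Sum>j<n. Im (c i) * Im (c j) * K (p i) (p j))"
      by (simp add: sum.distrib algebra_simps)
    also have "\<dots> \<ge> 0"
      using p by (intro add_nonneg_nonneg psd_family[OF K]) auto
    finally have re: "Re ?S \<ge> 0" .
    have "(\<Sum>i<n. \<Sum>j<n. Re (c i) * Im (c j) * K (p i) (p j))
        = (\<Sum>i<n. \<Sum>j<n. Re (c j) * Im (c i) * K (p j) (p i))"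
      by (rule sum.swap)
    also have "\<dots> = (\<Sum>i<n. \<Sum>j<n. Im (c i) * Re (c j) * K (p i) (p j))"
      using p psd_sym[OF K] by (auto intro!: sum.cong)
    finally have swap: "(\<Sum>i<n. \<Sum>j<n. Re (c i) * Im (c j) * K (p i) (p j))
        = (\<Sum>i<n. \<Sum>j<n. Im (c i) * Re (c j) * K (p i) (p j))" .
    have "Im ?S = (\<Sum>i<n. \<Sum>j<n. Im (c i) * Re (c j) * K (p i) (p j)) -
                  (\<Sum>i<n. \<Sum>j<n. Re (c i) * Im (c j) * K (p i) (p j))"
      by (simp add: sum_subtractf sum.distrib algebra_simps)
    then have "Im ?S = 0" by (simp only: swap diff_self)
    with re show "?S \<in> \<real>\<^sub>\<ge>\<^sub>0"
      by (simp add: complex_nonneg_Reals_iff)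
  qed
qed

lemma psd_cong:
  "psd X K \<Longrightarrow> (\<And>x y. x \<in> X \<Longrightarrow> y \<in> X \<Longrightarrow> K x y = L x y) \<Longrightarrow> psd X L"
  unfolding psd_def
proof (safe, goal_cases)
  case (2 F c)
  have "(\<Sum>x\<in>F. \<Sum>y\<in>F. c x * c y * L x y) = (\<Sum>x\<in>F. \<Sum>y\<in>F. c x * c y * K x y)"
    using 2 by (intro sum.cong refl) (auto simp: subset_iff)
  then show ?case using 2 by auto
qed auto

lemma psd_rank_one: "psd X (\<lambda>x y. g x * g y)"
  unfolding psd_def
proof (safe, goal_cases)
  case (2 F c)
  have "(\<Sum>x\<in>F. \<Sum>y\<in>F. c x * c y * (g x * g y)) = (\<Sum>x\<in>F. c x * g x)\<^sup>2"
    by (simp add: power2_eq_square sum_product mult_ac)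
  then show ?case by simp
qed auto

lemma psd_sum:
  assumes "\<And>i. i \<in> I \<Longrightarrow> psd X (K i)"
  shows "psd X (\<lambda>x y. \<Sum>i\<in>I. K i x y)"
  unfolding psd_def
proof (safe, goal_cases)
  case (1 x y)
  then show ?case by (intro sum.cong refl psd_sym[OF assms])
next
  case (2 F c)
  have "(\<Sum>x\<in>F. \<Sum>y\<in>F. c x * c y * (\<Sum>i\<in>I. K i x y))
      = (\<Sum>i\<in>I. \<Sum>x\<in>F. \<Sum>y\<in>F. c x * c y * K i x y)"
    by (simp add: sum_distrib_left sum.swap[where B=I])
  also have "\<dots> \<ge> 0"
    using assms 2 by (intro sum_nonneg psd_nonneg) auto
  finally show ?case .
qed

lemma psd_scale:
  assumes "psd X K" "a \<ge> 0"
  shows "psd X (\<lambda>x y. a * K x y)"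
  unfolding psd_def
proof (safe, goal_cases)
  case (1 x y)
  then show ?case using assms by (auto simp: psd_sym)
next
  case (2 F c)
  have "(\<Sum>x\<in>F. \<Sum>y\<in>F. c x * c y * (a * K x y)) = a * (\<Sum>x\<in>F. \<Sum>y\<in>F. c x * c y * K x y)"
    by (simp add: sum_distrib_left mult_ac)
  also have "\<dots> \<ge> 0"
    using assms 2 by (intro mult_nonneg_nonneg psd_nonneg) auto
  finally show ?case .
qed

lemma psd_limit:
  assumes K: "\<forall>\<^sub>F n in F. psd X (K n)" and F: "F \<noteq> bot"
    and lim: "\<And>x y. x \<in> X \<Longrightarrow> y \<in> X \<Longrightarrow> ((\<lambda>n. K n x y) \<longlongrightarrow> L x y) F"
  shows "psd X L"
  unfolding psd_def
proof (safe, goal_cases)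
  case (1 x y)
  have "((\<lambda>n. K n x y) \<longlongrightarrow> L y x) F"
    by (rule Lim_transform_eventually[OF lim[OF 1(2,1)]])
       (use K 1 in \<open>auto elim!: eventually_mono simp: psd_sym\<close>)
  then show ?case using lim[OF 1] F tendsto_unique by blast
next
  case (2 G c)
  have "((\<lambda>n. \<Sum>x\<in>G. \<Sum>y\<in>G. c x * c y * K n x y) \<longlongrightarrow> (\<Sum>x\<in>G. \<Sum>y\<in>G. c x * c y * L x y)) F"
    using 2 by (intro tendsto_intros lim) auto
  then show ?case
    by (rule tendsto_lowerbound) (use K 2 F in \<open>auto elim!: eventually_mono intro: psd_nonneg\<close>)
qed

text \<open>
  This covers restriction of a kernel along a map (one summand) and, with several summands, every
  kernel \<open>(x, y) \<mapsto> \<langle>\<mu>\<^sub>x, K \<mu>\<^sub>y\<rangle>\<close> obtained by attaching to each point a finite signed measure.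
\<close>

lemma psd_lincomb:
  assumes K: "psd X K" and A: "finite A" and g: "\<And>a y. a \<in> A \<Longrightarrow> y \<in> Y \<Longrightarrow> g a y \<in> X"
  shows "psd Y (\<lambda>x y. \<Sum>a\<in>A. \<Sum>b\<in>A. w a * w b * K (g a x) (g b y))"
  unfolding psd_def
proof (safe, goal_cases)
  case (1 x y)
  have "(\<Sum>a\<in>A. \<Sum>b\<in>A. w a * w b * K (g a x) (g b y)) = (\<Sum>a\<in>A. \<Sum>b\<in>A. w b * w a * K (g b x) (g a y))"
    by (rule sum.swap)
  also have "\<dots> = (\<Sum>a\<in>A. \<Sum>b\<in>A. w a * w b * K (g a y) (g b x))"
    using 1 g psd_sym[OF K] by (auto intro!: sum.cong)
  finally show ?case .
next
  case (2 F c)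
  have "(\<Sum>x\<in>F. \<Sum>y\<in>F. c x * c y * (\<Sum>a\<in>A. \<Sum>b\<in>A. w a * w b * K (g a x) (g b y)))
      = (\<Sum>x\<in>F. \<Sum>a\<in>A. \<Sum>y\<in>F. \<Sum>b\<in>A. c x * c y * (w a * w b * K (g a x) (g b y)))"
    by (simp add: sum_distrib_left sum.swap[of _ A F])
  also have "\<dots> = (\<Sum>(x, a)\<in>F \<times> A. \<Sum>(y, b)\<in>F \<times> A. c x * c y * (w a * w b * K (g a x) (g b y)))"
    by (simp only: sum.cartesian_product[symmetric])
  also have "\<dots> = (\<Sum>p\<in>F \<times> A. \<Sum>r\<in>F \<times> A. (c (fst p) * w (snd p)) * (c (fst r) * w (snd r)) *
      K (g (snd p) (fst p)) (g (snd r) (fst r)))"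
    by (simp add: case_prod_unfold mult_ac)
  also have "\<dots> \<ge> 0"
    using 2 A g by (intro psd_family[OF K]) auto
  finally show ?case .
qed

lemma psd_pullback:
  assumes "psd X K" "\<And>y. y \<in> Y \<Longrightarrow> g y \<in> X"
  shows "psd Y (\<lambda>x y. K (g x) (g y))"
  using psd_lincomb[OF assms(1), of "{()}" Y "\<lambda>_. g" "\<lambda>_. 1"] assms(2) by simp

lemma psd_diag: "psd X K \<Longrightarrow> x \<in> X \<Longrightarrow> 0 \<le> K x x"
  using psd_nonneg[of X K "{x}" "\<lambda>_. 1"] by simp

lemma psd_abs_le:
  assumes K: "psd X K" "x \<in> X" "y \<in> X" and eq: "K x x = m" "K y y = m"
  shows "\<bar>K x y\<bar> \<le> m"
proof -
  have "0 \<le> (\<Sum>i\<in>{True,False}. \<Sum>j\<in>{True,False}. (if i then 1 else s) * (if j then 1 else s) *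
      K (if i then x else y) (if j then x else y))" for s :: real
    by (rule psd_family[OF K(1)]) (use K in auto)
  from this[of 1] this[of "-1"] show ?thesis
    using psd_sym[OF K] by (simp add: eq abs_if)
qed

text \<open>
  Finite Gram representation, by elimination of one point at a time: after subtraction of the
  rank one kernel that matches the row of \<open>z\<close>, the rest is still positive (complete the square).
\<close>

lemma psd_finite_gram:
  assumes "finite F" "psd F K"
  shows "\<exists>(n::nat) g. \<forall>x\<in>F. \<forall>y\<in>F. K x y = (\<Sum>k<n. g k x * g k y)"
  using assms
proof (induction F arbitrary: K rule: finite_induct)
  case empty
  then show ?case by auto
next
  case (insert z F)
  define v where "v x = K z x / sqrt (K z z)" for x
  have sym: "K x y = K y x" if "x \<in> insert z F" "y \<in> insert z F" for x y
    using psd_sym[OF insert.prems] that .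
  have zz: "K z z \<ge> 0"
    by (rule psd_diag[OF insert.prems]) simp
  have ext: "0 \<le> s * s * K z z + 2 * s * (\<Sum>x\<in>F. c x * K z x) + (\<Sum>x\<in>F. \<Sum>y\<in>F. c x * c y * K x y)"
    for s and c :: "'a \<Rightarrow> real"
  proof -
    have "0 \<le> (\<Sum>x\<in>insert z F. \<Sum>y\<in>insert z F. (c(z := s)) x * (c(z := s)) y * K x y)"
      by (rule psd_nonneg[OF insert.prems]) (use insert.hyps in auto)
    also have "\<dots> = s * s * K z z + s * (\<Sum>x\<in>F. c x * K z x) + (s * (\<Sum>x\<in>F. c x * K x z) + (\<Sum>x\<in>F. \<Sum>y\<in>F. c x * c y * K x y))"
    proof -
      have F: "(\<Sum>y\<in>F. (c(z := s)) y * h y) = (\<Sum>y\<in>F. c y * h y)" for h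
        using insert.hyps by (intro sum.cong) auto
      have "(\<Sum>x\<in>insert z F. \<Sum>y\<in>insert z F. (c(z := s)) x * (c(z := s)) y * K x y)
          = (\<Sum>x\<in>insert z F. (c(z := s)) x * (\<Sum>y\<in>insert z F. (c(z := s)) y * K x y))"
        by (simp only: sum_distrib_left mult.assoc)
      also have "\<dots> = s * (s * K z z + (\<Sum>y\<in>F. c y * K z y)) +
          (\<Sum>x\<in>F. c x * (s * K x z + (\<Sum>y\<in>F. c y * K x y)))"
        by (simp only: sum.insert[OF insert.hyps] F fun_upd_same)
      finally show ?thesis
        by (simp add: sum_distrib_left sum.distrib algebra_simps)
    qed
    also have "(\<Sum>x\<in>F. c x * K x z) = (\<Sum>x\<in>F. c x * K z x)"
      by (intro sum.cong refl) (simp add: sym)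
    finally show ?thesis by (simp add: algebra_simps)
  qed
  \<comment> \<open>If \<open>K z z = 0\<close> then the whole row of \<open>z\<close> vanishes, and \<open>v = 0\<close> is the right choice.\<close>
  have row: "K z x = v z * v x" if "x \<in> insert z F" for x
  proof (cases "K z z = 0")
    case False
    then show ?thesis using zz by (simp add: v_def)
  next
    case True
    have "K z x = 0" if x: "x \<in> F"
    proof (rule ccontr)
      assume ne: "K z x \<noteq> 0"
      have 1: "(\<Sum>y\<in>F. of_bool (y = x) * K z y) = K z x"
        using x insert.hyps
          by (subst sum.mono_neutral_right[of F "{x}"]) auto
      have "0 \<le> 2 * s * K z x + (\<Sum>a\<in>F. \<Sum>y\<in>F. of_bool (a = x) * of_bool (y = x) * K a y)" for s
        using ext[of s "\<lambda>y. of_bool (y = x)"] unfolding True 1 by simp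
      from this[of "- ((\<Sum>a\<in>F. \<Sum>y\<in>F. of_bool (a = x) * of_bool (y = x) * K a y) + 1) / (2 * K z x)"]
      show False using ne by (simp add: field_simps)
    qed
    then show ?thesis using True that by (auto simp: v_def)
  qed
  have "psd F (\<lambda>x y. K x y - v x * v y)"
    unfolding psd_def
  proof (safe, goal_cases)
    case (1 x y)
    then show ?case using sym by auto
  next
    case (2 G c)
    define c' where "c' x = (if x \<in> G then c x else 0)" for x
    define t where "t = (\<Sum>x\<in>F. c' x * v x)"
    have restr: "(\<Sum>x\<in>G. \<Sum>y\<in>G. c x * c y * L x y) = (\<Sum>x\<in>F. \<Sum>y\<in>F. c' x * c' y * L x y)" for L
    proof -
      have *: "(\<Sum>x\<in>F. c' x * g x) = (\<Sum>x\<in>G. c x * g x)" for g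
        by (rule sum.mono_neutral_cong_right) (use 2 insert.hyps in \<open>auto simp: c'_def\<close>)
      have "(\<Sum>x\<in>F. \<Sum>y\<in>F. c' x * c' y * L x y) = (\<Sum>x\<in>F. c' x * (\<Sum>y\<in>F. c' y * L x y))"
        by (simp add: sum_distrib_left mult_ac)
      also have "\<dots> = (\<Sum>x\<in>G. c x * (\<Sum>y\<in>G. c y * L x y))"
        by (simp only: *)
      finally show ?thesis by (simp add: sum_distrib_left mult_ac)
    qed
    have lin: "(\<Sum>x\<in>F. c' x * K z x) = v z * t"
      unfolding t_def sum_distrib_left by (intro sum.cong refl) (simp add: row)
    have sq: "(\<Sum>x\<in>F. \<Sum>y\<in>F. c' x * c' y * (v x * v y)) = t\<^sup>2"
      by (simp add: t_def power2_eq_square sum_product mult_ac)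
    have goal: "(\<Sum>x\<in>G. \<Sum>y\<in>G. c x * c y * (K x y - v x * v y)) =
        (\<Sum>x\<in>F. \<Sum>y\<in>F. c' x * c' y * K x y) - t\<^sup>2"
      unfolding restr sq[symmetric] by (simp add: algebra_simps sum_subtractf)
    show ?case
    proof (cases "K z z = 0")
      case True
      then have "t = 0" by (simp add: t_def v_def)
      then show ?thesis using ext[of 0 c'] goal by simp
    next
      case False
      then have vz: "v z > 0" using zz by (simp add: v_def)
      have Kzz: "K z z = v z * v z" using row[of z] by simp
      show ?thesis
        using ext[of "- t / v z" c'] vz unfolding lin Kzz goal
        by (simp add: field_simps power2_eq_square)
    qed
  qed
  from insert.IH[OF this] obtain n :: nat and g where
    g: "\<forall>x\<in>F. \<forall>y\<in>F. K x y - v x * v y = (\<Sum>k<n. g k x * g k y)" by blast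
  define g' where "g' k x = (if k = n then v x else if x = z then 0 else g k x)" for k x
  have "K x y = (\<Sum>k<Suc n. g' k x * g' k y)" if xy: "x \<in> insert z F" "y \<in> insert z F" for x y
  proof -
    have *: "(\<Sum>k<Suc n. g' k x * g' k y) = (\<Sum>k<n. (if x = z then 0 else g k x) * (if y = z then 0 else g k y)) + v x * v y"
      by (simp add: g'_def)
    show ?thesis
    proof (cases "x = z \<or> y = z")
      case True
      then have "K x y = v x * v y" using row xy sym[OF xy] by (auto simp: mult.commute)
      then show ?thesis using True unfolding * by auto
    next
      case False
      then have "x \<in> F" "y \<in> F" using xy by auto
      then have "K x y - v x * v y = (\<Sum>k<n. g k x * g k y)" using g by blast
      then show ?thesis using False unfolding * by simp
    qed
  qed
  then show ?case by blast
qed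

text \<open>Schur product theorem: by a Gram representation it reduces to rank one factors.\<close>

lemma psd_mult:
  assumes K: "psd X K" and L: "psd X L"
  shows "psd X (\<lambda>x y. K x y * L x y)"
  unfolding psd_def
proof (safe, goal_cases)
  case (1 x y)
  then show ?case using assms by (simp add: psd_sym)
next
  case (2 F c)
  have "psd F K" using psd_pullback[OF K, of F "\<lambda>x. x"] 2 by auto
  with 2 obtain n :: nat and g where g: "\<forall>x\<in>F. \<forall>y\<in>F. K x y = (\<Sum>k<n. g k x * g k y)"
    using psd_finite_gram by blast
  have "(\<Sum>x\<in>F. \<Sum>y\<in>F. c x * c y * (K x y * L x y)) =
    (\<Sum>x\<in>F. \<Sum>y\<in>F. \<Sum>k<n. (c x * g k x) * (c y * g k y) * L x y)"
    using g by (intro sum.cong refl) (simp add: sum_distrib_left sum_distrib_right mult_ac)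
  also have "\<dots> = (\<Sum>k<n. \<Sum>x\<in>F. \<Sum>y\<in>F. (c x * g k x) * (c y * g k y) * L x y)"
    by (simp add: sum.swap[where B="{..<n}"])
  also have "\<dots> \<ge> 0"
    using 2 by (intro sum_nonneg psd_nonneg[OF L])
  finally show ?case .
qed

lemma psd_power:
  assumes "psd X K" shows "psd X (\<lambda>x y. K x y ^ n)"
proof (induction n)
  case 0
  show ?case using psd_rank_one[of X "\<lambda>_. 1"] by simp
next
  case (Suc n)
  show ?case using psd_mult[OF assms Suc] by simp
qed

section \<open>Integrals of positive definite kernels over an interval\<close>

lemma riemann_sum_error:
  fixes f :: "real \<Rightarrow> real"
  assumes ab: "a \<le> b" and p: "p tagged_division_of {a..b}" and f: "continuous_on {a..b} f"
    and osc: "\<And>x k y. (x, k) \<in> p \<Longrightarrow> y \<in> k \<Longrightarrow> \<bar>f y - f x\<bar> \<le> e"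
  shows "\<bar>integral {a..b} f - (\<Sum>(x, k)\<in>p. measure lborel k * f x)\<bar> \<le> e * (b - a)"
proof -
  have fin: "finite p" using p by blast
  have int: "f integrable_on {a..b}"
    by (rule integrable_continuous_interval[OF f])
  have "integral {a..b} f = (\<Sum>(x, k)\<in>p. integral k f)"
    using integral_combine_tagged_division_topdown[of f a b p] int p by simp
  then have "\<bar>integral {a..b} f - (\<Sum>(x, k)\<in>p. measure lborel k * f x)\<bar>
      = \<bar>\<Sum>(x, k)\<in>p. integral k f - measure lborel k * f x\<bar>"
    by (simp add: sum_subtractf case_prod_unfold)
  also have "\<dots> \<le> (\<Sum>(x, k)\<in>p. \<bar>integral k f - measure lborel k * f x\<bar>)"
    by (rule order_trans[OF sum_abs]) (simp add: case_prod_unfold)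
  also have "\<dots> \<le> (\<Sum>(x, k)\<in>p. measure lborel k * e)"
  proof (intro sum_mono, clarify)
    fix x k assume xk: "(x, k) \<in> p"
    obtain u v where uv: "k = cbox u v"
      using tagged_division_ofD(4)[OF p xk] by blast
    have sub: "k \<subseteq> {a..b}" using tagged_division_ofD(3)[OF p xk] .
    have fk: "f integrable_on k"
      using integrable_on_subinterval[OF int] sub unfolding uv by auto
    have "integral k f - measure lborel k * f x = integral k (\<lambda>y. f y - f x)"
      using fk by (subst integral_diff) (auto simp: uv)
    moreover have "norm (integral k (\<lambda>y. f y - f x)) \<le> e * measure lborel k"
    proof -
      have "x \<in> k" using tagged_division_ofD(2)[OF p xk] .
      then have "0 \<le> e" using osc[OF xk] by force
      moreover have "(\<lambda>y. f y - f x) integrable_on k"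
        using fk by (intro integrable_diff) (auto simp: uv)
      ultimately show ?thesis
        using osc[OF xk] unfolding uv
        by (intro integrable_bound) auto
    qed
    ultimately show "\<bar>integral k f - measure lborel k * f x\<bar> \<le> measure lborel k * e" by (simp add: mult.commute)
  qed
  also have "\<dots> = (\<Sum>(x, k)\<in>p. measure lborel k) * e"
    by (simp add: sum_distrib_right case_prod_unfold)
  also have "\<dots> = e * (b - a)"
    using additive_content_tagged_division[of p a b] p ab by simp
  finally show ?thesis .
qed

text \<open>
  The double integral is approximated by the quadratic form at the tags of a fine partition, with
  the lengths of the parts as coefficients.
\<close>

lemma psd_double_integral_nonneg:
  fixes K :: "real \<Rightarrow> real \<Rightarrow> real"
  assumes ab: "a \<le> b" and K: "psd {a..b} K"
    and cont: "continuous_on ({a..b} \<times> {a..b}) (\<lambda>(x, y). K x y)"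
  shows "0 \<le> integral {a..b} (\<lambda>x. integral {a..b} (K x))"
proof (rule field_le_epsilon)
  fix e' :: real assume e': "e' > 0"
  define e where "e = e' / (2 * ((b - a)\<^sup>2 + 1))"
  have e: "e > 0" using e' by (simp add: e_def add_nonneg_pos)
  have "uniformly_continuous_on ({a..b} \<times> {a..b}) (\<lambda>(x, y). K x y)"
    by (intro compact_uniformly_continuous cont compact_Times compact_Icc)
  then obtain d where d: "d > 0" and unif: "\<And>u v. u \<in> {a..b} \<times> {a..b} \<Longrightarrow> v \<in> {a..b} \<times> {a..b} \<Longrightarrow>
      dist v u < d \<Longrightarrow> dist (case v of (x, y) \<Rightarrow> K x y) (case u of (x, y) \<Rightarrow> K x y) < e"
    using e unfolding uniformly_continuous_on_def by metis
  have unif2: "\<bar>K x y' - K x y\<bar> \<le> e" if "x \<in> {a..b}" "y \<in> {a..b}" "y' \<in> {a..b}" "\<bar>y' - y\<bar> < d" for x y y'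
    using unif[of "(x, y)" "(x, y')"] that by (auto simp: dist_Pair_Pair dist_real_def)
  have unif1: "\<bar>K x' y - K x y\<bar> \<le> e" if "x \<in> {a..b}" "x' \<in> {a..b}" "y \<in> {a..b}" "\<bar>x' - x\<bar> < d" for x x' y
    using unif2[of y x x'] that psd_sym[OF K] by metis
  have contK: "continuous_on {a..b} (K x)" if "x \<in> {a..b}" for x
  proof -
    have "continuous_on {a..b} ((\<lambda>(x, y). K x y) \<circ> (\<lambda>y. (x, y)))"
      using that by (intro continuous_on_compose continuous_on_subset[OF cont] continuous_intros) auto
    then show ?thesis by (simp add: o_def)
  qed
  define G where "G x = integral {a..b} (K x)" for x
  have contG: "continuous_on {a..b} G"
    unfolding G_def using integral_continuous_on_param[of "{a..b}" a b K] cont by simp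
  have oscG: "\<bar>G x' - G x\<bar> \<le> e * (b - a)" if "x \<in> {a..b}" "x' \<in> {a..b}" "\<bar>x' - x\<bar> < d" for x x'
  proof -
    have "\<bar>integral {a..b} (\<lambda>y. K x' y - K x y)\<bar> \<le> e * (b - a)"
    proof -
      have "(\<lambda>y. K x' y - K x y) integrable_on cbox a b"
        using that by (auto intro!: integrable_continuous_interval continuous_intros contK)
      then have "norm (integral (cbox a b) (\<lambda>y. K x' y - K x y)) \<le> e * measure lborel (cbox a b)"
        using e that unif1[of x x'] by (intro integrable_bound) auto
      then show ?thesis using ab by simp
    qed
    then show ?thesis unfolding G_def
      using that by (subst (asm) integral_diff) (auto intro!: integrable_continuous_interval contK)
  qed
  obtain p where p: "p tagged_division_of {a..b}" and fine: "(\<lambda>x. ball x d) fine p"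
    using fine_division_exists_real[OF gauge_ball[OF d]] by blast
  have fin: "finite p" using p by blast
  have tag: "x \<in> {a..b}" and near: "y \<in> {a..b} \<and> \<bar>y - x\<bar> < d"
    if "(x, k) \<in> p" "y \<in> k" for x k y
    using that fineD[OF fine that(1)] tagged_division_ofD(2,3)[OF p that(1)]
    by (auto simp: dist_real_def)
  have tag': "x \<in> {a..b}" if "(x, k) \<in> p" for x k
    using tagged_division_ofD(2,3)[OF p that] by auto
  have wsum: "(\<Sum>(x, k)\<in>p. measure lborel k) = b - a"
    using additive_content_tagged_division[of p a b] p ab by simp
  have outer: "\<bar>integral {a..b} G - (\<Sum>(x, k)\<in>p. measure lborel k * G x)\<bar> \<le> e * (b - a) * (b - a)"
    by (rule riemann_sum_error[OF ab p contG]) (use oscG tag near in blast)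
  have inner: "\<bar>G x - (\<Sum>(y, k)\<in>p. measure lborel k * K x y)\<bar> \<le> e * (b - a)" if "x \<in> {a..b}" for x
    unfolding G_def
    by (rule riemann_sum_error[OF ab p contK[OF that]]) (use unif2 that tag near in blast)
  have "(\<Sum>(x, k)\<in>p. measure lborel k * (\<Sum>(y, k)\<in>p. measure lborel k * K x y))
      - (\<Sum>(x, k)\<in>p. measure lborel k * G x) \<le> (\<Sum>(x, k)\<in>p. measure lborel k * (e * (b - a)))"
    unfolding sum_subtractf[symmetric]
  proof (intro sum_mono, clarify)
    fix x k assume xk: "(x, k) \<in> p"
    have "measure lborel k * ((\<Sum>(y, k)\<in>p. measure lborel k * K x y) - G x) \<le> measure lborel k * (e * (b - a))"
      using inner[OF tag'[OF xk]] by (intro mult_left_mono) auto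
    then show "measure lborel k * (\<Sum>(y, k)\<in>p. measure lborel k * K x y) - measure lborel k * G x \<le> measure lborel k * (e * (b - a))"
      by (simp add: right_diff_distrib)
  qed
  also have "\<dots> = e * (b - a) * (b - a)"
    using wsum by (simp add: sum_distrib_right[symmetric] case_prod_unfold)
  finally have mid: "(\<Sum>(x, k)\<in>p. measure lborel k * (\<Sum>(y, k)\<in>p. measure lborel k * K x y))
      \<le> (\<Sum>(x, k)\<in>p. measure lborel k * G x) + e * (b - a) * (b - a)" by simp
  have "0 \<le> (\<Sum>i\<in>p. \<Sum>j\<in>p. measure lborel (snd i) * measure lborel (snd j) * K (fst i) (fst j))"
    using tag' by (intro psd_family[OF K fin]) auto
  also have "\<dots> = (\<Sum>(x, k)\<in>p. measure lborel k * (\<Sum>(y, k)\<in>p. measure lborel k * K x y))"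
    by (simp add: case_prod_unfold sum_distrib_left mult_ac)
  finally have "0 \<le> integral {a..b} G + 2 * (e * (b - a)\<^sup>2)"
    using mid outer by (simp add: power2_eq_square algebra_simps)
  also have "2 * (e * (b - a)\<^sup>2) \<le> e'"
  proof -
    have "(b - a)\<^sup>2 + 1 \<noteq> 0" using zero_le_power2[of "b - a"] by linarith
    then have "e * (2 * ((b - a)\<^sup>2 + 1)) = e'" by (simp only: e_def) simp
    then have "2 * (e * (b - a)\<^sup>2) = e' - 2 * e" by (simp add: algebra_simps)
    then show ?thesis using e by simp
  qed
  finally show "0 \<le> integral {a..b} (\<lambda>x. integral {a..b} (K x)) + e'"
    by (simp add: G_def[abs_def])
qed

section \<open>Wallis integrals\<close>

definition wallis :: "nat \<Rightarrow> nat \<Rightarrow> real" where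
  "wallis p q = integral {0..pi/2} (\<lambda>t. cos t ^ p * sin t ^ q)"

lemma trig_power_integrable [intro]: "(\<lambda>t::real. cos t ^ p * sin t ^ q) integrable_on {a..b}"
  by (intro integrable_continuous_interval continuous_intros)

lemma wallis_add: "wallis (p + 2) q + wallis p (q + 2) = wallis p q"
proof -
  have "wallis (p + 2) q + wallis p (q + 2)
      = integral {0..pi/2} (\<lambda>t. cos t ^ (p + 2) * sin t ^ q + cos t ^ p * sin t ^ (q + 2))"
    unfolding wallis_def by (rule integral_add[symmetric]; rule trig_power_integrable)
  also have "(\<lambda>t::real. cos t ^ (p + 2) * sin t ^ q + cos t ^ p * sin t ^ (q + 2))
      = (\<lambda>t. cos t ^ p * sin t ^ q)"
  proof
    fix t :: real
    have "cos t ^ (p + 2) * sin t ^ q + cos t ^ p * sin t ^ (q + 2)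
        = cos t ^ p * sin t ^ q * ((cos t)\<^sup>2 + (sin t)\<^sup>2)"
      by (simp only: power_add distrib_left mult_ac)
    also have "\<dots> = cos t ^ p * sin t ^ q" by (simp only: sin_cos_squared_add2 mult_1_right)
    finally show "cos t ^ (p + 2) * sin t ^ q + cos t ^ p * sin t ^ (q + 2) = cos t ^ p * sin t ^ q" .
  qed
  finally show ?thesis by (simp add: wallis_def)
qed

lemma wallis_parts: "real (q + 1) * wallis (p + 2) q = real (p + 1) * wallis p (q + 2)"
proof -
  have "((\<lambda>t. real (q + 1) * (cos t ^ (p + 2) * sin t ^ q) - real (p + 1) * (cos t ^ p * sin t ^ (q + 2)))
      has_integral (cos (pi/2) ^ (p + 1) * sin (pi/2) ^ (q + 1) - cos 0 ^ (p + 1) * sin 0 ^ (q + 1))) {0..pi/2}"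
  proof (rule fundamental_theorem_of_calculus)
    fix t :: real
    show "((\<lambda>t. cos t ^ (p + 1) * sin t ^ (q + 1)) has_vector_derivative
        real (q + 1) * (cos t ^ (p + 2) * sin t ^ q) - real (p + 1) * (cos t ^ p * sin t ^ (q + 2)))
        (at t within {0..pi/2})"
      unfolding has_real_derivative_iff_has_vector_derivative[symmetric]
      by (rule derivative_eq_intros refl)+ (simp add: algebra_simps)
  qed simp
  then have "integral {0..pi/2} (\<lambda>t. real (q + 1) * (cos t ^ (p + 2) * sin t ^ q) -
      real (p + 1) * (cos t ^ p * sin t ^ (q + 2))) = 0"
    by (simp add: integral_unique)
  also have "integral {0..pi/2} (\<lambda>t. real (q + 1) * (cos t ^ (p + 2) * sin t ^ q) -
      real (p + 1) * (cos t ^ p * sin t ^ (q + 2)))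
      = real (q + 1) * wallis (p + 2) q - real (p + 1) * wallis p (q + 2)"
    unfolding wallis_def
    by (subst integral_diff; (intro integrable_on_mult_right trig_power_integrable)?)
       (simp only: integral_mult_right)
  finally show ?thesis by simp
qed

lemma wallis_rec:
  "wallis (p + 2) q = (real p + 1) / (real p + real q + 2) * wallis p q"
  "wallis p (q + 2) = (real q + 1) / (real p + real q + 2) * wallis p q"
proof -
  have "(real p + real q + 2) * wallis (p + 2) q = (real p + 1) * wallis p q"
       "(real p + real q + 2) * wallis p (q + 2) = (real q + 1) * wallis p q"
    using wallis_parts[of q p] unfolding wallis_add[of p q, symmetric]
    by (simp_all only: of_nat_add of_nat_1 distrib_left distrib_right)
  then show "wallis (p + 2) q = (real p + 1) / (real p + real q + 2) * wallis p q"
    "wallis p (q + 2) = (real q + 1) / (real p + real q + 2) * wallis p q"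
    by (simp_all add: field_simps)
qed

lemma wallis_base: "wallis 0 0 = pi / 2" "wallis 1 0 = 1" "wallis 0 1 = 1" "wallis 1 1 = 1 / 2"
proof -
  show "wallis 0 0 = pi / 2" by (simp add: wallis_def)
  have "((\<lambda>t. cos t) has_integral (sin (pi/2) - sin 0)) {0..pi/2}"
    by (rule fundamental_theorem_of_calculus)
       (auto intro!: derivative_eq_intros simp: has_real_derivative_iff_has_vector_derivative[symmetric])
  then show "wallis 1 0 = 1" by (simp add: wallis_def integral_unique)
  have "((\<lambda>t. sin t) has_integral (- cos (pi/2) - (- cos 0))) {0..pi/2}"
    by (rule fundamental_theorem_of_calculus)
       (auto intro!: derivative_eq_intros simp: has_real_derivative_iff_has_vector_derivative[symmetric])
  then show "wallis 0 1 = 1" by (simp add: wallis_def integral_unique)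
  have "((\<lambda>t. cos t * sin t) has_integral ((sin (pi/2))\<^sup>2 / 2 - (sin 0)\<^sup>2 / 2)) {0..pi/2}"
    by (rule fundamental_theorem_of_calculus)
       (auto intro!: derivative_eq_intros simp: has_real_derivative_iff_has_vector_derivative[symmetric])
  then show "wallis 1 1 = 1 / 2" by (simp add: wallis_def integral_unique)
qed

text \<open>
  The value \<open>B((p+1)/2, (q+1)/2) / 2\<close> of the Beta function. Both sides satisfy the recurrences that
  raise one exponent by \<open>2\<close>, and they agree for exponents below \<open>2\<close>.
\<close>

lemma wallis_Gamma:
  "wallis p q = Gamma ((real p + 1) / 2) * Gamma ((real q + 1) / 2) / (2 * Gamma ((real p + real q) / 2 + 1))"
proof -
  have step: "Gamma (x + 1) = x * Gamma x" if "x > 0" for x :: real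
    using Gamma_plus1[of x] that by (metis add_0_left not_less nonpos_Ints_nonpos)
  have p2: "Gamma ((real (p + 2) + 1) / 2) = (real p + 1) / 2 * Gamma ((real p + 1) / 2)" for p
    using step[of "(real p + 1) / 2"] by (simp add: field_simps)
  have pq: "Gamma ((real (p + 2) + real q) / 2 + 1) = (real p + real q + 2) / 2 * Gamma ((real p + real q) / 2 + 1)"
    "Gamma ((real p + real (q + 2)) / 2 + 1) = (real p + real q + 2) / 2 * Gamma ((real p + real q) / 2 + 1)" for p q
    using step[of "(real p + real q) / 2 + 1"] by (simp_all add: field_simps)
  have alg: "k / c * (A * B / (2 * G)) = A * (k / 2 * B) / (2 * (c / 2 * G))" if "c > 0" for c k A B G :: real
    using that by (simp add: field_simps)
  have alg2: "k / c * (A * B / (2 * G)) = k / 2 * A * B / (2 * (c / 2 * G))" if "c > 0" for c k A B G :: real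
    using that by (simp add: field_simps)
  have G1: "Gamma (3 / 2 :: real) = sqrt pi / 2"
    using step[of "1/2"] by (simp add: Gamma_one_half_real)
  have base: "wallis p q = Gamma ((real p + 1) / 2) * Gamma ((real q + 1) / 2) / (2 * Gamma ((real p + real q) / 2 + 1))"
    if "p < 2" "q < 2" for p q
  proof -
    have "p = 0 \<or> p = 1" "q = 0 \<or> q = 1" using that by auto
    moreover have "Gamma (2::real) = 1" using step[of 1] by simp
    ultimately show ?thesis
      using wallis_base G1 by (auto simp: Gamma_one_half_real)
  qed
  have q: "wallis p q = Gamma ((real p + 1) / 2) * Gamma ((real q + 1) / 2) / (2 * Gamma ((real p + real q) / 2 + 1))"
    if "p < 2" for p q
  proof (induction q rule: less_induct)
    case (less q)
    show ?case
    proof (cases "q < 2")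
      case True
      then show ?thesis using base that by blast
    next
      case False
      then obtain r where r: "q = r + 2" by (metis add.commute le_Suc_ex not_less)
      show ?thesis
        unfolding r wallis_rec(2) p2 pq less.IH[of r, unfolded r, simplified]
        using alg[of "real p + real r + 2"] by simp
    qed
  qed
  show ?thesis
  proof (induction p rule: less_induct)
    case (less p)
    show ?case
    proof (cases "p < 2")
      case True
      then show ?thesis using q by blast
    next
      case False
      then obtain r where r: "p = r + 2" by (metis add.commute le_Suc_ex not_less)
      show ?thesis
        unfolding r wallis_rec(1) p2 pq less.IH[of r, unfolded r, simplified]
        using alg2[of "real r + real q + 2"] by simp
    qed
  qed
qed

lemma wallis_pos: "wallis p q > 0"
  unfolding wallis_Gamma
  by (intro divide_pos_pos mult_pos_pos Gamma_real_pos) (simp_all add: add_nonneg_pos)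

lemma integral_flip:
  fixes f :: "real \<Rightarrow> real"
  shows "integral {a..b} f = integral {c - b..c - a} (\<lambda>x. f (c - x))"
proof -
  have "integral {a..b} f = integral {-b..-a} (\<lambda>x. f (- x))"
    by (rule Henstock_Kurzweil_Integration.integral_reflect_real[symmetric])
  also have "\<dots> = integral {-b - (-c)..-a - (-c)} (\<lambda>x. f (- (x + (-c))))"
    by (rule integral_shift_real_ivl[symmetric])
  finally show ?thesis by (simp add: algebra_simps)
qed

lemma trig_power_integral:
  "integral {0..pi} (\<lambda>t. cos t ^ p * sin t ^ q) = (if even p then 2 * wallis p q else 0)"
proof -
  have "integral {0..pi} (\<lambda>t. cos t ^ p * sin t ^ q) =
      wallis p q + integral {pi/2..pi} (\<lambda>t. cos t ^ p * sin t ^ q)"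
    unfolding wallis_def by (rule Henstock_Kurzweil_Integration.integral_combine[symmetric]) (auto simp: field_simps)
  also have "integral {pi/2..pi} (\<lambda>t. cos t ^ p * sin t ^ q) =
      integral {0..pi/2} (\<lambda>t. (-1) ^ p * (cos t ^ p * sin t ^ q))"
    using integral_flip[of "pi/2" pi "\<lambda>t. cos t ^ p * sin t ^ q" pi]
    by (simp add: power_minus[of "cos _"] mult.assoc)
  also have "\<dots> = (-1) ^ p * wallis p q"
    by (simp add: wallis_def)
  finally show ?thesis by simp
qed

section \<open>Means of zonal functions\<close>

text \<open>
  In the variable \<open>x = cos t\<close> this is the integral with the weight \<open>(1 - x\<^sup>2)\<^bsup>(q-1)/2\<^esup>\<close>, which is, up to
  a factor, the distribution of \<open>\<langle>\<xi>, \<eta>\<rangle>\<close> for fixed \<open>\<eta>\<close> and uniformly distributed \<open>\<xi>\<close> on the sphere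
  \<open>S\<^bsup>q+1\<^esup>\<close>. The angular form avoids the singularities of the weight for \<open>q = 0\<close>.
\<close>

definition zint :: "nat \<Rightarrow> (real \<Rightarrow> real) \<Rightarrow> real" where
  "zint q h = integral {0..pi} (\<lambda>t. h (cos t) * sin t ^ q)"

lemma continuous_on_cos_comp:
  assumes "continuous_on {-1..1::real} h"
  shows "continuous_on S (\<lambda>t. h (cos t))"
  by (rule continuous_on_compose2[OF assms continuous_on_cos[OF continuous_on_id]]) auto

lemma zint_integrable:
  "continuous_on {-1..1} h \<Longrightarrow> (\<lambda>t. h (cos t) * sin t ^ q) integrable_on {0..pi}"
  by (intro integrable_continuous_interval continuous_intros continuous_on_cos_comp)

lemma zint_cong: "(\<And>x. x \<in> {-1..1} \<Longrightarrow> h x = g x) \<Longrightarrow> zint q h = zint q g"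
  unfolding zint_def by (intro integral_cong) auto

lemma zint_add:
  "continuous_on {-1..1} h \<Longrightarrow> continuous_on {-1..1} g \<Longrightarrow> zint q (\<lambda>x. h x + g x) = zint q h + zint q g"
  unfolding zint_def distrib_right by (intro integral_add zint_integrable)

lemma zint_diff:
  "continuous_on {-1..1} h \<Longrightarrow> continuous_on {-1..1} g \<Longrightarrow> zint q (\<lambda>x. h x - g x) = zint q h - zint q g"
  unfolding zint_def left_diff_distrib by (intro integral_diff zint_integrable)

lemma zint_cmult: "zint q (\<lambda>x. c * h x) = c * zint q h"
  unfolding zint_def by (simp add: mult.assoc)

lemma zint_sum:
  assumes "finite A" "\<And>a. a \<in> A \<Longrightarrow> continuous_on {-1..1} (h a)"
  shows "zint q (\<lambda>x. \<Sum>a\<in>A. h a x) = (\<Sum>a\<in>A. zint q (h a))"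
  unfolding zint_def sum_distrib_right using assms by (intro integral_sum zint_integrable) auto

lemma zint_mono:
  assumes "continuous_on {-1..1} h" "continuous_on {-1..1} g" "\<And>x. x \<in> {-1..1} \<Longrightarrow> h x \<le> g x"
  shows "zint q h \<le> zint q g"
  unfolding zint_def using assms
  by (intro integral_le zint_integrable mult_right_mono zero_le_power) (auto intro: sin_ge_zero)

lemma zint_power: "zint q (\<lambda>x. x ^ p) = (if even p then 2 * wallis p q else 0)"
  unfolding zint_def by (rule trig_power_integral)

lemma zint_const: "zint q (\<lambda>x. c) = c * (2 * wallis 0 q)"
  using zint_cmult[of q c "\<lambda>x. x ^ 0"] unfolding zint_power by simp

lemma zint_abs_le:
  assumes "continuous_on {-1..1} h" "\<And>x. x \<in> {-1..1} \<Longrightarrow> \<bar>h x\<bar> \<le> B"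
  shows "\<bar>zint q h\<bar> \<le> B * (2 * wallis 0 q)"
proof -
  have b: "h x \<le> B" "- B \<le> h x" if "x \<in> {-1..1}" for x
    using assms(2)[OF that] by linarith+
  have "zint q h \<le> zint q (\<lambda>_. B)" "zint q (\<lambda>_. - B) \<le> zint q h"
    by (rule zint_mono[OF assms(1) _ b(1)] zint_mono[OF _ assms(1) b(2)]; simp)+
  then show ?thesis unfolding zint_const by simp
qed

text \<open>Half-angle substitution: \<open>1 + cos t = 2 cos\<^sup>2 (t/2)\<close>, \<open>1 - cos t = 2 sin\<^sup>2 (t/2)\<close>.\<close>

lemma zint_Bernstein:
  "zint q (\<lambda>x. (1 + x) ^ i * (1 - x) ^ j) = 2 ^ (i + j + q + 1) * wallis (2 * i + q) (2 * j + q)"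
proof -
  have img: "(\<lambda>x. x / 2) ` {0..pi} = {0..pi/2}"
    by (auto simp: image_iff intro!: bexI[of _ "2 * _"])
  have "zint q (\<lambda>x. (1 + x) ^ i * (1 - x) ^ j) =
      2 * integral {0..pi/2} (\<lambda>t. (1 + cos (2 * t)) ^ i * (1 - cos (2 * t)) ^ j * sin (2 * t) ^ q)"
    using integral_stretch_real[of 2 0 pi "\<lambda>t. (1 + cos t) ^ i * (1 - cos t) ^ j * sin t ^ q"]
    by (simp add: zint_def img)
  also have "(\<lambda>t::real. (1 + cos (2 * t)) ^ i * (1 - cos (2 * t)) ^ j * sin (2 * t) ^ q)
      = (\<lambda>t. 2 ^ (i + j + q) * (cos t ^ (2 * i + q) * sin t ^ (2 * j + q)))"
  proof
    fix t :: real
    have double: "1 + cos (2 * t) = 2 * (cos t)\<^sup>2" "1 - cos (2 * t) = 2 * (sin t)\<^sup>2"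
      by (simp add: cos_double_cos, simp add: cos_double_sin)
    show "(1 + cos (2 * t)) ^ i * (1 - cos (2 * t)) ^ j * sin (2 * t) ^ q =
        2 ^ (i + j + q) * (cos t ^ (2 * i + q) * sin t ^ (2 * j + q))"
      unfolding double sin_double power_add power_mult power_mult_distrib by (simp only: mult_ac)
  qed
  finally show ?thesis by (simp add: wallis_def)
qed

lemma poly_approximation:
  assumes "continuous_on {-1..1} h" "e > 0"
  obtains p :: "real poly" where "\<And>x. x \<in> {-1..1} \<Longrightarrow> \<bar>h x - poly p x\<bar> < e"
proof -
  obtain g where g: "real_polynomial_function g" "\<And>x. x \<in> {-1..1} \<Longrightarrow> \<bar>h x - g x\<bar> < e"
    using Stone_Weierstrass_real_polynomial_function[OF compact_Icc assms] by metis
  from g(1) obtain a n where "g = (\<lambda>x. \<Sum>i\<le>n. a i * x ^ i)"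
    unfolding real_polynomial_function_iff_sum by blast
  then have "g x = poly (\<Sum>i\<le>n. monom (a i) i) x" for x
    by (simp add: poly_sum poly_monom)
  with g(2) that show thesis by metis
qed

lemma sum_even_odd: "(\<Sum>j\<le>2 * K. g j) = (\<Sum>i\<le>K. g (2 * i)) + (\<Sum>i<K. g (2 * i + 1 :: nat) :: real)"
  by (induction K) (auto simp: algebra_simps)

lemma Gamma_half_nat: "Gamma (real n + 1/2) = fact (2 * n) / (4 ^ n * fact n) * sqrt pi"
proof -
  have "pochhammer (1/2::real) n = Gamma (1/2 + real n) / sqrt pi"
    by (subst pochhammer_Gamma) (auto simp: Gamma_one_half_real elim!: nonpos_Ints_cases)
  moreover have "fact (2 * n) = (4 ^ n * pochhammer (1/2) n * fact n :: real)"
    by (simp add: fact_double power_mult)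
  ultimately show ?thesis by (simp add: field_simps)
qed

text \<open>
  After the binomial expansion of \<open>(cos a cos b + sin a sin b y)\<^bsup>2K\<^esup>\<close> this turns the binomial
  coefficients of order \<open>2K\<close> into those of order \<open>K\<close>, so that the sum collapses to
  \<open>(sin\<^sup>2 b + cos\<^sup>2 b)\<^sup>K\<close>.
\<close>

lemma wallis_binomial:
  assumes "i \<le> K"
  shows "real (2 * K choose (2 * i)) * wallis (2 * K - 2 * i) (2 * i + q + 1) * wallis (2 * i) q
       = real (K choose i) * wallis 0 q * wallis (2 * K) (q + 1)"
proof -
  let ?G = "\<lambda>x::real. Gamma x"
  have pos: "?G x > 0" if "x > 0" for x using that by (rule Gamma_real_pos)
  have "(real (2 * K - 2 * i) + 1) / 2 = real (K - i) + 1/2"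
    "(real (2 * i + q + 1) + 1) / 2 = real i + real q / 2 + 1"
    "(real (2 * K - 2 * i) + real (2 * i + q + 1)) / 2 + 1 = real K + real q / 2 + 3/2"
    using assms by (simp_all add: of_nat_diff field_simps)
  then have w1: "wallis (2 * K - 2 * i) (2 * i + q + 1) =
      ?G (real (K - i) + 1/2) * ?G (real i + real q / 2 + 1) / (2 * ?G (real K + real q / 2 + 3/2))"
    unfolding wallis_Gamma by (simp only:)
  have "(real (2 * i) + 1) / 2 = real i + 1/2" "(real (2 * i) + real q) / 2 + 1 = real i + real q / 2 + 1"
    by (simp_all add: field_simps)
  then have w2: "wallis (2 * i) q = ?G (real i + 1/2) * ?G ((real q + 1) / 2) / (2 * ?G (real i + real q / 2 + 1))"
    unfolding wallis_Gamma by (simp only:)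
  have w3: "wallis 0 q = sqrt pi * ?G ((real q + 1) / 2) / (2 * ?G (real q / 2 + 1))"
    by (simp add: wallis_Gamma Gamma_one_half_real)
  have "(real (2 * K) + 1) / 2 = real K + 1/2" "(real (q + 1) + 1) / 2 = real q / 2 + 1"
    "(real (2 * K) + real (q + 1)) / 2 + 1 = real K + real q / 2 + 3/2"
    by (simp_all add: field_simps)
  then have w4: "wallis (2 * K) (q + 1) = ?G (real K + 1/2) * ?G (real q / 2 + 1) / (2 * ?G (real K + real q / 2 + 3/2))"
    unfolding wallis_Gamma by (simp only:)
  have nz: "?G (real i + real q / 2 + 1) \<noteq> 0" "?G (real q / 2 + 1) \<noteq> 0"
    by (auto intro!: less_imp_neq[OF pos, symmetric])
  have key: "real (2 * K choose (2 * i)) * ?G (real (K - i) + 1/2) * ?G (real i + 1/2)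
      = real (K choose i) * sqrt pi * ?G (real K + 1/2)"
  proof -
    have c: "real (2 * K choose (2 * i)) = fact (2 * K) / (fact (2 * i) * fact (2 * (K - i)))"
      using assms by (subst binomial_fact) (auto simp: right_diff_distrib')
    have c': "real (K choose i) = fact K / (fact i * fact (K - i))"
      using assms by (rule binomial_fact)
    have p: "(4::real) ^ K = 4 ^ i * 4 ^ (K - i)"
      using assms by (simp add: power_add[symmetric])
    show ?thesis
      unfolding Gamma_half_nat c c' p by (simp add: field_simps)
  qed
  have "real (2 * K choose (2 * i)) * wallis (2 * K - 2 * i) (2 * i + q + 1) * wallis (2 * i) q =
     (real (2 * K choose (2 * i)) * ?G (real (K - i) + 1/2) * ?G (real i + 1/2)) *
     (?G ((real q + 1) / 2) / (4 * ?G (real K + real q / 2 + 3/2)))"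
    unfolding w1 w2 using nz by simp
  also have "\<dots> = real (K choose i) * wallis 0 q * wallis (2 * K) (q + 1)"
    unfolding key w3 w4 using nz by simp
  finally show ?thesis .
qed

lemma spherical_cosine_bound: "cos a * cos b + sin a * sin b * y \<in> {-1..1}" if "y \<in> {-1..1}" for a b y :: real
proof -
  have eq: "cos a * cos b + sin a * sin b * y = (1 + y) / 2 * cos (a - b) + (1 - y) / 2 * cos (a + b)"
    by (simp add: cos_add cos_diff field_simps)
  have "\<bar>(1 + y) / 2 * cos (a - b)\<bar> \<le> (1 + y) / 2 * 1" "\<bar>(1 - y) / 2 * cos (a + b)\<bar> \<le> (1 - y) / 2 * 1"
    using that unfolding abs_mult by (auto intro!: mult_left_le)
  then show ?thesis unfolding eq by (auto simp: abs_le_iff field_simps)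
qed


lemma zint_average_power:
  "integral {0..pi} (\<lambda>a. zint q (\<lambda>y. (cos a * cos b + sin a * sin b * y) ^ k) * sin a ^ (q + 1))
   = 2 * wallis 0 q * zint (q + 1) (\<lambda>x. x ^ k)"
proof -
  define F where "F p r = (if even p then 2 * wallis p r else 0)" for p r
  have inner: "zint q (\<lambda>y. (cos a * cos b + sin a * sin b * y) ^ k) =
      (\<Sum>j\<le>k. (k choose j) * (sin a * sin b) ^ j * (cos a * cos b) ^ (k - j) * F j q)" for a
  proof -
    have "zint q (\<lambda>y. (cos a * cos b + sin a * sin b * y) ^ k) =
        zint q (\<lambda>y. \<Sum>j\<le>k. ((k choose j) * (sin a * sin b) ^ j * (cos a * cos b) ^ (k - j)) * y ^ j)"
      by (subst add.commute, subst binomial_ring) (simp add: power_mult_distrib mult_ac)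
    also have "\<dots> = (\<Sum>j\<le>k. ((k choose j) * (sin a * sin b) ^ j * (cos a * cos b) ^ (k - j)) * F j q)"
      by (subst zint_sum) (auto intro!: continuous_intros simp: zint_cmult zint_power F_def)
    finally show ?thesis .
  qed
  have "integral {0..pi} (\<lambda>a. zint q (\<lambda>y. (cos a * cos b + sin a * sin b * y) ^ k) * sin a ^ (q + 1))
      = integral {0..pi} (\<lambda>a. \<Sum>j\<le>k. ((k choose j) * sin b ^ j * cos b ^ (k - j) * F j q) *
          (cos a ^ (k - j) * sin a ^ (j + q + 1)))"
    unfolding inner sum_distrib_right
    by (intro integral_cong sum.cong refl) (simp add: power_mult_distrib power_add mult_ac)
  also have "\<dots> = (\<Sum>j\<le>k. ((k choose j) * sin b ^ j * cos b ^ (k - j) * F j q) * F (k - j) (j + q + 1))"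
    by (subst integral_sum; (intro ballI finite_atMost integrable_on_mult_right trig_power_integrable)?)
       (simp only: integral_mult_right trig_power_integral F_def)
  also have "\<dots> = 2 * wallis 0 q * F k (q + 1)"
  proof (cases "even k")
    case False
    have "(k choose j) * sin b ^ j * cos b ^ (k - j) * F j q * F (k - j) (j + q + 1) = 0" if "j \<le> k" for j
      using False that by (auto simp: F_def)
    then have "(\<Sum>j\<le>k. (k choose j) * sin b ^ j * cos b ^ (k - j) * F j q * F (k - j) (j + q + 1)) = 0"
      by (intro sum.neutral ballI) (simp only: atMost_iff)
    then show ?thesis using False by (simp only: F_def) simp
  next
    case True
    then obtain K where K: "k = 2 * K" by blast
    have "(\<Sum>j\<le>k. ((k choose j) * sin b ^ j * cos b ^ (k - j) * F j q) * F (k - j) (j + q + 1))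
       = (\<Sum>i\<le>K. ((2 * K choose (2 * i)) * sin b ^ (2 * i) * cos b ^ (2 * K - 2 * i) * F (2 * i) q) *
            F (2 * K - 2 * i) (2 * i + q + 1))"
      unfolding K sum_even_odd by (simp add: F_def)
    also have "\<dots> = (\<Sum>i\<le>K. 4 * wallis 0 q * wallis (2 * K) (q + 1) *
        ((K choose i) * ((sin b)\<^sup>2) ^ i * ((cos b)\<^sup>2) ^ (K - i)))"
    proof (intro sum.cong refl)
      fix i assume "i \<in> {..K}"
      then have i: "i \<le> K" by simp
      have "(2 * K choose (2 * i)) * sin b ^ (2 * i) * cos b ^ (2 * K - 2 * i) * F (2 * i) q *
            F (2 * K - 2 * i) (2 * i + q + 1) = 4 * (sin b ^ (2 * i) * cos b ^ (2 * K - 2 * i)) *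
          (real (2 * K choose (2 * i)) * wallis (2 * K - 2 * i) (2 * i + q + 1) * wallis (2 * i) q)"
        by (simp add: F_def)
      also have "\<dots> = 4 * wallis 0 q * wallis (2 * K) (q + 1) *
        ((K choose i) * ((sin b)\<^sup>2) ^ i * ((cos b)\<^sup>2) ^ (K - i))"
        unfolding wallis_binomial[OF i] by (simp add: power_mult[symmetric] right_diff_distrib')
      finally show "(2 * K choose (2 * i)) * sin b ^ (2 * i) * cos b ^ (2 * K - 2 * i) * F (2 * i) q *
            F (2 * K - 2 * i) (2 * i + q + 1) = 4 * wallis 0 q * wallis (2 * K) (q + 1) *
        ((K choose i) * ((sin b)\<^sup>2) ^ i * ((cos b)\<^sup>2) ^ (K - i))" .
    qed
    also have "\<dots> = 4 * wallis 0 q * wallis (2 * K) (q + 1) * ((sin b)\<^sup>2 + (cos b)\<^sup>2) ^ K"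
      unfolding sum_distrib_left[symmetric] binomial_ring ..
    also have "\<dots> = 2 * wallis 0 q * F k (q + 1)"
      by (simp add: F_def K)
    finally show ?thesis .
  qed
  also have "F k (q + 1) = zint (q + 1) (\<lambda>x. x ^ k)"
    by (simp only: F_def zint_power)
  finally show ?thesis .
qed

lemma continuous_on_zint_average:
  assumes "continuous_on {-1..1} h"
  shows "continuous_on S (\<lambda>(a, b). zint q (\<lambda>y. h (cos a * cos b + sin a * sin b * y)))"
proof -
  have "continuous_on (S \<times> cbox 0 pi) (\<lambda>(p, t). h (cos (fst p) * cos (snd p) + sin (fst p) * sin (snd p) * cos t) * sin t ^ q)"
    unfolding case_prod_unfold
    by (intro continuous_intros continuous_on_compose2[OF assms] image_subsetI spherical_cosine_bound) auto
  from integral_continuous_on_param[OF this] show ?thesis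
    by (simp add: zint_def case_prod_unfold)
qed

lemma continuous_on_latitude:
  fixes h :: "real \<Rightarrow> real"
  assumes "continuous_on {-1..1} h"
  shows "continuous_on {-1..1} (\<lambda>y. h (cos a * cos b + sin a * sin b * y))"
  by (intro continuous_intros continuous_on_compose2[OF assms] image_subsetI spherical_cosine_bound)

lemma zint_average_integrable:
  assumes "continuous_on {-1..1} h"
  shows "(\<lambda>a. zint q (\<lambda>y. h (cos a * cos b + sin a * sin b * y)) * sin a ^ (q + 1)) integrable_on {0..pi}"
proof -
  have "continuous_on {0..pi} (\<lambda>a. (\<lambda>(a, b). zint q (\<lambda>y. h (cos a * cos b + sin a * sin b * y))) (a, b))"
    by (rule continuous_on_compose2[OF continuous_on_zint_average[OF assms, of UNIV q]])
       (auto intro!: continuous_intros)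
  then show ?thesis
    by (auto intro!: integrable_continuous_interval continuous_intros)
qed

text \<open>
  Averaging a zonal function over the circles of latitude. In
  \<open>cos a cos b + sin a sin b y\<close> the angles \<open>a\<close> and \<open>b\<close> are the distances of two points from
  the pole and \<open>y\<close> is the cosine of the angle between their longitudes; thus the left hand side is,
  up to normalisation, the mean of \<open>h (\<langle>\<xi>, \<eta>\<rangle>)\<close> over \<open>\<xi>\<close>, with \<open>\<eta>\<close> at distance \<open>b\<close> from
  the pole. That it does not depend on \<open>b\<close> is the rotation invariance of the surface measure.
\<close>

lemma zint_average:
  assumes h: "continuous_on {-1..1} h"
  shows "integral {0..pi} (\<lambda>a. zint q (\<lambda>y. h (cos a * cos b + sin a * sin b * y)) * sin a ^ (q + 1))
   = 2 * wallis 0 q * zint (q + 1) h"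
proof -
  define L where "L g = integral {0..pi} (\<lambda>a. zint q (\<lambda>y. g (cos a * cos b + sin a * sin b * y)) * sin a ^ (q + 1))"
    for g :: "real \<Rightarrow> real"
  have poly: "L (poly p) = 2 * wallis 0 q * zint (q + 1) (poly p)" for p
  proof -
    have "L (poly p) = integral {0..pi} (\<lambda>a. \<Sum>k\<le>degree p. coeff p k *
       (zint q (\<lambda>y. (cos a * cos b + sin a * sin b * y) ^ k) * sin a ^ (q + 1)))"
      unfolding L_def poly_altdef
      by (subst zint_sum) (auto intro!: continuous_intros simp: zint_cmult sum_distrib_right mult.assoc)
    also have "\<dots> = (\<Sum>k\<le>degree p. coeff p k * (2 * wallis 0 q * zint (q + 1) (\<lambda>x. x ^ k)))"
      by (subst integral_sum; (intro ballI finite_atMost integrable_on_mult_right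
             zint_average_integrable[of "\<lambda>x. x ^ _"] continuous_intros)?)
         (simp only: integral_mult_right zint_average_power)
    also have "\<dots> = 2 * wallis 0 q * zint (q + 1) (\<lambda>x. \<Sum>k\<le>degree p. coeff p k * x ^ k)"
      by (subst zint_sum) (auto intro!: continuous_intros simp: zint_cmult sum_distrib_left mult_ac)
    finally have "L (poly p) = 2 * wallis 0 q * zint (q + 1) (\<lambda>x. \<Sum>k\<le>degree p. coeff p k * x ^ k)" .
    moreover have "poly p = (\<lambda>x. \<Sum>k\<le>degree p. coeff p k * x ^ k)"
      by (rule ext) (rule poly_altdef)
    ultimately show ?thesis by (simp only:)
  qed
  \<comment> \<open>Both sides are bounded by \<open>c\<close> times the supremum norm, so polynomials suffice.\<close>
  define c where "c = 2 * wallis 0 q * (2 * wallis 0 (q + 1))"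
  have c: "c > 0" by (simp add: c_def wallis_pos)
  have bound: "\<bar>L g\<bar> \<le> e * c"
    if g: "continuous_on {-1..1} g" and e: "\<And>x. x \<in> {-1..1} \<Longrightarrow> \<bar>g x\<bar> \<le> e" for g e
  proof -
    have "norm (L g) \<le> integral {0..pi} (\<lambda>a. e * (2 * wallis 0 q) * (cos a ^ 0 * sin a ^ (q + 1)))"
      unfolding L_def
    proof (rule integral_norm_bound_integral)
      fix a :: real assume a: "a \<in> {0..pi}"
      have "\<bar>zint q (\<lambda>y. g (cos a * cos b + sin a * sin b * y))\<bar> \<le> e * (2 * wallis 0 q)"
        by (rule zint_abs_le[OF continuous_on_latitude[OF g]]) (rule e[OF spherical_cosine_bound])
      moreover have "sin a \<ge> 0" using a by (auto intro: sin_ge_zero)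
      ultimately show "norm (zint q (\<lambda>y. g (cos a * cos b + sin a * sin b * y)) * sin a ^ (q + 1))
          \<le> e * (2 * wallis 0 q) * (cos a ^ 0 * sin a ^ (q + 1))"
        unfolding real_norm_def abs_mult power_0 mult_1 by (simp add: mult_right_mono)
    qed (intro zint_average_integrable[OF g] integrable_on_mult_right trig_power_integrable)+
    then show ?thesis
      unfolding integral_mult_right trig_power_integral c_def by (simp add: mult_ac)
  qed
  have "\<bar>L h - 2 * wallis 0 q * zint (q + 1) h\<bar> \<le> e" if e: "e > 0" for e
  proof -
    obtain p where p: "\<And>x. x \<in> {-1..1} \<Longrightarrow> \<bar>h x - poly p x\<bar> < e / (2 * c)"
      using poly_approximation[OF h, of "e / (2 * c)"] e c by auto
    have cont: "continuous_on {-1..1} (\<lambda>x. h x - poly p x)"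
      by (intro continuous_intros h)
    have "L (\<lambda>x. h x - poly p x) = L h - L (poly p)"
    proof -
      have "zint q (\<lambda>y. h (cos a * cos b + sin a * sin b * y) - poly p (cos a * cos b + sin a * sin b * y)) =
          zint q (\<lambda>y. h (cos a * cos b + sin a * sin b * y)) -
          zint q (\<lambda>y. poly p (cos a * cos b + sin a * sin b * y))" for a
        by (intro zint_diff continuous_on_latitude h continuous_intros)
      then show ?thesis
        unfolding L_def left_diff_distrib
        by (simp only: left_diff_distrib)
           (intro integral_diff zint_average_integrable h continuous_intros)
    qed
    moreover have "\<bar>L (\<lambda>x. h x - poly p x)\<bar> \<le> e / (2 * c) * c"
      using p by (intro bound cont) (simp add: less_imp_le)
    moreover have "\<bar>2 * wallis 0 q * zint (q + 1) (\<lambda>x. h x - poly p x)\<bar> \<le> e / (2 * c) * c"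
    proof -
      have "\<bar>zint (q + 1) (\<lambda>x. h x - poly p x)\<bar> \<le> e / (2 * c) * (2 * wallis 0 (q + 1))"
        using p by (intro zint_abs_le cont) (simp add: less_imp_le)
      then have "2 * wallis 0 q * \<bar>zint (q + 1) (\<lambda>x. h x - poly p x)\<bar>
          \<le> 2 * wallis 0 q * (e / (2 * c) * (2 * wallis 0 (q + 1)))"
        using wallis_pos[of 0 q] by (intro mult_left_mono) auto
      also have "\<dots> = e / (2 * c) * c"
        unfolding c_def by (simp only: mult_ac)
      finally show ?thesis
        using wallis_pos[of 0 q] by (simp add: abs_mult)
    qed
    moreover have "zint (q + 1) (\<lambda>x. h x - poly p x) = zint (q + 1) h - zint (q + 1) (poly p)"
      by (intro zint_diff h continuous_intros)
    then have "L h - 2 * wallis 0 q * zint (q + 1) h =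
        (L h - L (poly p)) - 2 * wallis 0 q * zint (q + 1) (\<lambda>x. h x - poly p x)"
      by (simp only: poly right_diff_distrib)
    moreover have "e / (2 * c) * c = e / 2" using c by simp
    ultimately show ?thesis by linarith
  qed
  then have "L h - 2 * wallis 0 q * zint (q + 1) h = 0"
    by (metis dense_ge abs_le_zero_iff)
  then show ?thesis by (simp add: L_def)
qed

definition zonal_psd :: "nat \<Rightarrow> (real \<Rightarrow> real) \<Rightarrow> bool" where
  "zonal_psd m h \<longleftrightarrow> psd (unit_sphere m) (\<lambda>\<xi> \<eta>. h (dot m \<xi> \<eta>))"

lemma dot_commute: "dot m \<xi> \<eta> = dot m \<eta> \<xi>"
  by (simp add: dot_def mult.commute)

lemma dot_self: "\<xi> \<in> unit_sphere m \<Longrightarrow> dot m \<xi> \<xi> = 1"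
  by (simp add: dot_def unit_sphere_def power2_eq_square)

lemma dot_bound:
  assumes "\<xi> \<in> unit_sphere m" "\<eta> \<in> unit_sphere m"
  shows "dot m \<xi> \<eta> \<in> {-1..1}"
proof -
  have "(\<Sum>i\<le>m. (\<xi> i + \<eta> i)\<^sup>2) \<ge> 0" "(\<Sum>i\<le>m. (\<xi> i - \<eta> i)\<^sup>2) \<ge> 0"
    by (auto intro: sum_nonneg)
  then show ?thesis
    using assms by (simp add: dot_def unit_sphere_def power2_sum power2_diff sum.distrib
        sum_subtractf sum_distrib_left[symmetric] mult.assoc)
qed

text \<open>The point at distance \<open>a\<close> from the pole \<open>e\<^bsub>m+1\<^esub>\<close> with longitude \<open>\<omega>\<close>.\<close>

definition spherical_point :: "nat \<Rightarrow> real \<Rightarrow> (nat \<Rightarrow> real) \<Rightarrow> nat \<Rightarrow> real" where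
  "spherical_point m a \<omega> = (\<lambda>i. if i \<le> m then sin a * \<omega> i else if i = Suc m then cos a else 0)"

lemma dot_spherical_point:
  "dot (Suc m) (spherical_point m a \<xi>) (spherical_point m b \<eta>) = cos a * cos b + sin a * sin b * dot m \<xi> \<eta>"
proof -
  have "(\<Sum>i\<le>m. spherical_point m a \<xi> i * spherical_point m b \<eta> i) = sin a * sin b * dot m \<xi> \<eta>"
    unfolding dot_def sum_distrib_left by (intro sum.cong refl) (auto simp: spherical_point_def mult_ac)
  then show ?thesis by (simp add: dot_def spherical_point_def)
qed

lemma spherical_point_in_sphere:
  assumes "\<omega> \<in> unit_sphere m"
  shows "spherical_point m a \<omega> \<in> unit_sphere (Suc m)"
proof -
  have "dot (Suc m) (spherical_point m a \<omega>) (spherical_point m a \<omega>) = 1"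
    unfolding dot_spherical_point dot_self[OF assms] by (simp add: power2_eq_square[symmetric])
  then show ?thesis
    by (simp add: unit_sphere_def dot_def power2_eq_square) (simp add: spherical_point_def)
qed

definition circle_point :: "real \<Rightarrow> nat \<Rightarrow> real" where
  "circle_point a = (\<lambda>i. if i = 0 then cos a else if i = 1 then sin a else 0)"

lemma circle_point_in_sphere: "circle_point a \<in> unit_sphere 1"
  by (simp add: circle_point_def unit_sphere_def)

lemma dot_circle_point: "dot 1 (circle_point a) (circle_point b) = cos (a - b)"
  by (simp add: circle_point_def dot_def cos_diff)

lemma periodic_cos_integral:
  fixes h :: "real \<Rightarrow> real"
  assumes h: "continuous_on {-1..1} h" and a: "a \<in> {0..2 * pi}"
  shows "integral {0..2 * pi} (\<lambda>b. h (cos (a - b))) = 2 * zint 0 h"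
proof -
  note int = integrable_continuous_interval[OF continuous_on_cos_comp[OF h]]
  have "integral {0..2 * pi} (\<lambda>b. h (cos (a - b))) = integral {a - 2 * pi..a} (\<lambda>x. h (cos x))"
    using integral_flip[of "a - 2 * pi" a "\<lambda>x. h (cos x)" a] by simp
  also have "\<dots> = integral {a - 2 * pi..0} (\<lambda>x. h (cos x)) + integral {0..a} (\<lambda>x. h (cos x))"
    using a by (intro Henstock_Kurzweil_Integration.integral_combine[symmetric] int) auto
  also have "integral {a - 2 * pi..0} (\<lambda>x. h (cos x)) = integral {a..2 * pi} (\<lambda>x. h (cos x))"
    using integral_shift_real_ivl[of a "2 * pi" "2 * pi" "\<lambda>x. h (cos x)"] by simp
  also have "integral {a..2 * pi} (\<lambda>x. h (cos x)) + integral {0..a} (\<lambda>x. h (cos x))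
      = integral {0..2 * pi} (\<lambda>x. h (cos x))"
    using a by (subst add.commute) (intro Henstock_Kurzweil_Integration.integral_combine int; simp)
  also have "\<dots> = integral {0..pi} (\<lambda>x. h (cos x)) + integral {pi..2 * pi} (\<lambda>x. h (cos x))"
    by (intro Henstock_Kurzweil_Integration.integral_combine[symmetric] int) auto
  also have "integral {pi..2 * pi} (\<lambda>x. h (cos x)) = integral {0..pi} (\<lambda>x. h (cos x))"
    using integral_flip[of pi "2 * pi" "\<lambda>x. h (cos x)" "2 * pi"] by simp
  finally show ?thesis by (simp add: zint_def)
qed

text \<open>
  Up to a positive factor, the mean of \<open>h\<close> is the double integral of its kernel over the sphere.
  In spherical coordinates the integration over the longitudes is the same statement in one dimension
  less, which leaves a positive definite kernel in the latitudes.
\<close>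

theorem zint_nonneg_of_zonal_psd:
  fixes h :: "real \<Rightarrow> real"
  assumes "continuous_on {-1..1} h" "zonal_psd (q + 1) h"
  shows "0 \<le> zint q h"
  using assms
proof (induction q arbitrary: h)
  case 0
  have K: "psd {0..2 * pi} (\<lambda>a b. h (cos (a - b)))"
  proof -
    have "psd (unit_sphere 1) (\<lambda>\<xi> \<eta>. h (dot 1 \<xi> \<eta>))"
      using 0(2) by (simp add: zonal_psd_def)
    from psd_pullback[OF this circle_point_in_sphere]
    have "psd {0..2 * pi} (\<lambda>a b. h (dot 1 (circle_point a) (circle_point b)))" .
    then show ?thesis by (simp only: dot_circle_point)
  qed
  have "continuous_on ({0..2 * pi} \<times> {0..2 * pi}) (\<lambda>(a, b). h (cos (a - b)))"
    unfolding case_prod_unfold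
    by (rule continuous_on_compose2[OF 0(1)]) (auto intro!: continuous_intros)
  then have "0 \<le> integral {0..2 * pi} (\<lambda>a. integral {0..2 * pi} (\<lambda>b. h (cos (a - b))))"
    by (intro psd_double_integral_nonneg K) auto
  also have "\<dots> = integral {0..2 * pi} (\<lambda>a. 2 * zint 0 h)"
    by (intro integral_cong periodic_cos_integral 0(1))
  also have "\<dots> = 4 * pi * zint 0 h" by simp
  finally show ?case using pi_gt_zero by (auto simp: zero_le_mult_iff)
next
  case (Suc q)
  note h = Suc.prems(1)
  define H where "H a b = zint q (\<lambda>y. h (cos a * cos b + sin a * sin b * y))" for a b
  have "psd {0..pi} H"
    unfolding psd_def
  proof (intro conjI ballI allI impI)
    show "H a b = H b a" for a b
      by (simp add: H_def mult_ac)
  next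
    fix F and c :: "real \<Rightarrow> real"
    assume F: "finite F" "F \<subseteq> {0..pi}"
    define g where "g y = (\<Sum>a\<in>F. \<Sum>b\<in>F. c a * c b * h (cos a * cos b + sin a * sin b * y))" for y
    have "psd (unit_sphere (Suc (q + 1))) (\<lambda>\<xi> \<eta>. h (dot (Suc (q + 1)) \<xi> \<eta>))"
      using Suc.prems(2) by (simp add: zonal_psd_def)
    from psd_lincomb[OF this F(1), of "unit_sphere (q + 1)" "spherical_point (q + 1)" c]
    have "psd (unit_sphere (q + 1)) (\<lambda>\<xi> \<eta>. \<Sum>a\<in>F. \<Sum>b\<in>F. c a * c b *
        h (dot (Suc (q + 1)) (spherical_point (q + 1) a \<xi>) (spherical_point (q + 1) b \<eta>)))"
      using spherical_point_in_sphere by auto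
    then have "zonal_psd (q + 1) g"
      unfolding zonal_psd_def g_def dot_spherical_point .
    moreover have "continuous_on {-1..1} g"
      unfolding g_def by (intro continuous_intros continuous_on_latitude h)
    ultimately have "0 \<le> zint q g" by (rule Suc.IH[rotated])
    also have "zint q g = (\<Sum>a\<in>F. \<Sum>b\<in>F. c a * c b * H a b)"
      unfolding g_def H_def
      by (subst zint_sum[OF F(1)], intro continuous_intros continuous_on_latitude h,
          subst zint_sum[OF F(1)], intro continuous_intros continuous_on_latitude h,
          simp only: zint_cmult)
    finally show "0 \<le> (\<Sum>a\<in>F. \<Sum>b\<in>F. c a * c b * H a b)" .
  qed
  then have K: "psd {0..pi} (\<lambda>a b. H a b * (sin a ^ (q + 1) * sin b ^ (q + 1)))"
    by (intro psd_mult psd_rank_one)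
  have "continuous_on ({0..pi} \<times> {0..pi}) (\<lambda>(a, b). H a b)"
    unfolding H_def by (rule continuous_on_zint_average[OF h])
  then have "continuous_on ({0..pi} \<times> {0..pi}) (\<lambda>(a, b). H a b * (sin a ^ (q + 1) * sin b ^ (q + 1)))"
    unfolding case_prod_unfold by (intro continuous_intros)
  then have "0 \<le> integral {0..pi} (\<lambda>a. integral {0..pi} (\<lambda>b. H a b * (sin a ^ (q + 1) * sin b ^ (q + 1))))"
    by (intro psd_double_integral_nonneg K) auto
  also have "\<dots> = integral {0..pi} (\<lambda>a. (2 * wallis 0 q * zint (q + 1) h) * (cos a ^ 0 * sin a ^ (q + 1)))"
  proof (intro integral_cong)
    fix a
    have "integral {0..pi} (\<lambda>b. H a b * (sin a ^ (q + 1) * sin b ^ (q + 1)))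
        = sin a ^ (q + 1) * integral {0..pi} (\<lambda>b. H b a * sin b ^ (q + 1))"
      unfolding integral_mult_right[symmetric] by (simp add: H_def mult_ac)
    also have "\<dots> = sin a ^ (q + 1) * (2 * wallis 0 q * zint (q + 1) h)"
      unfolding H_def zint_average[OF h] ..
    finally show "integral {0..pi} (\<lambda>b. H a b * (sin a ^ (q + 1) * sin b ^ (q + 1)))
        = (2 * wallis 0 q * zint (q + 1) h) * (cos a ^ 0 * sin a ^ (q + 1))" by simp
  qed
  also have "\<dots> = (2 * wallis 0 q * (2 * wallis 0 (q + 1))) * zint (q + 1) h"
    unfolding integral_mult_right trig_power_integral by simp
  finally have "0 \<le> (2 * wallis 0 q * (2 * wallis 0 (q + 1))) * zint (q + 1) h" .
  moreover have "2 * wallis 0 q * (2 * wallis 0 (q + 1)) > 0"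
    using wallis_pos[of 0 q] wallis_pos[of 0 "q + 1"] by (intro mult_pos_pos) auto
  ultimately show ?case by (simp only: zero_le_mult_iff) simp
qed

section \<open>Gegenbauer polynomials\<close>

lemma continuous_on_polynomial: "continuous_on S (poly (p :: real poly))"
  by (rule continuous_on_poly[OF continuous_on_id])

text \<open>
  The Laplace--Beltrami operator of the sphere \<open>S\<^bsup>q+1\<^esup>\<close>, restricted to the zonal polynomials.
\<close>

definition lap :: "nat \<Rightarrow> real poly \<Rightarrow> real poly" where
  "lap q p = [:1, 0, -1:] * pderiv (pderiv p) - smult (real q + 1) ([:0, 1:] * pderiv p)"

definition lap_ev :: "nat \<Rightarrow> nat \<Rightarrow> real" where
  "lap_ev q n = real n * (real n + real q)"

lemma coeff_lap:
  "coeff (lap q p) n = (real n + 2) * (real n + 1) * coeff p (n + 2) - lap_ev q n * coeff p n"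
proof (cases n)
  case 0
  then show ?thesis by (simp add: lap_def lap_ev_def coeff_pderiv numeral_2_eq_2)
next
  case (Suc k)
  show ?thesis
    unfolding Suc by (cases k) (simp_all add: lap_def lap_ev_def coeff_pderiv numeral_2_eq_2 algebra_simps)
qed

lemma poly_lap:
  "poly (lap q p) x = (1 - x\<^sup>2) * poly (pderiv (pderiv p)) x - (real q + 1) * (x * poly (pderiv p) x)"
  by (simp add: lap_def power2_eq_square algebra_simps)

lemma lap_add: "lap q (p + r) = lap q p + lap q r"
  by (rule poly_eqI) (simp add: coeff_lap algebra_simps)

lemma lap_smult: "lap q (smult c p) = smult c (lap q p)"
  by (rule poly_eqI) (simp add: coeff_lap algebra_simps)

lemma lap_sum: "lap q (sum f A) = (\<Sum>a\<in>A. lap q (f a))"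
  by (rule poly_eqI) (simp add: coeff_lap coeff_sum sum_distrib_left sum_subtractf)

lemma lap_ev_less: "k < n \<Longrightarrow> lap_ev q k < lap_ev q n"
  unfolding lap_ev_def by (intro mult_strict_mono) auto

text \<open>
  Back substitution: in the monomial basis the operator is triangular, and its diagonal entries
  \<open>-lap_ev q k\<close>, for \<open>k < n\<close>, differ from \<open>-lap_ev q n\<close>.
\<close>

lemma lap_solve:
  assumes "k \<le> n" "\<And>i. i \<ge> k \<Longrightarrow> coeff g i = 0"
  shows "\<exists>p. (\<forall>i\<ge>k. coeff p i = 0) \<and> lap q p + smult (lap_ev q n) p = g"
  using assms
proof (induction k arbitrary: g)
  case 0
  then have "g = 0" by (intro poly_eqI) simp
  then show ?case by (intro exI[of _ 0]) (simp add: lap_def)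
next
  case (Suc k)
  define a where "a = coeff g k / (lap_ev q n - lap_ev q k)"
  define r where "r = monom a k"
  have ne: "lap_ev q n - lap_ev q k \<noteq> 0" using lap_ev_less[of k n q] Suc.prems(1) by auto
  have "coeff (g - (lap q r + smult (lap_ev q n) r)) i = 0" if i: "i \<ge> k" for i
  proof (cases "i = k")
    case True
    have "(lap_ev q n - lap_ev q k) * a = coeff g k" using ne by (simp add: a_def)
    then show ?thesis using True by (simp add: coeff_lap r_def algebra_simps)
  next
    case False
    then show ?thesis using i Suc.prems(2)[of i] by (simp add: coeff_lap r_def)
  qed
  from Suc.IH[OF _ this] Suc.prems(1) obtain p where
    p: "\<forall>i\<ge>k. coeff p i = 0" "lap q p + smult (lap_ev q n) p = g - (lap q r + smult (lap_ev q n) r)"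
    by auto
  have "lap q (p + r) + smult (lap_ev q n) (p + r) = g"
    using p(2) by (simp add: lap_add smult_add_right algebra_simps)
  moreover have "\<forall>i\<ge>Suc k. coeff (p + r) i = 0"
    using p(1) by (simp add: r_def)
  ultimately show ?case by blast
qed

lemma gegen_exists:
  "\<exists>Q. coeff Q n = 1 \<and> (\<forall>i>n. coeff Q i = 0) \<and> lap q Q = smult (- lap_ev q n) Q"
proof -
  define r :: "real poly" where "r = monom 1 n"
  have "coeff (lap q r + smult (lap_ev q n) r) i = 0" if "i \<ge> n" for i
    using that by (auto simp: coeff_lap r_def)
  from lap_solve[of n n _ q, OF le_refl this] obtain p where
    p: "\<forall>i\<ge>n. coeff p i = 0" "lap q p + smult (lap_ev q n) p = lap q r + smult (lap_ev q n) r"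
    by auto
  have "lap q (r + smult (-1) p) + smult (lap_ev q n) (r + smult (-1) p) = 0"
    using p(2) by (simp only: lap_add lap_smult smult_add_right) (simp add: algebra_simps)
  then have "lap q (r + smult (-1) p) = smult (- lap_ev q n) (r + smult (-1) p)"
    by (simp only: eq_neg_iff_add_eq_0 smult_minus_left)
  moreover have "coeff (r + smult (-1) p) n = 1" "\<forall>i>n. coeff (r + smult (-1) p) i = 0"
    using p(1) by (auto simp: r_def)
  ultimately show ?thesis by blast
qed

text \<open>
  The monic multiple of the Gegenbauer polynomial \<open>C\<^sub>n\<close> with parameter \<open>q/2\<close> (of the Chebyshev
  polynomial \<open>T\<^sub>n\<close> for \<open>q = 0\<close>).
\<close>

definition gegen :: "nat \<Rightarrow> nat \<Rightarrow> real poly" where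
  "gegen q n = (SOME Q. coeff Q n = 1 \<and> (\<forall>i>n. coeff Q i = 0) \<and> lap q Q = smult (- lap_ev q n) Q)"

lemma coeff_gegen_self: "coeff (gegen q n) n = 1"
  and coeff_gegen_above: "i > n \<Longrightarrow> coeff (gegen q n) i = 0"
  and lap_gegen: "lap q (gegen q n) = smult (- lap_ev q n) (gegen q n)"
  using someI_ex[OF gegen_exists[of n q]] unfolding gegen_def by auto

lemma gegen_neq_0: "gegen q n \<noteq> 0"
  using coeff_gegen_self[of q n] by auto

lemma degree_gegen: "degree (gegen q n) = n"
  using coeff_gegen_self[of q n] coeff_gegen_above[of n _ q]
  by (intro antisym degree_le le_degree) auto

lemma gegen_0: "gegen q 0 = 1"
proof (rule poly_eqI)
  fix i show "coeff (gegen q 0) i = coeff 1 i"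
    using coeff_gegen_self[of q 0] coeff_gegen_above[of 0 i q] by (cases i) auto
qed

text \<open>
  The eigenvalue equation ties the coefficient of degree \<open>i\<close> to the one of degree \<open>i + 2\<close>, so the
  vanishing of the coefficient of degree \<open>n + 1\<close> is inherited downwards.
\<close>

lemma coeff_gegen_parity: "i + 2 * j + 1 = n \<Longrightarrow> coeff (gegen q n) i = 0"
proof (induction j arbitrary: i)
  case 0
  have "coeff (lap q (gegen q n)) i = - lap_ev q n * coeff (gegen q n) i"
    by (simp add: lap_gegen)
  moreover have "coeff (gegen q n) (i + 2) = 0" using 0 by (intro coeff_gegen_above) auto
  ultimately have "(lap_ev q n - lap_ev q i) * coeff (gegen q n) i = 0"
    by (simp add: coeff_lap algebra_simps)
  then show ?case using lap_ev_less[of i n q] 0 by auto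
next
  case (Suc j)
  have "coeff (lap q (gegen q n)) i = - lap_ev q n * coeff (gegen q n) i"
    by (simp add: lap_gegen)
  moreover have "coeff (gegen q n) (i + 2) = 0" using Suc.prems by (intro Suc.IH) auto
  ultimately have "(lap_ev q n - lap_ev q i) * coeff (gegen q n) i = 0"
    by (simp add: coeff_lap algebra_simps)
  then show ?case using lap_ev_less[of i n q] Suc.prems by auto
qed

lemma poly_gegen_minus: "poly (gegen q n) (- x) = (-1) ^ n * poly (gegen q n) x"
proof -
  have "coeff (gegen q n) i * (- x) ^ i = (-1) ^ n * (coeff (gegen q n) i * x ^ i)" if "i \<le> n" for i
  proof (cases "even (n - i)")
    case True
    then have "(-1 :: real) ^ i = (-1) ^ n" using that by (cases "even i") auto
    then show ?thesis by (simp add: power_minus[of x])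
  next
    case False
    then obtain j where "n - i = 2 * j + 1" by (metis oddE)
    then have "coeff (gegen q n) i = 0" using that by (intro coeff_gegen_parity[of i j]) auto
    then show ?thesis by simp
  qed
  then show ?thesis
    unfolding poly_altdef degree_gegen sum_distrib_left by (intro sum.cong refl) simp
qed

text \<open>
  Integration by parts. The right hand side is symmetric in \<open>p\<close> and \<open>s\<close>, so the operator is
  self-adjoint and eigenfunctions for different eigenvalues are orthogonal.
\<close>

lemma lap_green:
  "zint q (\<lambda>x. poly (lap q p) x * poly s x) =
   - zint q (\<lambda>x. (1 - x\<^sup>2) * poly (pderiv p) x * poly (pderiv s) x)"
proof -
  have "((\<lambda>t. poly (lap q p) (cos t) * poly s (cos t) * sin t ^ q +
           (1 - (cos t)\<^sup>2) * poly (pderiv p) (cos t) * poly (pderiv s) (cos t) * sin t ^ q) has_integral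
         (- (sin pi ^ (q + 1) * (poly (pderiv p) (cos pi) * poly s (cos pi))) -
          - (sin 0 ^ (q + 1) * (poly (pderiv p) (cos 0) * poly s (cos 0))))) {0..pi}"
  proof (rule fundamental_theorem_of_calculus)
    fix t :: real
    have sin2: "1 - (cos t)\<^sup>2 = sin t * sin t"
      using sin_squared_eq[of t] by (simp add: power2_eq_square)
    have "((\<lambda>t. - (sin t ^ Suc q * (poly (pderiv p) (cos t) * poly s (cos t)))) has_real_derivative
        - ((1 + real q) * sin t ^ q * cos t * (poly (pderiv p) (cos t) * poly s (cos t)) +
           sin t ^ Suc q * (poly (pderiv (pderiv p)) (cos t) * (- sin t) * poly s (cos t) +
             poly (pderiv p) (cos t) * (poly (pderiv s) (cos t) * (- sin t))))) (at t within {0..pi})"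
      by (rule derivative_eq_intros poly_DERIV[THEN DERIV_chain2] refl)+ (simp add: algebra_simps)
    then show "((\<lambda>t. - (sin t ^ (q + 1) * (poly (pderiv p) (cos t) * poly s (cos t)))) has_vector_derivative
        poly (lap q p) (cos t) * poly s (cos t) * sin t ^ q +
           (1 - (cos t)\<^sup>2) * poly (pderiv p) (cos t) * poly (pderiv s) (cos t) * sin t ^ q) (at t within {0..pi})"
      unfolding has_real_derivative_iff_has_vector_derivative[symmetric] poly_lap sin2 Suc_eq_plus1[symmetric]
      by (rule DERIV_cong) (simp add: algebra_simps)
  qed simp
  then have "zint q (\<lambda>x. poly (lap q p) x * poly s x + (1 - x\<^sup>2) * poly (pderiv p) x * poly (pderiv s) x) = 0"
    unfolding zint_def by (simp add: distrib_right integral_unique)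
  then show ?thesis
    by (subst (asm) zint_add) (auto intro!: continuous_intros)
qed

lemma gegen_orthogonal:
  assumes "n \<noteq> k"
  shows "zint q (\<lambda>x. poly (gegen q n) x * poly (gegen q k) x) = 0"
proof -
  have ev: "zint q (\<lambda>x. poly (lap q (gegen q m)) x * poly r x) =
      - lap_ev q m * zint q (\<lambda>x. poly (gegen q m) x * poly r x)" for m r
    unfolding lap_gegen poly_smult mult.assoc zint_cmult ..
  have "zint q (\<lambda>x. poly (lap q (gegen q n)) x * poly (gegen q k) x) =
        zint q (\<lambda>x. poly (lap q (gegen q k)) x * poly (gegen q n) x)"
    unfolding lap_green by (simp only: mult_ac)
  then have "lap_ev q n * zint q (\<lambda>x. poly (gegen q n) x * poly (gegen q k) x) =
             lap_ev q k * zint q (\<lambda>x. poly (gegen q n) x * poly (gegen q k) x)"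
    unfolding ev by (simp add: mult.commute[of "poly (gegen q k) _"])
  moreover have "lap_ev q n \<noteq> lap_ev q k"
    using assms lap_ev_less[of n k q] lap_ev_less[of k n q] by (cases n k rule: linorder_cases) auto
  ultimately show ?thesis by simp
qed

lemma gegen_expansion:
  assumes "\<And>i. i > n \<Longrightarrow> coeff p i = 0"
  shows "\<exists>c. p = (\<Sum>k\<le>n. smult (c k) (gegen q k)) \<and> c n = coeff p n"
  using assms
proof (induction n arbitrary: p)
  case 0
  have "p = smult (coeff p 0) (gegen q 0)"
  proof (rule poly_eqI)
    fix i show "coeff p i = coeff (smult (coeff p 0) (gegen q 0)) i"
      using 0[of i] by (cases i) (auto simp: gegen_0)
  qed
  then show ?case by (intro exI[of _ "\<lambda>_. coeff p 0"]) simp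
next
  case (Suc n)
  define r where "r = p - smult (coeff p (Suc n)) (gegen q (Suc n))"
  have "coeff r i = 0" if "i > n" for i
    using Suc.prems[of i] that coeff_gegen_self[of q "Suc n"] coeff_gegen_above[of "Suc n" i q]
    by (cases "i = Suc n") (auto simp: r_def)
  from Suc.IH[OF this] obtain c where c: "r = (\<Sum>k\<le>n. smult (c k) (gegen q k))" by blast
  have "p = (\<Sum>k\<le>Suc n. smult ((c(Suc n := coeff p (Suc n))) k) (gegen q k))"
    using c by (simp add: r_def algebra_simps)
  then show ?case by (intro exI[of _ "c(Suc n := coeff p (Suc n))"]) simp
qed

lemma gegen_orthogonal_lower:
  assumes "\<And>i. i \<ge> n \<Longrightarrow> coeff p i = 0"
  shows "zint q (\<lambda>x. poly (gegen q n) x * poly p x) = 0"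
proof (cases n)
  case 0
  then have "p = 0" using assms by (intro poly_eqI) simp
  then show ?thesis using zint_const[of q 0] by simp
next
  case (Suc m)
  from gegen_expansion[of m p q] assms Suc obtain c where c: "p = (\<Sum>k\<le>m. smult (c k) (gegen q k))"
    by (auto simp: Suc_le_eq)
  have "zint q (\<lambda>x. poly (gegen q n) x * poly p x) =
      zint q (\<lambda>x. \<Sum>k\<le>m. c k * (poly (gegen q n) x * poly (gegen q k) x))"
    unfolding c by (simp add: poly_sum sum_distrib_left mult_ac)
  also have "\<dots> = (\<Sum>k\<le>m. c k * zint q (\<lambda>x. poly (gegen q n) x * poly (gegen q k) x))"
    by (subst zint_sum) (auto intro!: continuous_intros simp: zint_cmult)
  also have "\<dots> = 0"
    using Suc by (intro sum.neutral) (auto simp: gegen_orthogonal)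
  finally show ?thesis .
qed

text \<open>The weight may vanish at the end points, which are recovered by continuity.\<close>

lemma zint_square_eq_0D:
  fixes h :: "real \<Rightarrow> real"
  assumes h: "continuous_on {-1..1} h" and z: "zint q (\<lambda>x. (h x)\<^sup>2) = 0" and x: "x \<in> {-1..1}"
  shows "h x = 0"
proof -
  have cont: "continuous_on {0..pi} (\<lambda>t. (h (cos t))\<^sup>2 * sin t ^ q)"
    by (intro continuous_intros continuous_on_cos_comp h)
  have int: "((\<lambda>t. (h (cos t))\<^sup>2 * sin t ^ q) has_integral 0) {0..pi}"
    using integrable_integral[OF integrable_continuous_interval[OF cont]] z by (simp add: zint_def)
  have nonneg: "0 \<le> (h (cos t))\<^sup>2 * sin t ^ q" if "t \<in> box 0 pi" for t
    using that by (intro mult_nonneg_nonneg zero_le_power2 zero_le_power sin_ge_zero) auto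
  have npi: "\<not> pi \<le> 0" using pi_gt_zero by linarith
  have zero: "(h (cos t))\<^sup>2 * sin t ^ q = 0" if "t \<in> {0..pi}" for t
    by (rule has_integral_0_cbox_imp_0[of 0 pi "\<lambda>t. (h (cos t))\<^sup>2 * sin t ^ q"])
       (use cont int nonneg that npi in \<open>auto simp del: zero_le_mult_iff mult_eq_0_iff\<close>)
  have inner: "h y = 0" if "y \<in> {-1<..<1}" for y
  proof -
    have "arccos y \<in> {0..pi}" using that by (auto intro: arccos_lbound arccos_ubound)
    from zero[OF this] have "(h y)\<^sup>2 * sin (arccos y) ^ q = 0" using that by simp
    moreover have "sin (arccos y) > 0"
      using that arccos_lt_bounded[of y] by (auto intro!: sin_gt_zero)
    ultimately show ?thesis by simp
  qed
  show ?thesis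
    by (rule continuous_constant_on_closure[of "{-1<..<1}" h 0]) (use h inner x in auto)
qed

lemma gegen_norm_pos: "zint q (\<lambda>x. (poly (gegen q n) x)\<^sup>2) > 0"
proof -
  have "zint q (\<lambda>_. 0) \<le> zint q (\<lambda>x. (poly (gegen q n) x)\<^sup>2)"
    by (intro zint_mono continuous_intros) auto
  moreover have "zint q (\<lambda>x. (poly (gegen q n) x)\<^sup>2) \<noteq> 0"
  proof
    assume "zint q (\<lambda>x. (poly (gegen q n) x)\<^sup>2) = 0"
    then have "poly (gegen q n) x = 0" if "x \<in> {-1..1}" for x
      using zint_square_eq_0D[OF continuous_on_polynomial, of q "gegen q n" x] that by auto
    then have "{-1..1} \<subseteq> {x. poly (gegen q n) x = 0}" by auto
    then have "finite {-1..1::real}" using poly_roots_finite[OF gegen_neq_0] finite_subset by blast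
    then show False by (simp add: infinite_Icc)
  qed
  ultimately show ?thesis unfolding zint_const by simp
qed

section \<open>Positive definiteness of the Gegenbauer polynomials\<close>

definition rotate_plane :: "nat \<Rightarrow> nat \<Rightarrow> real \<Rightarrow> (nat \<Rightarrow> real) \<Rightarrow> nat \<Rightarrow> real" where
  "rotate_plane i j t \<xi> = \<xi>(i := cos t * \<xi> i - sin t * \<xi> j, j := sin t * \<xi> i + cos t * \<xi> j)"

lemma dot_rotate_plane:
  assumes "i \<noteq> j" "i \<le> m" "j \<le> m"
  shows "dot m (rotate_plane i j s \<xi>) (rotate_plane i j t \<eta>) =
    dot m \<xi> \<eta> + (cos (s - t) - 1) * (\<xi> i * \<eta> i + \<xi> j * \<eta> j) + sin (s - t) * (\<xi> i * \<eta> j - \<xi> j * \<eta> i)"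
proof -
  have split: "(\<Sum>k\<le>m. g k) = g i + g j + (\<Sum>k\<in>{..m} - {i, j}. g k)" for g :: "nat \<Rightarrow> real"
    using assms sum.subset_diff[of "{i, j}" "{..m}" g] by simp
  have rest: "(\<Sum>k\<in>{..m} - {i, j}. rotate_plane i j s \<xi> k * rotate_plane i j t \<eta> k)
      = (\<Sum>k\<in>{..m} - {i, j}. \<xi> k * \<eta> k)"
    by (intro sum.cong) (auto simp: rotate_plane_def)
  show ?thesis
    unfolding dot_def split rest using assms(1)
    by (simp add: rotate_plane_def cos_diff sin_diff algebra_simps)
qed

lemma rotate_plane_in_sphere:
  assumes "i \<noteq> j" "i \<le> m" "j \<le> m" "\<xi> \<in> unit_sphere m"
  shows "rotate_plane i j t \<xi> \<in> unit_sphere m"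
proof -
  have "dot m (rotate_plane i j t \<xi>) (rotate_plane i j t \<xi>) = 1"
    unfolding dot_rotate_plane[OF assms(1-3)] by (simp add: dot_self[OF assms(4)])
  moreover have "\<forall>k>m. rotate_plane i j t \<xi> k = 0"
    using assms by (auto simp: rotate_plane_def unit_sphere_def)
  ultimately show ?thesis by (simp add: unit_sphere_def dot_def power2_eq_square)
qed

lemma rotate_plane_0: "rotate_plane i j 0 \<xi> = \<xi>"
  by (auto simp: rotate_plane_def)

lemma second_symmetric_difference:
  fixes \<phi> :: "real \<Rightarrow> real"
  assumes d1: "\<And>t. (\<phi> has_real_derivative \<phi>' t) (at t)"
    and d2: "(\<phi>' has_real_derivative c) (at 0)"
  shows "((\<lambda>t. (2 * \<phi> 0 - \<phi> t - \<phi> (- t)) / t\<^sup>2) \<longlongrightarrow> - c) (at 0)"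
proof (rule lhopital[where f' = "\<lambda>t. \<phi>' (- t) - \<phi>' t" and g' = "\<lambda>t. 2 * t"])
  have cont: "isCont \<phi> t" for t using d1 by (rule DERIV_isCont)
  have "((\<lambda>t. 2 * \<phi> 0 - \<phi> t - \<phi> (- t)) \<longlongrightarrow> 2 * \<phi> 0 - \<phi> 0 - \<phi> (- 0)) (at 0)"
    by (intro tendsto_intros isCont_tendsto_compose[OF cont])
  then show "((\<lambda>t. 2 * \<phi> 0 - \<phi> t - \<phi> (- t)) \<longlongrightarrow> 0) (at 0)" by simp
  show "((\<lambda>t::real. t\<^sup>2) \<longlongrightarrow> 0) (at 0)" by (auto intro!: tendsto_eq_intros)
  show "\<forall>\<^sub>F t in at 0. (t::real)\<^sup>2 \<noteq> 0" "\<forall>\<^sub>F t in at 0. 2 * (t::real) \<noteq> 0"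
    by (auto simp: eventually_at intro!: exI[of _ 1])
  show "\<forall>\<^sub>F t in at 0. ((\<lambda>t. 2 * \<phi> 0 - \<phi> t - \<phi> (- t)) has_real_derivative \<phi>' (- t) - \<phi>' t) (at t)"
    by (intro always_eventually allI) (auto intro!: derivative_eq_intros d1 DERIV_chain2[OF d1])
  show "\<forall>\<^sub>F t in at 0. ((\<lambda>t::real. t\<^sup>2) has_real_derivative 2 * t) (at t)"
    by (intro always_eventually allI) (auto intro!: derivative_eq_intros)
  have lim: "((\<lambda>t. (\<phi>' t - \<phi>' 0) / t) \<longlongrightarrow> c) (at 0)"
    using d2 by (simp add: has_field_derivative_iff)
  have "filterlim (\<lambda>t::real. - t) (at 0) (at 0)"
    by (intro filterlim_atI) (auto intro!: tendsto_eq_intros simp: eventually_at intro: exI[of _ 1])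
  from filterlim_compose[OF lim this]
  have "((\<lambda>t. (\<phi>' (- t) - \<phi>' 0) / (- t)) \<longlongrightarrow> c) (at 0)" .
  from tendsto_mult[OF tendsto_const[of "- (1/2)"] tendsto_add[OF lim this]]
  have "((\<lambda>t. - (1/2) * ((\<phi>' t - \<phi>' 0) / t + (\<phi>' (- t) - \<phi>' 0) / (- t))) \<longlongrightarrow> - c) (at 0)"
    by simp
  moreover have "- (1/2) * ((\<phi>' t - \<phi>' 0) / t + (\<phi>' (- t) - \<phi>' 0) / (- t)) = (\<phi>' (- t) - \<phi>' t) / (2 * t)" for t
    by (cases "t = 0") (simp_all add: field_simps)
  ultimately show "((\<lambda>t. (\<phi>' (- t) - \<phi>' t) / (2 * t)) \<longlongrightarrow> - c) (at 0)" by (simp only:)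
qed

text \<open>
  For a rotation \<open>R\<close> in a coordinate plane attach to each point \<open>\<xi>\<close> the measure
  \<open>\<delta>\<^sub>\<xi> - \<delta>\<^bsub>R\<xi>\<^esub>\<close>. Since \<open>\<langle>R\<xi>, R\<eta>\<rangle> = \<langle>\<xi>, \<eta>\<rangle>\<close>, this turns the kernel into minus a symmetric
  second difference along the rotation. The Laplacian is the sum of the second derivatives along the
  rotations in all coordinate planes.
\<close>

lemma zonal_psd_minus_lap:
  assumes "zonal_psd (q + 1) (poly p)"
  shows "zonal_psd (q + 1) (poly (- lap q p))"
proof -
  let ?m = "q + 1"
  let ?S = "unit_sphere ?m"
  define P where "P = {(i, j). i \<le> ?m \<and> j \<le> ?m \<and> i \<noteq> j}"
  have finP: "finite P"
    by (rule finite_subset[of _ "{..?m} \<times> {..?m}"]) (auto simp: P_def)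
  define A where "A i j \<xi> \<eta> = \<xi> i * \<eta> i + \<xi> j * \<eta> j" for i j :: nat and \<xi> \<eta> :: "nat \<Rightarrow> real"
  define B where "B i j \<xi> \<eta> = \<xi> i * \<eta> j - \<xi> j * \<eta> i" for i j :: nat and \<xi> \<eta> :: "nat \<Rightarrow> real"
  define L where "L i j \<xi> \<eta> = poly (pderiv p) (dot ?m \<xi> \<eta>) * A i j \<xi> \<eta> -
      poly (pderiv (pderiv p)) (dot ?m \<xi> \<eta>) * (B i j \<xi> \<eta>)\<^sup>2" for i j \<xi> \<eta>
  have K: "psd ?S (\<lambda>\<xi> \<eta>. poly p (dot ?m \<xi> \<eta>))"
    using assms by (simp add: zonal_psd_def)
  have "psd ?S (L i j)" if ij: "i \<noteq> j" "i \<le> ?m" "j \<le> ?m" for i j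
  proof -
    define \<phi> where "\<phi> \<xi> \<eta> t = poly p (dot ?m \<xi> \<eta> + (cos t - 1) * A i j \<xi> \<eta> + sin t * B i j \<xi> \<eta>)" for \<xi> \<eta> t
    have rot: "poly p (dot ?m (rotate_plane i j s \<xi>) (rotate_plane i j t \<eta>)) = \<phi> \<xi> \<eta> (s - t)" for s t \<xi> \<eta>
      unfolding dot_rotate_plane[OF ij] by (simp add: \<phi>_def A_def B_def)
    have diff: "psd ?S (\<lambda>\<xi> \<eta>. (2 * \<phi> \<xi> \<eta> 0 - \<phi> \<xi> \<eta> t - \<phi> \<xi> \<eta> (- t)) / t\<^sup>2)" for t
    proof -
      have "psd ?S (\<lambda>\<xi> \<eta>. \<Sum>a\<in>{False, True}. \<Sum>b\<in>{False, True}. (if a then 1 else -1) * (if b then 1 else -1) *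
          poly p (dot ?m (rotate_plane i j (if a then t else 0) \<xi>) (rotate_plane i j (if b then t else 0) \<eta>)))"
        using rotate_plane_in_sphere[OF ij]
        by (intro psd_lincomb[OF K, where g = "\<lambda>a. rotate_plane i j (if a then t else 0)"]) simp_all
      then have "psd ?S (\<lambda>\<xi> \<eta>. (1 / t\<^sup>2) * (2 * \<phi> \<xi> \<eta> 0 - \<phi> \<xi> \<eta> t - \<phi> \<xi> \<eta> (- t)))"
        unfolding rot by (intro psd_scale) (simp_all add: algebra_simps)
      then show ?thesis by simp
    qed
    show ?thesis
    proof (rule psd_limit[where F = "at (0::real)" and K = "\<lambda>t \<xi> \<eta>. (2 * \<phi> \<xi> \<eta> 0 - \<phi> \<xi> \<eta> t - \<phi> \<xi> \<eta> (- t)) / t\<^sup>2"])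
      fix \<xi> \<eta> :: "nat \<Rightarrow> real"
      \<comment> \<open>\<open>u t\<close> is the inner product of \<open>\<eta>\<close> with the rotated \<open>\<xi>\<close>; at \<open>0\<close> its first two derivatives are
        \<open>B\<close> and \<open>-A\<close>.\<close>
      define u where "u t = dot ?m \<xi> \<eta> + (cos t - 1) * A i j \<xi> \<eta> + sin t * B i j \<xi> \<eta>" for t
      define u' where "u' t = - sin t * A i j \<xi> \<eta> + cos t * B i j \<xi> \<eta>" for t
      have u: "(u has_real_derivative u' t) (at t)" for t
        unfolding u_def[abs_def] u'_def by (auto intro!: derivative_eq_intros)
      have u': "(u' has_real_derivative - A i j \<xi> \<eta>) (at 0)"
        unfolding u'_def[abs_def] by (auto intro!: derivative_eq_intros)
      have "((\<lambda>t. (2 * \<phi> \<xi> \<eta> 0 - \<phi> \<xi> \<eta> t - \<phi> \<xi> \<eta> (- t)) / t\<^sup>2) \<longlongrightarrow>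
          - (poly (pderiv (pderiv p)) (u 0) * u' 0 * u' 0 + - A i j \<xi> \<eta> * poly (pderiv p) (u 0))) (at 0)"
      proof (rule second_symmetric_difference)
        show "(\<phi> \<xi> \<eta> has_real_derivative poly (pderiv p) (u t) * u' t) (at t)" for t
          unfolding \<phi>_def u_def[symmetric] by (rule DERIV_chain2[OF poly_DERIV u])
        show "((\<lambda>t. poly (pderiv p) (u t) * u' t) has_real_derivative
            poly (pderiv (pderiv p)) (u 0) * u' 0 * u' 0 + - A i j \<xi> \<eta> * poly (pderiv p) (u 0)) (at 0)"
          by (rule DERIV_mult[OF DERIV_chain2[OF poly_DERIV u] u'])
      qed
      then show "((\<lambda>t. (2 * \<phi> \<xi> \<eta> 0 - \<phi> \<xi> \<eta> t - \<phi> \<xi> \<eta> (- t)) / t\<^sup>2) \<longlongrightarrow> L i j \<xi> \<eta>) (at 0)"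
        by (simp add: L_def u_def u'_def power2_eq_square mult_ac)
    qed (use diff in auto)
  qed
  then have "psd ?S (\<lambda>\<xi> \<eta>. \<Sum>(i, j)\<in>P. L i j \<xi> \<eta>)"
    unfolding case_prod_unfold by (intro psd_sum) (auto simp: P_def)
  then have "psd ?S (\<lambda>\<xi> \<eta>. 1/2 * (\<Sum>(i, j)\<in>P. L i j \<xi> \<eta>))"
    by (intro psd_scale) auto
  moreover have "1/2 * (\<Sum>(i, j)\<in>P. L i j \<xi> \<eta>) = poly (- lap q p) (dot ?m \<xi> \<eta>)"
    if \<xi>: "\<xi> \<in> ?S" and \<eta>: "\<eta> \<in> ?S" for \<xi> \<eta>
  proof -
    let ?x = "dot ?m \<xi> \<eta>"
    \<comment> \<open>Every plane occurs twice in \<open>P\<close>, which explains the factor \<open>1/2\<close>.\<close>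
    have all: "(\<Sum>(i, j)\<in>P. g i j) = (\<Sum>i\<le>?m. \<Sum>j\<le>?m. g i j) - (\<Sum>i\<le>?m. g i i)" for g :: "nat \<Rightarrow> nat \<Rightarrow> real"
    proof -
      have "(\<Sum>i\<le>?m. \<Sum>j\<le>?m. g i j) = (\<Sum>(i, j)\<in>{..?m} \<times> {..?m}. g i j)"
        by (simp only: sum.cartesian_product)
      also have "{..?m} \<times> {..?m} = P \<union> (\<lambda>i. (i, i)) ` {..?m}"
        by (auto simp: P_def)
      also have "(\<Sum>(i, j)\<in>P \<union> (\<lambda>i. (i, i)) ` {..?m}. g i j) =
          (\<Sum>(i, j)\<in>P. g i j) + (\<Sum>(i, j)\<in>(\<lambda>i. (i, i)) ` {..?m}. g i j)"
        using finP by (intro sum.union_disjoint) (auto simp: P_def)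
      also have "(\<Sum>(i, j)\<in>(\<lambda>i. (i, i)) ` {..?m}. g i j) = (\<Sum>i\<le>?m. g i i)"
        by (subst sum.reindex) (auto simp: inj_on_def)
      finally show ?thesis by simp
    qed
    have sA: "(\<Sum>(i, j)\<in>P. A i j \<xi> \<eta>) = 2 * real ?m * ?x"
    proof -
      have "(\<Sum>i\<le>?m. \<Sum>j\<le>?m. A i j \<xi> \<eta>) = 2 * (real ?m + 1) * ?x"
      proof -
        have const: "(\<Sum>i\<le>M. \<Sum>j\<le>M. g i) = (real M + 1) * (\<Sum>i\<le>M. g i)" for M and g :: "nat \<Rightarrow> real"
          by (simp add: sum_distrib_left add.commute)
        have "(\<Sum>i\<le>?m. \<Sum>j\<le>?m. \<xi> j * \<eta> j) = (\<Sum>i\<le>?m. \<Sum>j\<le>?m. \<xi> i * \<eta> i)"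
          by (rule sum.swap)
        then show ?thesis
          unfolding A_def sum.distrib const by (simp only: dot_def const)
      qed
      moreover have "(\<Sum>i\<le>?m. A i i \<xi> \<eta>) = 2 * ?x"
        unfolding A_def dot_def sum_distrib_left by (intro sum.cong) auto
      ultimately show ?thesis unfolding all by (simp add: algebra_simps)
    qed
    have sB: "(\<Sum>(i, j)\<in>P. (B i j \<xi> \<eta>)\<^sup>2) = 2 * (1 - ?x\<^sup>2)"
    proof -
      have "(\<Sum>i\<le>?m. \<Sum>j\<le>?m. (B i j \<xi> \<eta>)\<^sup>2) =
          (\<Sum>i\<le>?m. \<Sum>j\<le>?m. (\<xi> i * \<xi> i) * (\<eta> j * \<eta> j)) + (\<Sum>i\<le>?m. \<Sum>j\<le>?m. (\<eta> i * \<eta> i) * (\<xi> j * \<xi> j))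
          - 2 * (\<Sum>i\<le>?m. \<Sum>j\<le>?m. (\<xi> i * \<eta> i) * (\<xi> j * \<eta> j))"
        unfolding sum_distrib_left sum.distrib[symmetric] sum_subtractf[symmetric] B_def
        by (intro sum.cong refl) (simp add: power2_eq_square algebra_simps)
      also have "\<dots> = dot ?m \<xi> \<xi> * dot ?m \<eta> \<eta> + dot ?m \<eta> \<eta> * dot ?m \<xi> \<xi> - 2 * (?x * ?x)"
        by (simp only: dot_def sum_product)
      also have "\<dots> = 2 * (1 - ?x\<^sup>2)"
        unfolding dot_self[OF \<xi>] dot_self[OF \<eta>] by (simp add: power2_eq_square)
      finally show ?thesis unfolding all by (simp add: B_def)
    qed
    have "(\<Sum>(i, j)\<in>P. L i j \<xi> \<eta>) = poly (pderiv p) ?x * (\<Sum>(i, j)\<in>P. A i j \<xi> \<eta>) -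
        poly (pderiv (pderiv p)) ?x * (\<Sum>(i, j)\<in>P. (B i j \<xi> \<eta>)\<^sup>2)"
      by (simp add: L_def case_prod_unfold sum_subtractf sum_distrib_left)
    then show ?thesis
      unfolding sA sB by (simp add: poly_lap algebra_simps)
  qed
  ultimately show ?thesis
    unfolding zonal_psd_def by (rule psd_cong)
qed

lemma psd_dot: "psd X (dot m)"
proof -
  have "psd X (\<lambda>\<xi> \<eta>. \<Sum>i\<le>m. \<xi> i * \<eta> i)"
    by (intro psd_sum psd_rank_one[of X "\<lambda>\<xi>. \<xi> _"])
  then show ?thesis by (simp only: dot_def[abs_def])
qed

lemma zonal_psd_power: "zonal_psd m (\<lambda>x. x ^ n)"
  unfolding zonal_psd_def by (rule psd_power[OF psd_dot])

text \<open>
  The power \<open>x\<^sup>n\<close> is positive definite with leading Gegenbauer coefficient \<open>1\<close>. Repeated application of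
  minus the Laplacian, normalised on degree \<open>n\<close>, damps the components of lower degree geometrically,
  so that the Gegenbauer polynomial of degree \<open>n\<close> remains in the limit.
\<close>

theorem zonal_psd_gegen: "zonal_psd (q + 1) (poly (gegen q n))"
proof (cases "n = 0")
  case True
  then show ?thesis using zonal_psd_power[of "q + 1" 0] by (simp add: gegen_0 zonal_psd_def)
next
  case False
  define N where "N = lap_ev q n"
  have N: "N > 0" using False by (simp add: N_def lap_ev_def)
  obtain c where c: "monom 1 n = (\<Sum>k\<le>n. smult (c k) (gegen q k))" "c n = 1"
    using gegen_expansion[of n "monom 1 n" q] by auto
  define p where "p j = (\<Sum>k\<le>n. smult (c k * (lap_ev q k / N) ^ j) (gegen q k))" for j
  have step: "p (Suc j) = smult (1 / N) (- lap q (p j))" for j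
    unfolding p_def lap_sum lap_smult lap_gegen
    by (rule poly_eqI) (simp add: coeff_sum sum_distrib_left sum_negf mult_ac)
  have pd: "zonal_psd (q + 1) (poly (p j))" for j
  proof (induction j)
    case 0
    have "p 0 = monom 1 n"
      using c(1) by (simp add: p_def)
    then have "poly (p 0) = (\<lambda>x. x ^ n)"
      by (simp add: fun_eq_iff poly_monom)
    then show ?case using zonal_psd_power by metis
  next
    case (Suc j)
    from zonal_psd_minus_lap[OF Suc] show ?case
      unfolding step zonal_psd_def poly_smult using N by (intro psd_scale) auto
  qed
  show ?thesis
    unfolding zonal_psd_def
  proof (rule psd_limit[where F = sequentially and K = "\<lambda>j \<xi> \<eta>. poly (p j) (dot (q + 1) \<xi> \<eta>)"])
    fix \<xi> \<eta> :: "nat \<Rightarrow> real"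
    let ?x = "dot (q + 1) \<xi> \<eta>"
    have "(\<lambda>j. c k * (lap_ev q k / N) ^ j * poly (gegen q k) ?x) \<longlonglongrightarrow> (if k = n then poly (gegen q n) ?x else 0)"
      if "k \<le> n" for k
    proof (cases "k = n")
      case True
      then show ?thesis using N c(2) by (simp add: N_def)
    next
      case False
      then have "norm (lap_ev q k / N) < 1"
        using that lap_ev_less[of k n q] N by (auto simp: N_def lap_ev_def)
      from tendsto_mult[OF tendsto_mult[OF tendsto_const[of "c k"] LIMSEQ_power_zero[OF this]]
          tendsto_const[of "poly (gegen q k) ?x"]]
      show ?thesis using False by simp
    qed
    then have "(\<lambda>j. \<Sum>k\<le>n. c k * (lap_ev q k / N) ^ j * poly (gegen q k) ?x) \<longlonglongrightarrow>
        (\<Sum>k\<le>n. if k = n then poly (gegen q n) ?x else 0)"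
      by (intro tendsto_sum) auto
    then show "(\<lambda>j. poly (p j) ?x) \<longlonglongrightarrow> poly (gegen q n) ?x"
      by (simp add: p_def poly_sum)
  qed (use pd in \<open>auto simp: zonal_psd_def\<close>)
qed

lemma sphere_pair_exists:
  assumes "x \<in> {-1..1}"
  obtains \<xi> \<eta> where "\<xi> \<in> unit_sphere (q + 1)" "\<eta> \<in> unit_sphere (q + 1)" "dot (q + 1) \<xi> \<eta> = x"
proof -
  define e :: "nat \<Rightarrow> real" where "e = (\<lambda>i. of_bool (i = 0))"
  have e: "e \<in> unit_sphere (q + 1)"
  proof -
    have "(\<Sum>i\<le>q + 1. (e i)\<^sup>2) = (\<Sum>i\<in>{0}. (e i)\<^sup>2)"
      by (rule sum.mono_neutral_right) (auto simp: e_def)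
    then show ?thesis by (auto simp: unit_sphere_def e_def)
  qed
  have r: "rotate_plane 0 (q + 1) (- arccos x) e \<in> unit_sphere (q + 1)"
    by (rule rotate_plane_in_sphere[OF _ _ _ e]) auto
  have "dot (q + 1) (rotate_plane 0 (q + 1) (- arccos x) e) (rotate_plane 0 (q + 1) 0 e) =
      dot (q + 1) e e + (cos (- arccos x - 0) - 1) * (e 0 * e 0 + e (q + 1) * e (q + 1)) +
      sin (- arccos x - 0) * (e 0 * e (q + 1) - e (q + 1) * e 0)"
    by (rule dot_rotate_plane) auto
  also have "\<dots> = x"
    unfolding dot_self[OF e] using assms by (simp add: e_def)
  finally show thesis using that[OF r e] by (simp add: rotate_plane_0)
qed

text \<open>
  The bound of a positive definite kernel by its diagonal, where a zonal kernel is constant. Any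
  \<open>x\<close> in the interval occurs as an inner product, because the sphere has positive dimension.
\<close>

lemma zonal_psd_abs_le:
  assumes "zonal_psd (q + 1) h" "x \<in> {-1..1}"
  shows "\<bar>h x\<bar> \<le> h 1"
proof -
  obtain \<xi> \<eta> where "\<xi> \<in> unit_sphere (q + 1)" "\<eta> \<in> unit_sphere (q + 1)" "dot (q + 1) \<xi> \<eta> = x"
    using sphere_pair_exists[OF assms(2)] .
  then show ?thesis
    using psd_abs_le[OF assms(1)[unfolded zonal_psd_def], of \<xi> \<eta> "h 1"] dot_self by metis
qed

lemma gegen_abs_le: "x \<in> {-1..1} \<Longrightarrow> \<bar>poly (gegen q n) x\<bar> \<le> poly (gegen q n) 1"
  by (rule zonal_psd_abs_le[OF zonal_psd_gegen])

lemma gegen_1_pos: "poly (gegen q n) 1 > 0"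
proof (rule ccontr)
  assume "\<not> ?thesis"
  then have "zint q (\<lambda>x. (poly (gegen q n) x)\<^sup>2) = zint q (\<lambda>_. 0)"
    using gegen_abs_le[of _ q n] by (intro zint_cong) force
  then show False using gegen_norm_pos[of q n] by (simp add: zint_const)
qed

section \<open>The half-step operators on Gegenbauer polynomials\<close>

text \<open>
  The operators \<open>I\<^sup>\<lambda>\<^sub>+\<close> and \<open>I\<^sup>\<lambda>\<^sub>-\<close> with \<open>d = 2 \<lambda> + 1\<close>, after the substitution
  \<open>u = -1 + (1 + x) sin\<^sup>2 t\<close>. In this form the integrand is continuous and the value at the end point is
  the limit. The second operator is the first one conjugated with the reflection \<open>x \<mapsto> -x\<close>.
\<close>

definition half_plus :: "nat \<Rightarrow> (real \<Rightarrow> real) \<Rightarrow> real \<Rightarrow> real" where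
  "half_plus d h x = 2 * (1 + x) * integral {0..pi/2} (\<lambda>t. h (-1 + (1 + x) * (sin t)\<^sup>2) * sin t ^ d)"

definition half_minus :: "nat \<Rightarrow> (real \<Rightarrow> real) \<Rightarrow> real \<Rightarrow> real" where
  "half_minus d h x = half_plus d (\<lambda>u. h (- u)) (- x)"

lemma half_plus_node:
  assumes "x \<in> {-1..1::real}"
  shows "-1 + (1 + x) * (sin t)\<^sup>2 \<in> {-1..1}"
proof -
  have "(1 + x) * (sin t)\<^sup>2 \<le> (1 + x) * 1"
    using assms by (intro mult_left_mono) (auto simp: abs_square_le_1)
  then show ?thesis using assms by auto
qed

lemma half_plus_integrable:
  fixes h :: "real \<Rightarrow> real"
  assumes "continuous_on {-1..1} h" "x \<in> {-1..1}"
  shows "(\<lambda>t. h (-1 + (1 + x) * (sin t)\<^sup>2) * sin t ^ d) integrable_on {0..pi/2}"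
  using assms half_plus_node
  by (intro integrable_continuous_interval continuous_intros continuous_on_compose2[OF assms(1)] image_subsetI)

lemma half_plus_poly:
  "half_plus d (\<lambda>u. \<Sum>k\<le>n. a k * (1 + u) ^ k) x = (\<Sum>k\<le>n. a k * (2 * wallis 0 (2 * k + d)) * (1 + x) ^ (k + 1))"
proof -
  have "integral {0..pi/2} (\<lambda>t. (\<Sum>k\<le>n. a k * (1 + (-1 + (1 + x) * (sin t)\<^sup>2)) ^ k) * sin t ^ d)
      = integral {0..pi/2} (\<lambda>t. \<Sum>k\<le>n. (a k * (1 + x) ^ k) * (cos t ^ 0 * sin t ^ (2 * k + d)))"
    unfolding sum_distrib_right
    by (intro integral_cong sum.cong refl) (simp add: power_mult_distrib power_mult[symmetric] power_add)
  also have "\<dots> = (\<Sum>k\<le>n. (a k * (1 + x) ^ k) * wallis 0 (2 * k + d))"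
    unfolding wallis_def
    by (subst integral_sum; (intro ballI finite_atMost integrable_on_mult_right trig_power_integrable)?)
       (simp only: integral_mult_right)
  finally have int: "integral {0..pi/2} (\<lambda>t. (\<Sum>k\<le>n. a k * (1 + (-1 + (1 + x) * (sin t)\<^sup>2)) ^ k) * sin t ^ d)
      = (\<Sum>k\<le>n. (a k * (1 + x) ^ k) * wallis 0 (2 * k + d))" .
  show ?thesis
    unfolding half_plus_def int sum_distrib_left
    by (intro sum.cong refl) (simp add: algebra_simps)
qed

text \<open>
  Both sides are the Dirichlet integral
  \<open>\<Gamma>(1/2) \<Gamma>((p+1)/2) \<Gamma>((s+1)/2) / (4 \<Gamma>((p+s+3)/2))\<close>, which is symmetric in \<open>p\<close> and \<open>s\<close>. In the
  adjointness relation below this is why the factor does not depend on the power of \<open>1 + x\<close>.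
\<close>

lemma wallis_exchange:
  "wallis 0 p * wallis (p + 1) s = wallis 0 s * wallis p (s + 1)"
proof -
  have "Gamma (real p / 2 + 1) \<noteq> 0" "Gamma (real s / 2 + 1) \<noteq> 0"
    by (auto intro!: less_imp_neq[OF Gamma_real_pos, symmetric])
  moreover have args: "(real (p + 1) + 1) / 2 = real p / 2 + 1" "(real (s + 1) + 1) / 2 = real s / 2 + 1"
    "real (p + 1) + real s = real p + real (s + 1)"
    by (simp_all add: field_simps)
  ultimately show ?thesis
    unfolding wallis_Gamma args by simp
qed

lemma poly_taylor:
  fixes p :: "real poly"
  shows "poly p x = (\<Sum>k\<le>degree p. coeff (pcompose p [:-1, 1:]) k * (1 + x) ^ k)"
    and "poly p x = (\<Sum>k\<le>degree p. coeff (pcompose p [:1, -1:]) k * (1 - x) ^ k)"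
proof -
  have "poly p x = poly (pcompose p [:-1, 1:]) (1 + x)" by (simp add: poly_pcompose)
  then show "poly p x = (\<Sum>k\<le>degree p. coeff (pcompose p [:-1, 1:]) k * (1 + x) ^ k)"
    by (simp add: poly_altdef degree_pcompose)
  have "poly p x = poly (pcompose p [:1, -1:]) (1 - x)" by (simp add: poly_pcompose)
  then show "poly p x = (\<Sum>k\<le>degree p. coeff (pcompose p [:1, -1:]) k * (1 - x) ^ k)"
    by (simp add: poly_altdef degree_pcompose)
qed

text \<open>
  Adjointness of the half-step operator between the two weights: on the powers of \<open>1 - x\<close> the adjoint
  is diagonal, hence it does not raise the degree of a polynomial.
\<close>

lemma half_plus_adjoint:
  "zint q (\<lambda>x. half_plus (q + 1) (poly p) x * (1 - x) ^ j) =
   2 * wallis 0 (2 * j + q) * zint (q + 1) (\<lambda>x. poly p x * (1 - x) ^ j)"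
proof -
  define a where "a k = coeff (pcompose p [:-1, 1:]) k" for k
  let ?n = "degree p"
  have p: "poly p = (\<lambda>x. \<Sum>k\<le>?n. a k * (1 + x) ^ k)"
    unfolding a_def by (rule ext) (rule poly_taylor(1))
  have "zint q (\<lambda>x. half_plus (q + 1) (poly p) x * (1 - x) ^ j) =
      zint q (\<lambda>x. \<Sum>k\<le>?n. (a k * (2 * wallis 0 (2 * k + (q + 1)))) * ((1 + x) ^ (k + 1) * (1 - x) ^ j))"
    unfolding p half_plus_poly sum_distrib_right by (simp only: mult.assoc)
  also have "\<dots> = (\<Sum>k\<le>?n. (a k * (2 * wallis 0 (2 * k + (q + 1)))) *
      (2 ^ (k + 1 + j + q + 1) * wallis (2 * (k + 1) + q) (2 * j + q)))"
    by (subst zint_sum; (intro continuous_intros finite_atMost)?) (simp only: zint_cmult zint_Bernstein)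
  also have "\<dots> = (\<Sum>k\<le>?n. 2 * wallis 0 (2 * j + q) * (a k *
      (2 ^ (k + j + (q + 1) + 1) * wallis (2 * k + (q + 1)) (2 * j + (q + 1)))))"
    using wallis_exchange[of "2 * _ + (q + 1)" "2 * j + q"]
    by (intro sum.cong refl) (simp add: algebra_simps)
  also have "\<dots> = 2 * wallis 0 (2 * j + q) * zint (q + 1) (\<lambda>x. \<Sum>k\<le>?n. a k * ((1 + x) ^ k * (1 - x) ^ j))"
    by (subst zint_sum; (intro continuous_intros finite_atMost)?) (simp only: zint_cmult zint_Bernstein sum_distrib_left)
  also have "(\<lambda>x. \<Sum>k\<le>?n. a k * ((1 + x) ^ k * (1 - x) ^ j)) = (\<lambda>x. poly p x * (1 - x) ^ j)"
    unfolding p sum_distrib_right by (simp only: mult.assoc)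
  finally show ?thesis .
qed

text \<open>
  By adjointness the image of the Gegenbauer polynomial of degree \<open>n\<close>, a polynomial of degree
  \<open>n + 1\<close>, is orthogonal to everything of degree less than \<open>n\<close>. So only two components remain. The one
  of degree \<open>n + 1\<close> is the leading coefficient; the other one is determined by the zero at \<open>-1\<close>.
\<close>

theorem half_plus_gegen:
  obtains a b where "a > 0" "b > 0"
    "\<And>x. half_plus (q + 1) (poly (gegen (q + 1) n)) x = a * poly (gegen q n) x + b * poly (gegen q (n + 1)) x"
proof -
  define p where "p = gegen (q + 1) n"
  have deg: "degree p = n" by (simp add: p_def degree_gegen)
  define P where "P = pcompose p [:-1, 1:]"
  have lead: "coeff P n = 1"
    using lead_coeff_comp[of "[:-1, 1:]" p] coeff_gegen_self[of "q + 1" n]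
    by (simp add: P_def degree_pcompose deg) (simp add: p_def degree_gegen)
  define w where "w k = coeff P k * (2 * wallis 0 (2 * k + (q + 1)))" for k
  define r where "r = (\<Sum>k\<le>n. smult (w k) ([:1, 1:] ^ (k + 1)))"
  have poly_r: "half_plus (q + 1) (poly p) x = poly r x" for x
  proof -
    have "poly p = (\<lambda>x. \<Sum>k\<le>n. coeff P k * (1 + x) ^ k)"
      unfolding P_def by (rule ext) (use poly_taylor(1)[of p] deg in simp)
    then have "half_plus (q + 1) (poly p) x = (\<Sum>k\<le>n. w k * (1 + x) ^ (k + 1))"
      unfolding w_def by (simp only: half_plus_poly)
    then show ?thesis by (simp add: r_def poly_sum poly_power algebra_simps)
  qed
  have deg_pow: "coeff ([:1, 1:] ^ k) i = (0::real)" if "i > k" for i k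
    using that by (intro coeff_eq_0) (simp add: degree_linear_power)
  have r_above: "coeff r i = 0" if "i > n + 1" for i
    unfolding r_def coeff_sum coeff_smult
  proof (intro sum.neutral ballI)
    fix k assume "k \<in> {..n}"
    then have "coeff ([:1, 1:] ^ (k + 1)) i = (0::real)" using that by (intro deg_pow) auto
    then show "w k * coeff ([:1, 1:] ^ (k + 1)) i = 0" by (simp only: mult_zero_right)
  qed
  have r_lead: "coeff r (n + 1) = w n"
  proof -
    have "coeff r (n + 1) = (\<Sum>k\<le>n. if k = n then w n else 0)"
      unfolding r_def coeff_sum coeff_smult
    proof (intro sum.cong refl)
      fix k assume "k \<in> {..n}"
      then have "coeff ([:1, 1:] ^ (k + 1)) (n + 1) = (of_bool (k = n) :: real)"
        using deg_pow[of "k + 1" "n + 1"] coeff_linear_power[of "1::real" "n + 1"]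
        by (cases "k = n") (auto simp del: power_Suc)
      then show "w k * coeff ([:1, 1:] ^ (k + 1)) (n + 1) = (if k = n then w n else 0)"
        by (simp only: of_bool_def) simp
    qed
    then show ?thesis by simp
  qed
  obtain c where c: "r = (\<Sum>k\<le>n + 1. smult (c k) (gegen q k))" "c (n + 1) = w n"
    using gegen_expansion[of "n + 1" r q] r_above r_lead by auto
  have low: "c k = 0" if k: "k < n" for k
  proof -
    have "zint q (\<lambda>x. poly r x * (1 - x) ^ j) = 0" if "j < n" for j
    proof -
      have "zint (q + 1) (\<lambda>x. poly p x * poly ([:1, -1:] ^ j) x) = 0"
        unfolding p_def
      proof (rule gegen_orthogonal_lower)
        fix i assume "i \<ge> n"
        moreover have "degree ([:1, -1:] ^ j :: real poly) \<le> j"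
          using degree_power_le[of "[:1, -1:] :: real poly" j] by simp
        ultimately show "coeff ([:1, -1:] ^ j) i = (0::real)"
          using that by (intro coeff_eq_0) linarith
      qed
      then have "zint (q + 1) (\<lambda>x. poly p x * (1 - x) ^ j) = 0" by (simp add: poly_power)
      with half_plus_adjoint[of q p j] show ?thesis by (simp only: poly_r mult_zero_right)
    qed
    note low_powers = this
    let ?b = "\<lambda>j. coeff (pcompose (gegen q k) [:1, -1:]) j"
    have "zint q (\<lambda>x. poly r x * poly (gegen q k) x) = zint q (\<lambda>x. \<Sum>j\<le>k. ?b j * (poly r x * (1 - x) ^ j))"
      unfolding poly_taylor(2)[of "gegen q k"] degree_gegen sum_distrib_left by (simp only: mult_ac)
    also have "\<dots> = (\<Sum>j\<le>k. ?b j * zint q (\<lambda>x. poly r x * (1 - x) ^ j))"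
      by (subst zint_sum; (intro continuous_intros finite_atMost)?) (simp only: zint_cmult)
    also have "\<dots> = 0"
      using low_powers k by (intro sum.neutral) auto
    finally have "zint q (\<lambda>x. poly r x * poly (gegen q k) x) = 0" .
    moreover have "zint q (\<lambda>x. poly r x * poly (gegen q k) x) =
        zint q (\<lambda>x. \<Sum>i\<le>n + 1. c i * (poly (gegen q i) x * poly (gegen q k) x))"
      unfolding c(1) poly_sum poly_smult sum_distrib_right by (simp only: mult.assoc)
    moreover have "\<dots> = (\<Sum>i\<le>n + 1. c i * zint q (\<lambda>x. poly (gegen q i) x * poly (gegen q k) x))"
      by (subst zint_sum; (intro continuous_intros finite_atMost)?) (simp only: zint_cmult)
    moreover have "\<dots> = (\<Sum>i\<in>{k}. c i * zint q (\<lambda>x. poly (gegen q i) x * poly (gegen q k) x))"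
      using k by (intro sum.mono_neutral_right) (auto simp: gegen_orthogonal)
    ultimately have "c k * zint q (\<lambda>x. (poly (gegen q k) x)\<^sup>2) = 0"
      by (simp add: power2_eq_square)
    then show ?thesis using gegen_norm_pos[of q k] by simp
  qed
  have r: "poly r x = c n * poly (gegen q n) x + w n * poly (gegen q (n + 1)) x" for x
  proof -
    have "(\<Sum>k\<in>{..<n}. c k * poly (gegen q k) x) = 0"
      using low by (intro sum.neutral) auto
    moreover have "poly r x = (\<Sum>k\<in>{..<n}. c k * poly (gegen q k) x) + c n * poly (gegen q n) x + c (n + 1) * poly (gegen q (n + 1)) x"
      unfolding c(1) by (simp add: poly_sum lessThan_Suc_atMost[symmetric])
    ultimately show ?thesis using c(2) by simp
  qed
  have w: "w n > 0" by (simp add: w_def lead wallis_pos)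
  \<comment> \<open>At \<open>-1\<close> the two Gegenbauer polynomials have opposite signs, so their coefficients in \<open>r\<close> have the
    same sign.\<close>
  have "poly r (-1) = 0" by (simp add: poly_r[symmetric] half_plus_def)
  then have "(-1) ^ n * (c n * poly (gegen q n) 1 - w n * poly (gegen q (n + 1)) 1) = 0"
    unfolding r poly_gegen_minus by (simp add: algebra_simps)
  then have "c n * poly (gegen q n) 1 = w n * poly (gegen q (n + 1)) 1" by simp
  moreover have "w n * poly (gegen q (n + 1)) 1 > 0"
    using w gegen_1_pos by (intro mult_pos_pos)
  ultimately have "c n > 0"
    using gegen_1_pos[of q n] by (metis zero_less_mult_pos2)
  then show thesis using that[OF _ w] poly_r r unfolding p_def by metis
qed

section \<open>The half-step operators on continuous functions\<close>

text \<open>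
  The substitution \<open>u = -1 + (1 + x) sin\<^sup>2 t\<close> absorbs both singular factors of the integrand.
\<close>

lemma half_plus_eq_LBINT:
  fixes h :: "real \<Rightarrow> real"
  assumes d: "d \<ge> 1" and l: "l = (real d - 1) / 2" and x: "-1 < x" "x \<le> 1"
    and h: "continuous_on {-1..1} h"
  shows "(1 + x) powr (- l + 1/2) * (LBINT u:{-1..x}. (x - u) powr (- (1/2)) * (1 + u) powr l * h u) = half_plus d h x"
proof -
  define g where "g t = -1 + (1 + x) * (sin t)\<^sup>2" for t
  define g' where "g' t = 2 * (1 + x) * (sin t * cos t)" for t
  define k where "k u = (x - u) powr (- (1/2)) * (1 + u) powr l" for u
  define C where "C = 2 * (1 + x) powr (l + 1/2)"
  have C: "C \<ge> 0" by (simp add: C_def)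
  have g0: "g 0 = -1" and g1: "g (pi/2) = x" by (simp_all add: g_def)
  have g_range: "g t \<in> {-1..1}" for t
    unfolding g_def using x by (intro half_plus_node) auto
  have dg: "(g has_real_derivative g' t) (at t)" for t
    unfolding g_def[abs_def] g'_def by (auto intro!: derivative_eq_intros)
  have cg': "continuous_on {0..pi/2} g'"
    unfolding g'_def[abs_def] by (intro continuous_intros)
  have g'_nonneg: "g' t \<ge> 0" if "t \<in> {0..pi/2}" for t
    unfolding g'_def using x that by (auto intro!: mult_nonneg_nonneg sin_ge_zero cos_ge_zero)
  have key: "k (g t) * g' t = C * sin t ^ d" if t: "t \<in> {0..<pi/2}" for t
  proof (cases "t = 0")
    case True
    then show ?thesis using d by (simp add: g'_def)
  next
    case False
    then have s: "sin t > 0" and c: "cos t > 0"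
      using t by (auto intro!: sin_gt_zero cos_gt_zero)
    have "x - g t = (1 + x) * (cos t)\<^sup>2"
      unfolding g_def cos_squared_eq by (simp add: algebra_simps)
    moreover have "((cos t)\<^sup>2) powr (- (1/2)) = 1 / cos t"
      using c by (simp only: powr_minus_divide powr_half_sqrt[OF zero_le_power2] real_sqrt_abs abs_of_pos)
    ultimately have k1: "(x - g t) powr (- (1/2)) = (1 + x) powr (- (1/2)) / cos t"
      using x c by (simp add: powr_mult)
    have "((sin t)\<^sup>2) powr l = sin t ^ (d - 1)"
    proof -
      have "((sin t)\<^sup>2) powr l = (sin t powr 2) powr l" using s by simp
      also have "\<dots> = sin t powr (2 * l)" by (rule powr_powr)
      also have "2 * l = real (d - 1)" using d by (simp add: l of_nat_diff)
      also have "sin t powr real (d - 1) = sin t ^ (d - 1)" using s by (rule powr_realpow)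
      finally show ?thesis .
    qed
    then have k2: "(1 + g t) powr l = (1 + x) powr l * sin t ^ (d - 1)"
      using x s by (simp add: g_def powr_mult)
    have e: "(1 + x) powr (l + 1/2) = (1 + x) powr (- (1/2)) * (1 + x) powr l * (1 + x)"
    proof -
      have "(1 + x) powr (- (1/2)) * (1 + x) powr l * (1 + x) powr 1 = (1 + x) powr (- (1/2) + l + 1)"
        by (simp only: powr_add)
      then show ?thesis using x by (simp add: add.commute)
    qed
    have "sin t ^ d = sin t ^ (d - 1) * sin t"
      using d by (metis Suc_diff_1 less_eq_Suc_le One_nat_def power_Suc2)
    then show ?thesis
      unfolding k_def k1 k2 g'_def C_def e using c by simp
  qed
  have k_nonneg: "k u \<ge> 0" for u by (simp add: k_def)
  have k_meas [measurable]: "k \<in> borel_measurable borel"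
    unfolding k_def[abs_def] by measurable
  have bound: "k (g t) * g' t * indicator {0..pi/2} t \<le> C * indicator {0..pi/2} t" for t
  proof (cases "t \<in> {0..<pi/2}")
    case True
    then have "sin t ^ d \<le> 1" by (intro power_le_one sin_ge_zero) auto
    then show ?thesis using key[OF True] C True by (simp add: mult_left_le)
  next
    case False
    then consider "t = pi/2" | "t \<notin> {0..pi/2}" by force
    then show ?thesis
    proof cases
      case 1
      show ?thesis unfolding 1 using C by (simp add: g'_def)
    next
      case 2
      then show ?thesis by (simp only: indicator_simps if_False mult_zero_right order_refl not_False_eq_True)
    qed
  qed
  \<comment> \<open>The kernel is integrable because its image under the substitution is bounded by \<open>C\<close>.\<close>
  have k_int: "set_integrable lborel {-1..x} k"
    unfolding set_integrable_def
  proof (rule integrableI_nonneg)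
    have "(\<integral>\<^sup>+u. ennreal (indicator {-1..x} u *\<^sub>R k u) \<partial>lborel) = (\<integral>\<^sup>+u. ennreal (k u * indicator {g 0..g (pi/2)} u) \<partial>lborel)"
      by (simp add: g0 g1 mult.commute)
    also have "\<dots> = (\<integral>\<^sup>+t. ennreal (k (g t) * g' t * indicator {0..pi/2} t) \<partial>lborel)"
      by (rule nn_integral_substitution[OF _ dg cg' g'_nonneg]) (auto simp: set_borel_measurable_def)
    also have "\<dots> \<le> (\<integral>\<^sup>+t. ennreal (C * indicator {0..pi/2} t) \<partial>lborel)"
      by (intro nn_integral_mono ennreal_leI bound)
    also have "\<dots> = (\<integral>\<^sup>+t. ennreal C * indicator {0..pi/2} t \<partial>lborel)"
      by (intro nn_integral_cong) (auto simp: indicator_def)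
    also have "\<dots> < \<infinity>"
      by (subst nn_integral_cmult_indicator) (auto simp: ennreal_mult_less_top)
    finally show "(\<integral>\<^sup>+u. ennreal (indicator {-1..x} u *\<^sub>R k u) \<partial>lborel) < \<infinity>" .
  qed (auto simp: k_nonneg)
  have hx: "continuous_on {-1..x} h"
    using x by (intro continuous_on_subset[OF h]) auto
  obtain B where B: "\<forall>u\<in>{-1..x}. \<bar>h u\<bar> \<le> B"
    using compact_imp_bounded[OF compact_continuous_image[OF hx compact_Icc]]
    by (auto simp: bounded_iff)
  have F_int: "set_integrable lborel {-1..x} (\<lambda>u. k u * h u)"
    unfolding set_integrable_def
  proof (rule Bochner_Integration.integrable_bound)
    show "integrable lborel (\<lambda>u. B * (indicator {-1..x} u *\<^sub>R k u))"
      using k_int unfolding set_integrable_def by (intro integrable_mult_right)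
    have "(\<lambda>u. indicator {-1..x} u *\<^sub>R h u) \<in> borel_measurable borel"
      by (intro borel_measurable_continuous_on_indicator hx) auto
    then have "(\<lambda>u. k u * (indicator {-1..x} u *\<^sub>R h u)) \<in> borel_measurable borel"
      by (intro borel_measurable_times k_meas)
    then show "(\<lambda>u. indicator {-1..x} u *\<^sub>R (k u * h u)) \<in> borel_measurable lborel"
      by (simp add: mult_ac)
    show "AE u in lborel. norm (indicator {-1..x} u *\<^sub>R (k u * h u)) \<le> norm (B * (indicator {-1..x} u *\<^sub>R k u))"
    proof (intro always_eventually allI)
      fix u
      show "norm (indicator {-1..x} u *\<^sub>R (k u * h u)) \<le> norm (B * (indicator {-1..x} u *\<^sub>R k u))"
      proof (cases "u \<in> {-1..x}")
        case True
        then have "\<bar>h u\<bar> * k u \<le> \<bar>B\<bar> * k u"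
          using B True k_nonneg by (intro mult_right_mono) force+
        then show ?thesis using True k_nonneg[of u] by (simp add: abs_mult mult.commute)
      qed simp
    qed
  qed
  have cont: "continuous_on {0..pi/2} (\<lambda>t. C * (h (g t) * sin t ^ d))"
    unfolding g_def
    by (intro continuous_intros continuous_on_compose2[OF h])
       (use g_range in \<open>auto simp: g_def\<close>)
  have "(LBINT u:{-1..x}. k u * h u) = (LBINT u. (k u * h u) * indicator {g 0..g (pi/2)} u)"
    unfolding set_lebesgue_integral_def g0 g1 by (simp add: mult.commute)
  also have "\<dots> = (LBINT t. (k (g t) * h (g t)) * g' t * indicator {0..pi/2} t)"
    by (rule integral_substitution(2)[OF _ dg cg' g'_nonneg]) (use F_int in \<open>auto simp: g0 g1\<close>)
  also have "\<dots> = (LBINT t. indicator {0..pi/2} t *\<^sub>R (C * (h (g t) * sin t ^ d)))"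
  proof (rule Bochner_Integration.integral_cong_AE)
    have "set_integrable lborel {0..pi/2} (\<lambda>t. k (g t) * h (g t) * g' t)"
      by (rule integral_substitution(1)[OF _ dg cg' g'_nonneg]) (use F_int in \<open>auto simp: g0 g1\<close>)
    then show "(\<lambda>t. k (g t) * h (g t) * g' t * indicator {0..pi/2} t) \<in> borel_measurable lborel"
      unfolding set_integrable_def by (auto dest!: borel_measurable_integrable simp: mult.commute)
    show "(\<lambda>t. indicator {0..pi/2} t *\<^sub>R (C * (h (g t) * sin t ^ d))) \<in> borel_measurable lborel"
      using borel_measurable_continuous_on_indicator[OF _ cont] by simp
    have "AE t in lborel. t \<noteq> pi/2" by (rule AE_lborel_singleton)
    then show "AE t in lborel. k (g t) * h (g t) * g' t * indicator {0..pi/2} t =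
        indicator {0..pi/2} t *\<^sub>R (C * (h (g t) * sin t ^ d))"
    proof eventually_elim
      case (elim t)
      show ?case
      proof (cases "t \<in> {0..pi/2}")
        case True
        then have "k (g t) * g' t = C * sin t ^ d" using elim by (intro key) auto
        then show ?thesis using True by (simp add: mult_ac)
      qed simp
    qed
  qed
  also have "\<dots> = (LBINT t:{0..pi/2}. C * (h (g t) * sin t ^ d))"
    by (simp only: set_lebesgue_integral_def)
  also have "\<dots> = integral {0..pi/2} (\<lambda>t. C * (h (g t) * sin t ^ d))"
    by (rule set_borel_integral_eq_integral(2)[OF borel_integrable_atLeastAtMost'[OF cont]])
  also have "\<dots> = C * integral {0..pi/2} (\<lambda>t. h (g t) * sin t ^ d)"
    by (rule integral_mult_right)
  finally have main: "(LBINT u:{-1..x}. (x - u) powr (- (1/2)) * (1 + u) powr l * h u) =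
      C * integral {0..pi/2} (\<lambda>t. h (g t) * sin t ^ d)"
    by (simp only: k_def)
  have "(1 + x) powr (- l + 1/2) * C = 2 * ((1 + x) powr (- l + 1/2) * (1 + x) powr (l + 1/2))"
    by (simp add: C_def)
  also have "(1 + x) powr (- l + 1/2) * (1 + x) powr (l + 1/2) = 1 + x"
    using x by (simp add: powr_add[symmetric])
  finally show ?thesis
    unfolding main half_plus_def g_def by (simp add: mult.assoc[symmetric])
qed

lemma continuous_on_half_plus:
  assumes f: "continuous_on ({-1..1} \<times> UNIV) (\<lambda>(x, t). f x t)"
  shows "continuous_on ({-1..1} \<times> UNIV) (\<lambda>(x, t :: real). half_plus d (\<lambda>u. f u t) x)"
proof -
  have "continuous_on (({-1..1} \<times> UNIV) \<times> cbox 0 (pi/2))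
      (\<lambda>z. (\<lambda>(x, t). f x t) (-1 + (1 + fst (fst z)) * (sin (snd z))\<^sup>2, snd (fst z)))"
    by (rule continuous_on_compose2[OF f]) (use half_plus_node in \<open>auto intro!: continuous_intros\<close>)
  then have "continuous_on (({-1..1} \<times> UNIV) \<times> cbox 0 (pi/2))
      (\<lambda>(p, s). f (-1 + (1 + fst p) * (sin s)\<^sup>2) (snd p) * sin s ^ d)"
    unfolding case_prod_unfold by (intro continuous_intros) simp
  from integral_continuous_on_param[OF this]
  show ?thesis
    unfolding half_plus_def case_prod_unfold by (intro continuous_intros) simp
qed

lemma continuous_on_slice:
  assumes f: "continuous_on ({-1..1::real} \<times> (UNIV :: real set)) (\<lambda>(x, t). f x t)"
  shows "continuous_on {-1..1} (\<lambda>x. f x t)"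
proof -
  have "continuous_on {-1..1} (\<lambda>x. (\<lambda>(x, t). f x t) (x, t))"
    by (rule continuous_on_compose2[OF f]) (auto intro!: continuous_intros)
  then show ?thesis by simp
qed

lemma continuous_on_half_plus_1:
  fixes h :: "real \<Rightarrow> real"
  assumes h: "continuous_on {-1..1} h"
  shows "continuous_on {-1..1} (half_plus d h)"
proof -
  have "continuous_on ({-1..1} \<times> UNIV) (\<lambda>(x, t::real). h x)"
    unfolding case_prod_unfold by (rule continuous_on_compose2[OF h]) (auto intro!: continuous_intros)
  from continuous_on_slice[OF continuous_on_half_plus[OF this]] show ?thesis by simp
qed

lemma I_plus_eq_half_plus:
  assumes d: "d \<ge> 1" and l: "l = (real d - 1) / 2"
    and f: "continuous_on ({-1..1} \<times> UNIV) (\<lambda>(x, t). f x t)" and x: "x \<in> {-1..1}"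
  shows "I_plus l f x t = half_plus d (\<lambda>u. f u t) x"
proof -
  note h = continuous_on_slice[OF f, of t]
  have raw: "I_plus_raw l f y t = half_plus d (\<lambda>u. f u t) y" if "-1 < y" "y \<le> 1" for y
    unfolding I_plus_raw_def by (rule half_plus_eq_LBINT[OF d l that h])
  show ?thesis
  proof (cases "x = -1")
    case False
    then show ?thesis using x raw by (simp add: I_plus_def)
  next
    case True
    have "(half_plus d (\<lambda>u. f u t) \<longlongrightarrow> half_plus d (\<lambda>u. f u t) (-1)) (at_right (-1))"
      using continuous_on_half_plus_1[OF h, of d, unfolded continuous_on_def, rule_format, of "-1"]
      by (simp add: at_within_Icc_at_right)
    moreover have "\<forall>\<^sub>F y in at_right (-1). half_plus d (\<lambda>u. f u t) y = I_plus_raw l f y t"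
      unfolding eventually_at_right_field by (rule exI[of _ 1]) (simp add: raw)
    ultimately have "((\<lambda>y. I_plus_raw l f y t) \<longlongrightarrow> half_plus d (\<lambda>u. f u t) (-1)) (at_right (-1))"
      by (rule Lim_transform_eventually)
    then have "Lim (at_right (-1)) (\<lambda>y. I_plus_raw l f y t) = half_plus d (\<lambda>u. f u t) (-1)"
      by (intro tendsto_Lim) auto
    then show ?thesis using True by (simp add: I_plus_def)
  qed
qed

lemma I_minus_eq_half_minus:
  assumes d: "d \<ge> 1" and l: "l = (real d - 1) / 2"
    and f: "continuous_on ({-1..1} \<times> UNIV) (\<lambda>(x, t). f x t)" and x: "x \<in> {-1..1}"
  shows "I_minus l f x t = half_minus d (\<lambda>u. f u t) x"
proof -
  have h: "continuous_on {-1..1} (\<lambda>u. f (- u) t)"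
    by (rule continuous_on_compose2[OF continuous_on_slice[OF f, of t]]) (auto intro!: continuous_intros)
  have raw: "I_minus_raw l f y t = half_minus d (\<lambda>u. f u t) y" if "-1 \<le> y" "y < 1" for y
  proof -
    have S: "{u. - u \<in> {y..1}} = {-1..- y}" by auto
    have "I_minus_raw l f y t = (1 + (- y)) powr (- l + 1/2) *
        (LBINT u:{-1..- y}. (- y - u) powr (- (1/2)) * (1 + u) powr l * f (- u) t)"
      unfolding I_minus_raw_def set_integral_reflect[of "{y..1}"] S by (simp add: minus_diff_commute)
    also have "\<dots> = half_plus d (\<lambda>u. f (- u) t) (- y)"
      using that by (intro half_plus_eq_LBINT[OF d l _ _ h]) auto
    finally show ?thesis by (simp add: half_minus_def)
  qed
  show ?thesis
  proof (cases "x = 1")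
    case False
    then show ?thesis using x raw by (simp add: I_minus_def)
  next
    case True
    have "continuous_on {-1..1} (half_minus d (\<lambda>u. f u t))"
      unfolding half_minus_def
      by (rule continuous_on_compose2[OF continuous_on_half_plus_1[OF h]]) (auto intro!: continuous_intros)
    from this[unfolded continuous_on_def, rule_format, of 1]
    have "(half_minus d (\<lambda>u. f u t) \<longlongrightarrow> half_minus d (\<lambda>u. f u t) 1) (at_left 1)"
      by (simp add: at_within_Icc_at_left)
    moreover have "\<forall>\<^sub>F y in at_left 1. half_minus d (\<lambda>u. f u t) y = I_minus_raw l f y t"
      unfolding eventually_at_left_field by (rule exI[of _ "-1"]) (simp add: raw)
    ultimately have "((\<lambda>y. I_minus_raw l f y t) \<longlongrightarrow> half_minus d (\<lambda>u. f u t) 1) (at_left 1)"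
      by (rule Lim_transform_eventually)
    then have "Lim (at_left 1) (\<lambda>y. I_minus_raw l f y t) = half_minus d (\<lambda>u. f u t) 1"
      by (intro tendsto_Lim) auto
    then show ?thesis using True by (simp add: I_minus_def)
  qed
qed

section \<open>Expansion of positive definite functions\<close>

lemma zint_uniform_limit:
  assumes h: "\<And>N. continuous_on {-1..1} (h N)" and g: "continuous_on {-1..1} g"
    and lim: "uniform_limit {-1..1} h g sequentially"
  shows "(\<lambda>N. zint q (h N)) \<longlonglongrightarrow> zint q g"
proof (rule LIMSEQ_I)
  fix e :: real assume e: "e > 0"
  define w where "w = 2 * wallis 0 q"
  have w: "w > 0" by (simp add: w_def wallis_pos)
  have "\<forall>\<^sub>F N in sequentially. \<forall>x\<in>{-1..1}. dist (h N x) (g x) < e / (2 * w)"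
    using lim e w by (intro uniform_limitD) auto
  then obtain N0 where N0: "\<forall>N\<ge>N0. \<forall>x\<in>{-1..1}. \<bar>h N x - g x\<bar> < e / (2 * w)"
    by (auto simp: eventually_sequentially dist_real_def)
  have "norm (zint q (h N) - zint q g) < e" if "N \<ge> N0" for N
  proof -
    have "zint q (h N) - zint q g = zint q (\<lambda>x. h N x - g x)"
      by (rule zint_diff[OF h g, symmetric])
    moreover have "\<bar>zint q (\<lambda>x. h N x - g x)\<bar> \<le> e / (2 * w) * (2 * wallis 0 q)"
      using N0 that by (intro zint_abs_le continuous_intros h g) (auto intro: less_imp_le)
    then have "\<bar>zint q (\<lambda>x. h N x - g x)\<bar> \<le> e / (2 * w) * w" by (simp only: w_def)
    moreover have "e / (2 * w) * w = e / 2" using w by simp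
    ultimately show ?thesis using e by simp
  qed
  then show "\<exists>N0. \<forall>N\<ge>N0. norm (zint q (h N) - zint q g) < e" by blast
qed

lemma half_plus_uniform_limit:
  fixes h :: "nat \<Rightarrow> real \<Rightarrow> real"
  assumes h: "\<And>N. continuous_on {-1..1} (h N)" and g: "continuous_on {-1..1} g"
    and lim: "uniform_limit {-1..1} h g sequentially" and x: "x \<in> {-1..1}"
  shows "(\<lambda>N. half_plus d (h N) x) \<longlonglongrightarrow> half_plus d g x"
proof -
  have "uniform_limit {0..pi/2} (\<lambda>N t. h N (-1 + (1 + x) * (sin t)\<^sup>2) * sin t ^ d)
      (\<lambda>t. g (-1 + (1 + x) * (sin t)\<^sup>2) * sin t ^ d) sequentially"
  proof (rule uniform_limitI)
    fix e :: real assume "e > 0"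
    then have "\<forall>\<^sub>F N in sequentially. \<forall>x\<in>{-1..1}. dist (h N x) (g x) < e"
      using lim by (intro uniform_limitD)
    then show "\<forall>\<^sub>F N in sequentially. \<forall>t\<in>{0..pi/2}.
        dist (h N (-1 + (1 + x) * (sin t)\<^sup>2) * sin t ^ d) (g (-1 + (1 + x) * (sin t)\<^sup>2) * sin t ^ d) < e"
    proof eventually_elim
      case (elim N)
      show ?case
      proof
        fix t :: real
        have "\<bar>sin t ^ d\<bar> \<le> 1" by (simp add: power_abs power_le_one)
        then have "\<bar>h N (-1 + (1 + x) * (sin t)\<^sup>2) - g (-1 + (1 + x) * (sin t)\<^sup>2)\<bar> * \<bar>sin t ^ d\<bar>
            \<le> \<bar>h N (-1 + (1 + x) * (sin t)\<^sup>2) - g (-1 + (1 + x) * (sin t)\<^sup>2)\<bar>"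
          by (intro mult_left_le) auto
        also have "\<dots> < e" using elim half_plus_node[OF x, of t] by (simp add: dist_real_def)
        finally show "dist (h N (-1 + (1 + x) * (sin t)\<^sup>2) * sin t ^ d) (g (-1 + (1 + x) * (sin t)\<^sup>2) * sin t ^ d) < e"
          by (simp add: dist_real_def abs_mult[symmetric] left_diff_distrib)
      qed
    qed
  qed
  moreover have "continuous_on {0..pi/2} (\<lambda>t. h N (-1 + (1 + x) * (sin t)\<^sup>2) * sin t ^ d)" for N
    by (intro continuous_intros continuous_on_compose2[OF h] image_subsetI half_plus_node[OF x])
  ultimately obtain I J where IJ: "\<And>N. ((\<lambda>t. h N (-1 + (1 + x) * (sin t)\<^sup>2) * sin t ^ d) has_integral I N) {0..pi/2}"
    "((\<lambda>t. g (-1 + (1 + x) * (sin t)\<^sup>2) * sin t ^ d) has_integral J) {0..pi/2}" "I \<longlonglongrightarrow> J"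
    by (rule uniform_limit_integral) auto
  have "half_plus d (h N) x = 2 * (1 + x) * I N" for N
    unfolding half_plus_def using IJ(1)[of N] by (simp add: integral_unique)
  moreover have "half_plus d g x = 2 * (1 + x) * J"
    unfolding half_plus_def using IJ(2) by (simp add: integral_unique)
  ultimately show ?thesis using IJ(3) by (auto intro!: tendsto_intros)
qed

text \<open>
  The measures with density proportional to \<open>(1 + x)\<^sup>N\<close> concentrate at \<open>1\<close>.
\<close>

lemma zint_concentration:
  "(\<lambda>N. zint q (\<lambda>x. (1 + x) ^ N * poly p x) / zint q (\<lambda>x. (1 + x) ^ N)) \<longlonglongrightarrow> poly p 1"
proof -
  define r where "r N j = zint q (\<lambda>x. (1 + x) ^ N * (1 - x) ^ j) / zint q (\<lambda>x. (1 + x) ^ N)" for N j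
  have total: "zint q (\<lambda>x. (1 + x) ^ N) = 2 ^ (N + q + 1) * wallis (2 * N + q) q" for N
    using zint_Bernstein[of q N 0] by simp
  have r: "r N j = 2 ^ j * wallis (2 * N + q) (2 * j + q) / wallis (2 * N + q) q" for N j
    unfolding r_def zint_Bernstein total by (simp add: power_add)
  have r_0: "r N 0 = 1" for N
    using wallis_pos[of "2 * N + q" q] by (simp add: r)
  have r_Suc: "r N (Suc j) = (real (2 * j + q + 1) / real (N + (j + q + 1))) * r N j" for N j
  proof -
    have "wallis (2 * N + q) (2 * Suc j + q) =
        real (2 * j + q + 1) / (2 * real (N + (j + q + 1))) * wallis (2 * N + q) (2 * j + q)"
      using wallis_rec(2)[of "2 * N + q" "2 * j + q"] by (simp add: algebra_simps)
    then show ?thesis unfolding r by (simp del: of_nat_add of_nat_Suc)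
  qed
  have lim: "(\<lambda>N. r N j) \<longlonglongrightarrow> (if j = 0 then 1 else 0)" for j
  proof (induction j)
    case 0
    then show ?case by (simp add: r_0)
  next
    case (Suc j)
    have "(\<lambda>N. real (2 * j + q + 1) / real (N + (j + q + 1))) \<longlonglongrightarrow> 0"
      by (rule LIMSEQ_ignore_initial_segment[OF lim_const_over_n])
    from tendsto_mult[OF this Suc] show ?case unfolding r_Suc by simp
  qed
  let ?b = "\<lambda>j. coeff (pcompose p [:1, -1:]) j"
  have "zint q (\<lambda>x. (1 + x) ^ N * poly p x) / zint q (\<lambda>x. (1 + x) ^ N) = (\<Sum>j\<le>degree p. ?b j * r N j)" for N
  proof -
    have "zint q (\<lambda>x. (1 + x) ^ N * poly p x) = zint q (\<lambda>x. \<Sum>j\<le>degree p. ?b j * ((1 + x) ^ N * (1 - x) ^ j))"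
      unfolding poly_taylor(2)[of p] sum_distrib_left by (simp only: mult_ac)
    also have "\<dots> = (\<Sum>j\<le>degree p. ?b j * zint q (\<lambda>x. (1 + x) ^ N * (1 - x) ^ j))"
      by (subst zint_sum; (intro continuous_intros finite_atMost)?) (simp only: zint_cmult)
    finally show ?thesis by (simp add: r_def sum_divide_distrib)
  qed
  moreover have "(\<lambda>N. \<Sum>j\<le>degree p. ?b j * r N j) \<longlonglongrightarrow> (\<Sum>j\<le>degree p. ?b j * (if j = 0 then 1 else 0))"
    by (intro tendsto_intros lim)
  moreover have "(\<Sum>j\<le>degree p. ?b j * (if j = 0 then 1 else 0)) = poly p 1"
    using poly_taylor(2)[of p 1] by (simp add: power_0_left)
  ultimately show ?thesis by simp
qed

lemma zonal_psd_mult: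
  "zonal_psd m g \<Longrightarrow> zonal_psd m h \<Longrightarrow> zonal_psd m (\<lambda>x. g x * h x)"
  unfolding zonal_psd_def by (rule psd_mult)

lemma zonal_psd_one_plus_power: "zonal_psd m (\<lambda>x. (1 + x) ^ N)"
proof -
  have "psd (unit_sphere m) (\<lambda>\<xi> \<eta>. \<Sum>b\<in>{False, True}. if b then dot m \<xi> \<eta> else 1)"
    using psd_rank_one[of "unit_sphere m" "\<lambda>_. 1"] psd_dot[of "unit_sphere m" m]
    by (intro psd_sum) (rename_tac b, case_tac b, simp_all)
  then have "psd (unit_sphere m) (\<lambda>\<xi> \<eta>. 1 + dot m \<xi> \<eta>)" by simp
  then show ?thesis unfolding zonal_psd_def by (rule psd_power)
qed

definition gegen_coeff :: "nat \<Rightarrow> nat \<Rightarrow> (real \<Rightarrow> real) \<Rightarrow> real" where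
  "gegen_coeff q n h = zint q (\<lambda>x. h x * poly (gegen q n) x) / zint q (\<lambda>x. (poly (gegen q n) x)\<^sup>2)"

lemma gegen_coeff_nonneg:
  assumes "continuous_on {-1..1} h" "zonal_psd (q + 1) h"
  shows "gegen_coeff q n h \<ge> 0"
  unfolding gegen_coeff_def using assms zonal_psd_gegen
  by (intro divide_nonneg_pos gegen_norm_pos zint_nonneg_of_zonal_psd zonal_psd_mult continuous_intros) auto

text \<open>
  Integrating \<open>h\<close> against the density proportional to \<open>(1 + x)\<^sup>N\<close> gives at most \<open>h 1\<close>. This density is
  itself positive definite, so the integral is a sum of nonnegative terms, one for each degree. The
  weights of the coefficients of \<open>h\<close> tend to the values of the Gegenbauer polynomials at \<open>1\<close> as \<open>N\<close>
  grows.
\<close>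

lemma gegen_coeff_sum_le:
  assumes h: "continuous_on {-1..1} h" and pd: "zonal_psd (q + 1) h"
  shows "(\<Sum>n\<le>M. gegen_coeff q n h * poly (gegen q n) 1) \<le> h 1"
proof -
  define w where "w N n = zint q (\<lambda>x. (1 + x) ^ N * poly (gegen q n) x) / zint q (\<lambda>x. (1 + x) ^ N)" for N n
  have lim: "(\<lambda>N. \<Sum>n\<le>M. gegen_coeff q n h * w N n) \<longlonglongrightarrow> (\<Sum>n\<le>M. gegen_coeff q n h * poly (gegen q n) 1)"
    unfolding w_def by (intro tendsto_intros zint_concentration)
  have "(\<Sum>n\<le>M. gegen_coeff q n h * w N n) \<le> h 1" if N: "N \<ge> M" for N
  proof -
    define T where "T = zint q (\<lambda>x. (1 + x) ^ N)"
    have T: "T > 0"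
      using zint_Bernstein[of q N 0] wallis_pos by (simp add: T_def)
    have "coeff ([:1, 1:] ^ N) i = (0::real)" if "i > N" for i
      using that by (intro coeff_eq_0) (simp add: degree_linear_power)
    then obtain c where c: "[:1, 1:] ^ N = (\<Sum>k\<le>N. smult (c k) (gegen q k))"
      using gegen_expansion[of N "[:1, 1:] ^ N" q] by blast
    have \<Phi>: "(1 + x) ^ N = (\<Sum>k\<le>N. c k * poly (gegen q k) x)" for x
      using arg_cong[OF c, of "\<lambda>p. poly p x"] by (simp add: poly_power poly_sum)
    have cw: "c k * zint q (\<lambda>x. (poly (gegen q k) x)\<^sup>2) = zint q (\<lambda>x. (1 + x) ^ N * poly (gegen q k) x)"
      if "k \<le> N" for k
    proof -
      have "zint q (\<lambda>x. (1 + x) ^ N * poly (gegen q k) x) =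
          zint q (\<lambda>x. \<Sum>i\<le>N. c i * (poly (gegen q i) x * poly (gegen q k) x))"
        unfolding \<Phi> sum_distrib_right by (simp only: mult.assoc)
      also have "\<dots> = (\<Sum>i\<le>N. c i * zint q (\<lambda>x. poly (gegen q i) x * poly (gegen q k) x))"
        by (subst zint_sum; (intro continuous_intros finite_atMost)?) (simp only: zint_cmult)
      also have "\<dots> = (\<Sum>i\<in>{k}. c i * zint q (\<lambda>x. poly (gegen q i) x * poly (gegen q k) x))"
        using that by (intro sum.mono_neutral_right) (auto simp: gegen_orthogonal)
      finally show ?thesis by (simp add: power2_eq_square)
    qed
    have wpos: "w N n \<ge> 0" for n
      unfolding w_def T_def[symmetric] using T
      by (intro divide_nonneg_pos zint_nonneg_of_zonal_psd zonal_psd_mult zonal_psd_one_plus_power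
          zonal_psd_gegen continuous_intros)
    have summand: "gegen_coeff q k h * w N k * T = c k * zint q (\<lambda>x. h x * poly (gegen q k) x)" if "k \<le> N" for k
      using cw[OF that] T gegen_norm_pos[of q k]
      unfolding gegen_coeff_def w_def T_def[symmetric] by (simp add: field_simps)
    have "(\<Sum>n\<le>M. gegen_coeff q n h * w N n) * T \<le> (\<Sum>n\<le>N. gegen_coeff q n h * w N n) * T"
      using N T gegen_coeff_nonneg[OF h pd] wpos by (intro mult_right_mono sum_mono2) auto
    also have "\<dots> = (\<Sum>k\<le>N. c k * zint q (\<lambda>x. h x * poly (gegen q k) x))"
      unfolding sum_distrib_right by (intro sum.cong refl summand) auto
    also have "\<dots> = zint q (\<lambda>x. \<Sum>k\<le>N. c k * (h x * poly (gegen q k) x))"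
      by (subst zint_sum; (intro continuous_intros finite_atMost h)?) (simp only: zint_cmult)
    also have "\<dots> = zint q (\<lambda>x. h x * (1 + x) ^ N)"
      unfolding \<Phi> sum_distrib_left by (simp only: mult_ac)
    also have "\<dots> \<le> zint q (\<lambda>x. h 1 * (1 + x) ^ N)"
    proof (intro zint_mono continuous_intros h mult_right_mono)
      fix x :: real assume "x \<in> {-1..1}"
      then show "h x \<le> h 1" "0 \<le> (1 + x) ^ N" using zonal_psd_abs_le[OF pd] by (auto simp: abs_le_iff)
    qed
    also have "\<dots> = h 1 * T" by (simp add: zint_cmult T_def)
    finally show ?thesis using T by simp
  qed
  then show ?thesis
    by (intro tendsto_upperbound[OF lim]) (auto intro: eventually_sequentiallyI)
qed

text \<open>
  The Gegenbauer polynomials span all polynomials, which are uniformly dense; a continuous function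
  orthogonal to all of them is orthogonal to itself.
\<close>

lemma zint_gegen_complete:
  assumes e: "continuous_on {-1..1} e" and orth: "\<And>n. zint q (\<lambda>x. e x * poly (gegen q n) x) = 0"
    and x: "x \<in> {-1..1}"
  shows "e x = (0::real)"
proof -
  have poly: "zint q (\<lambda>x. e x * poly p x) = 0" for p
  proof -
    obtain c where c: "p = (\<Sum>k\<le>degree p. smult (c k) (gegen q k))"
      using gegen_expansion[of "degree p" p q] coeff_eq_0 by blast
    have "zint q (\<lambda>x. e x * poly p x) = zint q (\<lambda>x. \<Sum>k\<le>degree p. c k * (e x * poly (gegen q k) x))"
      by (subst c) (simp add: poly_sum sum_distrib_left mult_ac)
    also have "\<dots> = (\<Sum>k\<le>degree p. c k * zint q (\<lambda>x. e x * poly (gegen q k) x))"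
      by (subst zint_sum; (intro continuous_intros finite_atMost e)?) (simp only: zint_cmult)
    finally show ?thesis by (simp add: orth)
  qed
  obtain B where B: "\<forall>x\<in>{-1..1}. \<bar>e x\<bar> \<le> B"
    using compact_imp_bounded[OF compact_continuous_image[OF e compact_Icc]] by (auto simp: bounded_iff)
  have B0: "B \<ge> 0" using B[rule_format, of 0] by simp
  have "zint q (\<lambda>x. (e x)\<^sup>2) = 0"
  proof -
    have "\<bar>zint q (\<lambda>x. (e x)\<^sup>2)\<bar> \<le> \<epsilon> * (B * (2 * wallis 0 q))" if \<epsilon>: "\<epsilon> > 0" for \<epsilon>
    proof -
      obtain p where p: "\<And>x. x \<in> {-1..1} \<Longrightarrow> \<bar>e x - poly p x\<bar> < \<epsilon>"
        using poly_approximation[OF e \<epsilon>] by blast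
      have "zint q (\<lambda>x. (e x)\<^sup>2) = zint q (\<lambda>x. (e x)\<^sup>2) - zint q (\<lambda>x. e x * poly p x)"
        by (simp add: poly)
      also have "\<dots> = zint q (\<lambda>x. (e x)\<^sup>2 - e x * poly p x)"
        by (intro zint_diff[symmetric] continuous_intros e)
      also have "\<bar>\<dots>\<bar> \<le> B * \<epsilon> * (2 * wallis 0 q)"
      proof (rule zint_abs_le)
        show "continuous_on {-1..1} (\<lambda>x. (e x)\<^sup>2 - e x * poly p x)" by (intro continuous_intros e)
        fix x :: real assume x: "x \<in> {-1..1}"
        have "(e x)\<^sup>2 - e x * poly p x = e x * (e x - poly p x)" by (simp add: power2_eq_square right_diff_distrib)
        moreover have "\<bar>e x\<bar> * \<bar>e x - poly p x\<bar> \<le> B * \<epsilon>"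
          using B x p[OF x] B0 by (intro mult_mono) auto
        ultimately show "\<bar>(e x)\<^sup>2 - e x * poly p x\<bar> \<le> B * \<epsilon>"
          by (simp only: abs_mult)
      qed
      finally show ?thesis by (simp add: mult_ac)
    qed
    note bd = this
    define D where "D = B * (2 * wallis 0 q) + 1"
    have D: "D > 0" "B * (2 * wallis 0 q) \<le> D" using B0 wallis_pos[of 0 q] by (auto simp: D_def intro!: add_nonneg_pos)
    have "\<bar>zint q (\<lambda>x. (e x)\<^sup>2)\<bar> \<le> \<epsilon>" if \<epsilon>: "\<epsilon> > 0" for \<epsilon>
    proof -
      have "\<bar>zint q (\<lambda>x. (e x)\<^sup>2)\<bar> \<le> \<epsilon> / D * (B * (2 * wallis 0 q))" using \<epsilon> D by (intro bd) auto
      also have "\<dots> \<le> \<epsilon> / D * D" using \<epsilon> D by (intro mult_left_mono) auto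
      finally show ?thesis using D by simp
    qed
    then show ?thesis by (metis abs_le_zero_iff dense_ge)
  qed
  then show ?thesis by (rule zint_square_eq_0D[OF e _ x])
qed

lemma zonal_psd_lincomb_of_kernel:
  assumes "psd (unit_sphere m \<times> UNIV) (\<lambda>(\<xi>, s) (\<eta>, t). f (dot m \<xi> \<eta>) (s - t))" "finite F"
  shows "zonal_psd m (\<lambda>x. \<Sum>s\<in>F. \<Sum>t\<in>F. c s * c t * f x (s - t :: real))"
  using psd_lincomb[OF assms, of "unit_sphere m" "\<lambda>s \<xi>. (\<xi>, s)" c]
  unfolding zonal_psd_def by simp

text \<open>
  A quadratic form in the second variable leaves a positive definite function on the sphere, and its
  coefficient is the same quadratic form of the coefficients.
\<close>

lemma psd_gegen_coeff:
  fixes f :: "real \<Rightarrow> real \<Rightarrow> real"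
  assumes f: "continuous_on ({-1..1} \<times> UNIV) (\<lambda>(x, t). f x t)"
    and pd: "psd (unit_sphere (q + 1) \<times> UNIV) (\<lambda>(\<xi>, s) (\<eta>, t). f (dot (q + 1) \<xi> \<eta>) (s - t))"
  shows "psd UNIV (\<lambda>s t :: real. gegen_coeff q n (\<lambda>x. f x (s - t)))"
  unfolding psd_def
proof (intro conjI ballI allI impI)
  fix s t :: real
  have "f x (s - t) = f x (t - s)" if x: "x \<in> {-1..1}" for x
  proof -
    obtain \<xi> \<eta> where p: "\<xi> \<in> unit_sphere (q + 1)" "\<eta> \<in> unit_sphere (q + 1)" "dot (q + 1) \<xi> \<eta> = x"
      using sphere_pair_exists[OF x] .
    show ?thesis
      using psd_sym[OF pd, of "(\<xi>, s)" "(\<eta>, t)"] p by (simp add: dot_commute[of _ \<eta> \<xi>])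
  qed
  then show "gegen_coeff q n (\<lambda>x. f x (s - t)) = gegen_coeff q n (\<lambda>x. f x (t - s))"
    unfolding gegen_coeff_def by (intro arg_cong2[where f = "(/)"] zint_cong refl) simp
next
  fix F :: "real set" and c :: "real \<Rightarrow> real"
  assume F: "finite F"
  note h = continuous_on_slice[OF f]
  let ?g = "\<lambda>x. \<Sum>s\<in>F. \<Sum>t\<in>F. c s * c t * f x (s - t)"
  have "0 \<le> gegen_coeff q n ?g"
    by (intro gegen_coeff_nonneg zonal_psd_lincomb_of_kernel pd F continuous_intros h)
  also have "zint q (\<lambda>x. ?g x * poly (gegen q n) x) =
      (\<Sum>s\<in>F. \<Sum>t\<in>F. c s * c t * zint q (\<lambda>x. f x (s - t) * poly (gegen q n) x))"
  proof -
    have "zint q (\<lambda>x. ?g x * poly (gegen q n) x) =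
        zint q (\<lambda>x. \<Sum>s\<in>F. \<Sum>t\<in>F. c s * c t * (f x (s - t) * poly (gegen q n) x))"
      by (simp only: sum_distrib_right mult.assoc)
    also have "\<dots> = (\<Sum>s\<in>F. zint q (\<lambda>x. \<Sum>t\<in>F. c s * c t * (f x (s - t) * poly (gegen q n) x)))"
      by (intro zint_sum F continuous_intros h)
    also have "\<dots> = (\<Sum>s\<in>F. \<Sum>t\<in>F. zint q (\<lambda>x. c s * c t * (f x (s - t) * poly (gegen q n) x)))"
      by (intro sum.cong refl zint_sum F continuous_intros h)
    finally show ?thesis by (simp only: zint_cmult)
  qed
  then have "gegen_coeff q n ?g = (\<Sum>s\<in>F. \<Sum>t\<in>F. c s * c t * gegen_coeff q n (\<lambda>x. f x (s - t)))"
    unfolding gegen_coeff_def by (simp add: sum_divide_distrib)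
  finally show "0 \<le> (\<Sum>s\<in>F. \<Sum>t\<in>F. c s * c t * gegen_coeff q n (\<lambda>x. f x (s - t)))" .
qed

text \<open>
  Schoenberg's expansion. The series is dominated by its value at \<open>(1, 0)\<close>, which converges because its
  partial sums are bounded; hence it converges uniformly, and its sum has the same coefficients as \<open>f\<close>.
\<close>

theorem schoenberg_expansion:
  fixes f :: "real \<Rightarrow> real \<Rightarrow> real"
  assumes f: "continuous_on ({-1..1} \<times> UNIV) (\<lambda>(x, t). f x t)"
    and pd: "psd (unit_sphere (q + 1) \<times> UNIV) (\<lambda>(\<xi>, s) (\<eta>, t). f (dot (q + 1) \<xi> \<eta>) (s - t))"
  shows "uniform_limit {-1..1} (\<lambda>N x. \<Sum>n<N. gegen_coeff q n (\<lambda>y. f y t) * poly (gegen q n) x)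
    (\<lambda>x. f x t) sequentially"
proof -
  define a where "a n s = gegen_coeff q n (\<lambda>y. f y s)" for n s
  note h = continuous_on_slice[OF f]
  have a_psd: "psd UNIV (\<lambda>s t. a n (s - t))" for n
    unfolding a_def by (rule psd_gegen_coeff[OF f pd])
  have a_le: "\<bar>a n t\<bar> \<le> a n 0" for n
    using psd_abs_le[OF a_psd[of n], of t 0] by simp
  have a0: "a n 0 \<ge> 0" for n using a_le[of n] by (meson abs_ge_zero order_trans)
  have pd0: "zonal_psd (q + 1) (\<lambda>x. f x 0)"
    using zonal_psd_lincomb_of_kernel[OF pd, of "{0}" "\<lambda>_. 1"] by simp
  have summable: "summable (\<lambda>n. a n 0 * poly (gegen q n) 1)"
  proof (rule summableI_nonneg_bounded)
    show nonneg: "0 \<le> a n 0 * poly (gegen q n) 1" for n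
      by (rule mult_nonneg_nonneg[OF a0 less_imp_le[OF gegen_1_pos]])
    show "(\<Sum>i<n. a i 0 * poly (gegen q i) 1) \<le> f 1 0" for n
    proof -
      have "(\<Sum>i<n. a i 0 * poly (gegen q i) 1) \<le> (\<Sum>i\<le>n. a i 0 * poly (gegen q i) 1)"
        by (intro sum_mono2 nonneg) auto
      also have "\<dots> \<le> f 1 0"
        unfolding a_def by (rule gegen_coeff_sum_le[OF h pd0])
      finally show ?thesis .
    qed
  qed
  define F where "F x = (\<Sum>n. a n t * poly (gegen q n) x)" for x
  have lim: "uniform_limit {-1..1} (\<lambda>N x. \<Sum>n<N. a n t * poly (gegen q n) x) F sequentially"
    unfolding F_def
  proof (rule Weierstrass_m_test[OF _ summable])
    fix n and x :: real assume "x \<in> {-1..1}"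
    then show "norm (a n t * poly (gegen q n) x) \<le> a n 0 * poly (gegen q n) 1"
      unfolding real_norm_def abs_mult using a_le a0 by (intro mult_mono gegen_abs_le) auto
  qed
  have contN: "continuous_on {-1..1} (\<lambda>x. \<Sum>n<N. a n t * poly (gegen q n) x)" for N
    by (intro continuous_intros)
  have contF: "continuous_on {-1..1} F"
    by (rule uniform_limit_theorem[OF _ lim]) (auto intro!: always_eventually contN)
  have orth: "zint q (\<lambda>x. (f x t - F x) * poly (gegen q k) x) = 0" for k
  proof -
    let ?G = "poly (gegen q k)"
    have "bounded (?G ` {-1..1})"
      by (intro compact_imp_bounded compact_continuous_image continuous_on_polynomial compact_Icc)
    moreover have "bounded (F ` {-1..1})"
      by (intro compact_imp_bounded compact_continuous_image contF compact_Icc)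
    ultimately have "uniform_limit {-1..1} (\<lambda>N x. (\<Sum>n<N. a n t * poly (gegen q n) x) * ?G x) (\<lambda>x. F x * ?G x) sequentially"
      by (intro uniform_lim_mult lim uniform_limit_const)
    then have "(\<lambda>N. zint q (\<lambda>x. (\<Sum>n<N. a n t * poly (gegen q n) x) * ?G x)) \<longlonglongrightarrow> zint q (\<lambda>x. F x * ?G x)"
      by (rule zint_uniform_limit[rotated 2]) (intro continuous_intros contF)+
    moreover have "zint q (\<lambda>x. (\<Sum>n<N. a n t * poly (gegen q n) x) * ?G x) = zint q (\<lambda>x. f x t * ?G x)" if "N > k" for N
    proof -
      have "zint q (\<lambda>x. (\<Sum>n<N. a n t * poly (gegen q n) x) * ?G x) =
          zint q (\<lambda>x. \<Sum>n<N. a n t * (poly (gegen q n) x * ?G x))"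
        by (simp only: sum_distrib_right mult.assoc)
      also have "\<dots> = (\<Sum>n<N. a n t * zint q (\<lambda>x. poly (gegen q n) x * ?G x))"
        by (subst zint_sum; (intro continuous_intros finite_lessThan)?) (simp only: zint_cmult)
      also have "\<dots> = (\<Sum>n\<in>{k}. a n t * zint q (\<lambda>x. poly (gegen q n) x * ?G x))"
        using that by (intro sum.mono_neutral_right) (auto simp: gegen_orthogonal)
      also have "\<dots> = zint q (\<lambda>x. f x t * ?G x)"
        using gegen_norm_pos[of q k] by (simp add: a_def gegen_coeff_def power2_eq_square)
      finally show ?thesis .
    qed
    then have "(\<lambda>N. zint q (\<lambda>x. (\<Sum>n<N. a n t * poly (gegen q n) x) * ?G x)) \<longlonglongrightarrow> zint q (\<lambda>x. f x t * ?G x)"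
      by (intro tendsto_eventually) (auto simp: eventually_sequentially intro!: exI[of _ "Suc k"])
    ultimately have "zint q (\<lambda>x. F x * ?G x) = zint q (\<lambda>x. f x t * ?G x)"
      by (rule LIMSEQ_unique)
    moreover have "zint q (\<lambda>x. f x t * ?G x - F x * ?G x) = zint q (\<lambda>x. f x t * ?G x) - zint q (\<lambda>x. F x * ?G x)"
      by (intro zint_diff continuous_intros h contF)
    ultimately show ?thesis by (simp add: left_diff_distrib)
  qed
  have "f x t - F x = 0" if "x \<in> {-1..1}" for x
    by (rule zint_gegen_complete[OF _ orth that]) (intro continuous_intros h contF)
  then have eq: "F x = f x t" if "x \<in> {-1..1}" for x using that by simp
  show ?thesis
    using lim unfolding a_def by (rule uniform_limit_cong'[THEN iffD1, rotated 2]) (use eq in auto)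
qed

section \<open>The half-step operators on positive definite functions\<close>

lemma half_plus_cmult_sum:
  assumes "finite A" "\<And>n. n \<in> A \<Longrightarrow> continuous_on {-1..1} (g n)" "x \<in> {-1..1}"
  shows "half_plus d (\<lambda>u. \<Sum>n\<in>A. a n * g n u) x = (\<Sum>n\<in>A. a n * half_plus d (g n) x)"
proof -
  have "integral {0..pi/2} (\<lambda>t. (\<Sum>n\<in>A. a n * g n (-1 + (1 + x) * (sin t)\<^sup>2)) * sin t ^ d)
      = integral {0..pi/2} (\<lambda>t. \<Sum>n\<in>A. a n * (g n (-1 + (1 + x) * (sin t)\<^sup>2) * sin t ^ d))"
    by (simp only: sum_distrib_right mult.assoc)
  also have "\<dots> = (\<Sum>n\<in>A. a n * integral {0..pi/2} (\<lambda>t. g n (-1 + (1 + x) * (sin t)\<^sup>2) * sin t ^ d))"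
    using assms by (subst integral_sum; (intro ballI integrable_on_mult_right half_plus_integrable)?)
      (simp_all only: integral_mult_right)
  finally show ?thesis
    unfolding half_plus_def by (simp add: sum_distrib_left mult_ac)
qed

lemma kernel_eq_dot:
  assumes "\<xi> \<in> unit_sphere m" "\<eta> \<in> unit_sphere m"
  shows "cos (geodesic_dist m \<xi> \<eta>) = dot m \<xi> \<eta>"
  using dot_bound[OF assms] by (simp add: geodesic_dist_def)

lemma pd_class_iff:
  "f \<in> pd_class m \<longleftrightarrow> continuous_on ({-1..1} \<times> UNIV) (\<lambda>(x, t). f x t) \<and>
     psd (unit_sphere m \<times> UNIV) (\<lambda>(\<xi>, s) (\<eta>, t). f (dot m \<xi> \<eta>) (s - t))"
proof -
  have "psd (unit_sphere m \<times> UNIV) (\<lambda>(\<xi>, s) (\<eta>, t). f (cos (geodesic_dist m \<xi> \<eta>)) (s - t)) \<longleftrightarrow>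
        psd (unit_sphere m \<times> UNIV) (\<lambda>(\<xi>, s) (\<eta>, t). f (dot m \<xi> \<eta>) (s - t))"
    by (rule iffI; erule psd_cong) (auto simp: kernel_eq_dot)
  then show ?thesis
    by (simp add: pd_class_def pos_def_kernel_iff_psd)
qed

theorem theorem3p1:
  fixes d :: nat and l :: real and f :: "real \<Rightarrow> real \<Rightarrow> real"
  assumes "d \<ge> 1"
    and "l = (real d - 1) / 2"
    and "f \<in> pd_class (d + 1)"
  shows "J_plus l f \<in> pd_class d \<and> J_minus l f \<in> pd_class d"
proof -
  obtain q where d: "d = q + 1" using assms(1) by (metis add.commute le_Suc_ex)
  have f: "continuous_on ({-1..1} \<times> UNIV) (\<lambda>(x, t). f x t)"
    and pd: "psd (unit_sphere (d + 1) \<times> UNIV) (\<lambda>(\<xi>, s) (\<eta>, t). f (dot (d + 1) \<xi> \<eta>) (s - t))"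
    using assms(3) by (auto simp: pd_class_iff)
  note h = continuous_on_slice[OF f]
  define a where "a n t = gegen_coeff d n (\<lambda>y. f y t)" for n t
  have a_psd: "psd UNIV (\<lambda>s t. a n (s - t))" for n
    unfolding a_def by (rule psd_gegen_coeff[OF f pd])
  have "\<forall>n. \<exists>\<alpha> \<beta>. \<alpha> > 0 \<and> \<beta> > 0 \<and>
      (\<forall>x. half_plus d (poly (gegen d n)) x = \<alpha> * poly (gegen q n) x + \<beta> * poly (gegen q (n + 1)) x)"
    unfolding d by (metis half_plus_gegen)
  then obtain \<alpha> \<beta> where pos: "\<And>n. \<alpha> n > 0" "\<And>n. \<beta> n > 0" and
    hp: "\<And>n x. half_plus d (poly (gegen d n)) x = \<alpha> n * poly (gegen q n) x + \<beta> n * poly (gegen q (n + 1)) x"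
    by metis
  \<comment> \<open>By parity the reflection only changes the sign of the component of degree \<open>n + 1\<close>. So in the sum
    and in the difference of the two operators one of the components cancels.\<close>
  have hm: "half_minus d (poly (gegen d n)) x = \<alpha> n * poly (gegen q n) x - \<beta> n * poly (gegen q (n + 1)) x" for n x
  proof -
    have "half_minus d (poly (gegen d n)) x = (-1) ^ n * half_plus d (poly (gegen d n)) (- x)"
      unfolding half_minus_def half_plus_def poly_gegen_minus by (simp add: mult.assoc)
    also have "\<dots> = ((-1) ^ n * (-1) ^ n) * (\<alpha> n * poly (gegen q n) x - \<beta> n * poly (gegen q (n + 1)) x)"
      unfolding hp poly_gegen_minus by (simp add: algebra_simps)
    also have "(-1 :: real) ^ n * (-1) ^ n = 1"
      by (simp add: power_mult_distrib[symmetric])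
    finally show ?thesis by simp
  qed
  have plus: "(\<lambda>N. \<Sum>n<N. a n t * half_plus d (poly (gegen d n)) x) \<longlonglongrightarrow> I_plus l f x t"
    and minus: "(\<lambda>N. \<Sum>n<N. a n t * half_minus d (poly (gegen d n)) x) \<longlonglongrightarrow> I_minus l f x t"
    if x: "x \<in> {-1..1}" for x t
  proof -
    have x': "- x \<in> {-1..1}" using x by auto
    have lim: "uniform_limit {-1..1} (\<lambda>N x. \<Sum>n<N. a n t * poly (gegen d n) x) (\<lambda>x. f x t) sequentially"
      unfolding a_def by (rule schoenberg_expansion[OF f pd])
    have "(\<lambda>N. half_plus d (\<lambda>x. \<Sum>n<N. a n t * poly (gegen d n) x) x) \<longlonglongrightarrow> half_plus d (\<lambda>x. f x t) x"
      by (rule half_plus_uniform_limit[OF _ h lim x]) (intro continuous_intros)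
    moreover have "half_plus d (\<lambda>x. \<Sum>n<N. a n t * poly (gegen d n) x) x =
        (\<Sum>n<N. a n t * half_plus d (poly (gegen d n)) x)" for N
      by (rule half_plus_cmult_sum[OF finite_lessThan continuous_on_polynomial x])
    ultimately show "(\<lambda>N. \<Sum>n<N. a n t * half_plus d (poly (gegen d n)) x) \<longlonglongrightarrow> I_plus l f x t"
      by (simp only: I_plus_eq_half_plus[OF assms(1,2) f x])
    have neg: "continuous_on {-1..1} (\<lambda>u. g (- u))" if "continuous_on {-1..1} g" for g :: "real \<Rightarrow> real"
      by (rule continuous_on_compose2[OF that]) (auto intro!: continuous_intros)
    have "uniform_limit {-1..1} (\<lambda>N x. \<Sum>n<N. a n t * poly (gegen d n) (- x)) (\<lambda>x. f (- x) t) sequentially"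
      using uniform_limit_compose'[OF lim, of uminus "{-1..1}"] by auto
    then have "(\<lambda>N. half_plus d (\<lambda>x. \<Sum>n<N. a n t * poly (gegen d n) (- x)) (- x)) \<longlonglongrightarrow> half_plus d (\<lambda>x. f (- x) t) (- x)"
      by (rule half_plus_uniform_limit[OF _ neg[OF h] _ x', rotated]) (intro continuous_intros)
    moreover have "half_plus d (\<lambda>x. \<Sum>n<N. a n t * poly (gegen d n) (- x)) (- x) =
        (\<Sum>n<N. a n t * half_minus d (poly (gegen d n)) x)" for N
      unfolding half_minus_def
      by (rule half_plus_cmult_sum[OF finite_lessThan neg[OF continuous_on_polynomial] x'])
    ultimately show "(\<lambda>N. \<Sum>n<N. a n t * half_minus d (poly (gegen d n)) x) \<longlonglongrightarrow> I_minus l f x t"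
      by (simp only: I_minus_eq_half_minus[OF assms(1,2) f x] half_minus_def)
  qed
  have cont_p: "continuous_on ({-1..1} \<times> UNIV) (\<lambda>(x, t). I_plus l f x t)"
    using continuous_on_half_plus[OF f, of d]
    by (rule continuous_on_cong[THEN iffD1, rotated 2]) (auto simp: I_plus_eq_half_plus[OF assms(1,2) f])
  have cont_m: "continuous_on ({-1..1} \<times> UNIV) (\<lambda>(x, t). I_minus l f x t)"
  proof -
    have "continuous_on ({-1..1} \<times> UNIV) (\<lambda>z. (\<lambda>(x, t). f x t) (- fst z, snd z))"
      by (rule continuous_on_compose2[OF f]) (auto intro!: continuous_intros)
    then have "continuous_on ({-1..1} \<times> UNIV) (\<lambda>(x, t). f (- x) t)"
      by (simp add: case_prod_unfold)
    from continuous_on_half_plus[OF this]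
    have "continuous_on ({-1..1} \<times> UNIV) (\<lambda>z. (\<lambda>(x, t). half_plus d (\<lambda>u. f (- u) t) x) (- fst z, snd z))"
      by (rule continuous_on_compose2) (auto intro!: continuous_intros)
    then show ?thesis
      by (rule continuous_on_cong[THEN iffD1, rotated 2])
         (auto simp: I_minus_eq_half_minus[OF assms(1,2) f] half_minus_def)
  qed
  have series_pd: "psd (unit_sphere d \<times> UNIV) (\<lambda>(\<xi>, s) (\<eta>, t). J (dot d \<xi> \<eta>) (s - t))"
    if J: "\<And>x t. x \<in> {-1..1} \<Longrightarrow> (\<lambda>N. \<Sum>n<N. \<gamma> n * (a n t * poly (gegen q (k n)) x)) \<longlonglongrightarrow> J x t"
      and \<gamma>: "\<And>n. \<gamma> n \<ge> 0" for J \<gamma> and k :: "nat \<Rightarrow> nat"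
  proof (rule psd_limit[where F = sequentially])
    let ?X = "unit_sphere d \<times> (UNIV :: real set)"
    have "psd ?X (\<lambda>z w. a n (snd z - snd w) * poly (gegen q (k n)) (dot d (fst z) (fst w)))" for n
    proof (rule psd_mult)
      show "psd ?X (\<lambda>z w. a n (snd z - snd w))"
        using psd_pullback[OF a_psd[of n], of ?X snd] by simp
      show "psd ?X (\<lambda>z w. poly (gegen q (k n)) (dot d (fst z) (fst w)))"
        using psd_pullback[OF zonal_psd_gegen[of q "k n", unfolded zonal_psd_def], of ?X fst] by (auto simp: d)
    qed
    then show "\<forall>\<^sub>F N in sequentially. psd ?X (\<lambda>z w. \<Sum>n<N. \<gamma> n * (a n (snd z - snd w) * poly (gegen q (k n)) (dot d (fst z) (fst w))))"
      by (intro always_eventually allI psd_sum psd_scale \<gamma>)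
  qed (use J dot_bound in \<open>auto simp: case_prod_unfold\<close>)
  have "J_plus l f \<in> pd_class d"
    unfolding pd_class_iff
  proof
    show "continuous_on ({-1..1} \<times> UNIV) (\<lambda>(x, t). J_plus l f x t)"
      using cont_p cont_m unfolding J_plus_def case_prod_unfold by (intro continuous_intros)
    show "psd (unit_sphere d \<times> UNIV) (\<lambda>(\<xi>, s) (\<eta>, t). J_plus l f (dot d \<xi> \<eta>) (s - t))"
    proof (rule series_pd[where \<gamma> = "\<lambda>n. 2 * \<alpha> n" and k = "\<lambda>n. n"])
      fix x t :: real assume x: "x \<in> {-1..1}"
      show "(\<lambda>N. \<Sum>n<N. 2 * \<alpha> n * (a n t * poly (gegen q n) x)) \<longlonglongrightarrow> J_plus l f x t"
        using tendsto_add[OF plus[OF x, of t] minus[OF x, of t]] unfolding hp hm J_plus_def sum.distrib[symmetric]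
        by (simp add: algebra_simps)
    qed (use pos in \<open>auto intro: less_imp_le\<close>)
  qed
  moreover have "J_minus l f \<in> pd_class d"
    unfolding pd_class_iff
  proof
    show "continuous_on ({-1..1} \<times> UNIV) (\<lambda>(x, t). J_minus l f x t)"
      using cont_p cont_m unfolding J_minus_def case_prod_unfold by (intro continuous_intros)
    show "psd (unit_sphere d \<times> UNIV) (\<lambda>(\<xi>, s) (\<eta>, t). J_minus l f (dot d \<xi> \<eta>) (s - t))"
    proof (rule series_pd[where \<gamma> = "\<lambda>n. 2 * \<beta> n" and k = "\<lambda>n. n + 1"])
      fix x t :: real assume x: "x \<in> {-1..1}"
      show "(\<lambda>N. \<Sum>n<N. 2 * \<beta> n * (a n t * poly (gegen q (n + 1)) x)) \<longlonglongrightarrow> J_minus l f x t"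
        using tendsto_diff[OF plus[OF x, of t] minus[OF x, of t]] unfolding hp hm J_minus_def sum_subtractf[symmetric]
        by (simp add: algebra_simps)
    qed (use pos in \<open>auto intro: less_imp_le\<close>)
  qed
  ultimately show ?thesis ..
qed

end
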